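(* Let $\mathcal{G}$ be the recursively defined class of simple graphs given in the context. A graph belongs to $\mathcal{G}$ if and only if it is uniformly $3$-connected.
   Context: All graphs are finite, undirected and loopless, but may contain parallel edges. Paths using different parallel edges are different paths. Two or more (distinct) paths are independent if every vertex contained in more than one of the paths is an endpoint of all the paths it is contained in. A graph $G$ is $3$-connected if $|V(G)|\ge 4$ and $G-S$ is connected for every $S\subseteq V(G)$ with $|S|\le 2$. A graph $G$ with at least $4$ vertices is uniformly $3$-connected if for every pair of distinct vertices of $G$ the maximum number of independent paths between them is exactly $3$. $G\cup H$ denotes the graph with vertex set $V(G)\cup V(H)$ and edge set $E(G)\cup E(H)$; $N(v)$ is the set of neighbors of $v$; $+$ and $-$ denote addition and deletion of vertices/edges. The class $\mathcal{G}$ of simple graphs is the smallest class such that: (1) If $G$ is a ($\,$simple) $3$-connected and $3$-regular graph, then $G\in\mathcal{G}$. (2) If $G_1,G_2\in\mathcal{G}$ have disjoint vertex sets, and $v_1\in V(G_1)$, $v_2\in V(G_2)$ are vertices with $N(v_1)=\{x_1,x_2,x_3\}$ and $N(v_2)=\{y_1,y_2,y_3\}$ (three distinct neighbors each), then $(G_1-v_1)\cup(G_2-v_2)+x_1y_1+x_2y_2+x_3y_3\in\mathcal{G}$. (3) If $G\in\mathcal{G}$ and $v,w,x\in V(G)$ are distinct vertices with $vw\in E(G)$ and $\deg(y)=3$ for all $y\in V(G)\setminus\{x\}$, and $u\notin V(G)$ is a new vertex, then $G+u-vw+uw+uv+ux\in\mathcal{G}$. *)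

theory Defs
  imports Main "HOL-Library.Multiset" "HOL-Library.Infinite_Typeclass"
begin

text \<open>
  Multigraphs are given by a vertex set and a multiset of edges, an edge being a two-element
  set of vertices; parallel edges are repeated elements of the multiset.
\<close>

record 'v mgraph =
  verts :: "'v set"
  edges :: "'v set multiset"

definition multigraph :: "'v mgraph \<Rightarrow> bool" where
  "multigraph G \<longleftrightarrow> finite (verts G) \<and> (\<forall>e \<in># edges G. e \<subseteq> verts G \<and> card e = 2)"

definition simple_graph :: "'v mgraph \<Rightarrow> bool" where
  "simple_graph G \<longleftrightarrow> multigraph G \<and> (\<forall>e. count (edges G) e \<le> 1)"

definition neighbors :: "'v mgraph \<Rightarrow> 'v \<Rightarrow> 'v set" where
  "neighbors G v = {w. {v, w} \<in># edges G}"

definition degree :: "'v mgraph \<Rightarrow> 'v \<Rightarrow> nat" where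
  "degree G v = size {#e \<in># edges G. v \<in> e#}"

definition regular :: "nat \<Rightarrow> 'v mgraph \<Rightarrow> bool" where
  "regular k G \<longleftrightarrow> (\<forall>v \<in> verts G. degree G v = k)"

definition del_verts :: "'v mgraph \<Rightarrow> 'v set \<Rightarrow> 'v mgraph" where
  "del_verts G S = \<lparr>verts = verts G - S, edges = {#e \<in># edges G. e \<inter> S = {}#}\<rparr>"

definition add_vert :: "'v mgraph \<Rightarrow> 'v \<Rightarrow> 'v mgraph" where
  "add_vert G v = G\<lparr>verts := insert v (verts G)\<rparr>"

definition add_edge :: "'v mgraph \<Rightarrow> 'v \<Rightarrow> 'v \<Rightarrow> 'v mgraph" where
  "add_edge G v w = G\<lparr>edges := add_mset {v, w} (edges G)\<rparr>"

definition del_edge :: "'v mgraph \<Rightarrow> 'v \<Rightarrow> 'v \<Rightarrow> 'v mgraph" where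
  "del_edge G v w = G\<lparr>edges := edges G - {#{v, w}#}\<rparr>"

definition graph_union :: "'v mgraph \<Rightarrow> 'v mgraph \<Rightarrow> 'v mgraph" where
  "graph_union G H = \<lparr>verts = verts G \<union> verts H, edges = edges G \<union># edges H\<rparr>"

text \<open>
  A path is a sequence of distinct vertices together with the sequence of edges it uses. The
  pair \<open>(e, i)\<close> with \<open>i < count (edges G) e\<close> denotes the \<open>i\<close>-th of the parallel edges joining
  the two elements of \<open>e\<close>, so paths using different parallel edges are different. A path
  between two vertices is always listed from the first to the second; hence for distinct ends
  there is exactly one such pair of lists for each path.
\<close>

type_synonym 'v path = "'v list \<times> ('v set \<times> nat) list"

definition path_verts :: "'v path \<Rightarrow> 'v set" where
  "path_verts P = set (fst P)"

definition path_ends :: "'v path \<Rightarrow> 'v set" where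
  "path_ends P = {hd (fst P), last (fst P)}"

definition is_path :: "'v mgraph \<Rightarrow> 'v path \<Rightarrow> bool" where
  "is_path G P \<longleftrightarrow> (case P of (vs, es) \<Rightarrow>
     set vs \<subseteq> verts G \<and> distinct vs \<and> length vs = Suc (length es) \<and>
     (\<forall>k < length es. case es ! k of (e, i) \<Rightarrow>
        e = {vs ! k, vs ! Suc k} \<and> i < count (edges G) e))"

definition paths_between :: "'v mgraph \<Rightarrow> 'v \<Rightarrow> 'v \<Rightarrow> 'v path set" where
  "paths_between G u v = {P. is_path G P \<and> hd (fst P) = u \<and> last (fst P) = v}"

definition independent_paths :: "'v path set \<Rightarrow> bool" where
  "independent_paths \<P> \<longleftrightarrow>
     (\<forall>x. (\<exists>P \<in> \<P>. \<exists>Q \<in> \<P>. P \<noteq> Q \<and> x \<in> path_verts P \<and> x \<in> path_verts Q) \<longrightarrow>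
          (\<forall>P \<in> \<P>. x \<in> path_verts P \<longrightarrow> x \<in> path_ends P))"

text \<open>
  For distinct vertices of a finite graph the maximum is over a finite set containing \<open>0\<close>.
\<close>

definition max_independent_paths :: "'v mgraph \<Rightarrow> 'v \<Rightarrow> 'v \<Rightarrow> nat" where
  "max_independent_paths G u v =
     Max {card \<P> | \<P>. finite \<P> \<and> \<P> \<subseteq> paths_between G u v \<and> independent_paths \<P>}"

definition uniformly_3_connected :: "'v mgraph \<Rightarrow> bool" where
  "uniformly_3_connected G \<longleftrightarrow> card (verts G) \<ge> 4 \<and>
     (\<forall>u \<in> verts G. \<forall>v \<in> verts G. u \<noteq> v \<longrightarrow> max_independent_paths G u v = 3)"

definition connected_graph :: "'v mgraph \<Rightarrow> bool" where
  "connected_graph G \<longleftrightarrow> verts G \<noteq> {} \<and>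
     (\<forall>u \<in> verts G. \<forall>v \<in> verts G. paths_between G u v \<noteq> {})"

definition three_connected :: "'v mgraph \<Rightarrow> bool" where
  "three_connected G \<longleftrightarrow> card (verts G) \<ge> 4 \<and>
     (\<forall>S \<subseteq> verts G. card S \<le> 2 \<longrightarrow> connected_graph (del_verts G S))"

text \<open>
  The vertex type should be infinite: the second rule needs disjoint copies and the third rule
  a new vertex. Over an infinite vertex type the class is closed under isomorphism.
\<close>

inductive_set graph_class :: "'v mgraph set" where
  cubic:
    "simple_graph G \<Longrightarrow> three_connected G \<Longrightarrow> regular 3 G \<Longrightarrow> G \<in> graph_class"
| join:
    "G1 \<in> graph_class \<Longrightarrow> G2 \<in> graph_class \<Longrightarrow> verts G1 \<inter> verts G2 = {} \<Longrightarrow>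
     v1 \<in> verts G1 \<Longrightarrow> v2 \<in> verts G2 \<Longrightarrow>
     distinct [x1, x2, x3] \<Longrightarrow> neighbors G1 v1 = {x1, x2, x3} \<Longrightarrow>
     distinct [y1, y2, y3] \<Longrightarrow> neighbors G2 v2 = {y1, y2, y3} \<Longrightarrow>
     add_edge (add_edge (add_edge
       (graph_union (del_verts G1 {v1}) (del_verts G2 {v2})) x1 y1) x2 y2) x3 y3
       \<in> graph_class"
| extend:
    "G \<in> graph_class \<Longrightarrow> {v, w, x} \<subseteq> verts G \<Longrightarrow> distinct [v, w, x] \<Longrightarrow>
     {v, w} \<in># edges G \<Longrightarrow> (\<forall>y \<in> verts G - {x}. degree G y = 3) \<Longrightarrow> u \<notin> verts G \<Longrightarrow>
     add_edge (add_edge (add_edge (del_edge (add_vert G u) v w) u w) u v) u x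
       \<in> graph_class"

end

theory Submission
  imports Defs
begin

text \<open>
  For disjoint nonempty vertex sets \<open>X\<close>, \<open>Y\<close> count the vertices outside \<open>X \<union> Y\<close> plus the
  edges between \<open>X\<close> and \<open>Y\<close>. By Menger's theorem (Goering's short proof, by induction on the
  edges), \<open>G\<close> is uniformly 3-connected iff this order is never below 3 and any two vertices are
  separated by a pair of order 3. The order is submodular.

  Both composition rules preserve this condition. Conversely, suppose it holds. If some partition
  of the vertices into two sides of size at least 2 has only three crossing edges, these edges form
  a matching, and contracting either side yields the two graphs of the join rule. Otherwise at most
  one vertex \<open>x\<close> has degree at least 4: among the pairs of order 3 having such a vertex on both
  sides take one with \<open>X\<close> minimum and then \<open>Y\<close> maximum; uncrossing it with a pair that separates
  a high-degree vertex of \<open>X\<close> from a high-degree separator vertex produces a 3-edge cut. If such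
  an \<open>x\<close> exists, any neighbour of \<open>x\<close> can be removed by the inverse of the extension rule;
  if not, \<open>G\<close> is cubic.
\<close>

section \<open>Menger's theorem for directed graphs\<close>

text \<open>Mixed separations are used because a family of independent paths may contain edges
  joining its two ends: vertex separators alone say nothing about adjacent vertices, whereas here
  each crossing edge counts with its multiplicity. The obstacle is a separator vertex of degree at
  least 4. A vertex of degree at most 3 can always be moved to one side at no cost, so a pair of
  order 3 with only such separator vertices turns into a 3-edge cut; a high-degree vertex may have
  two edges to either side and stay stuck. The extremal choice controls these vertices: maximality
  of \<open>Y\<close> leaves every separator vertex two edges into \<open>X\<close>, and the choice
  as a whole leaves one corner of the two crossing pairs empty, so that only small configurations
  remain. Degree 4 at \<open>x\<close> is what permits the removal of a neighbour \<open>u\<close>: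
  a tight pair with \<open>x\<close> opposite to \<open>u\<close> and another vertex would extend to
  a 3-edge cut, and the degree of \<open>x\<close> keeps \<open>x\<close> alone from being one side
  of it.\<close>

definition walk :: "('a \<times> 'a) set \<Rightarrow> 'a set \<Rightarrow> 'a set \<Rightarrow> 'a list \<Rightarrow> bool" where
  "walk E A B p \<longleftrightarrow> p \<noteq> [] \<and> hd p \<in> A \<and> last p \<in> B \<and> successively (\<lambda>x y. (x, y) \<in> E) p"

definition separates :: "('a \<times> 'a) set \<Rightarrow> 'a set \<Rightarrow> 'a set \<Rightarrow> 'a set \<Rightarrow> bool" where
  "separates E A B S \<longleftrightarrow> (\<forall>p. walk E A B p \<longrightarrow> set p \<inter> S \<noteq> {})"

definition linkage :: "('a \<times> 'a) set \<Rightarrow> 'a set \<Rightarrow> 'a set \<Rightarrow> 'a list set \<Rightarrow> bool" where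
  "linkage E A B L \<longleftrightarrow> finite L \<and> (\<forall>p \<in> L. walk E A B p \<and> distinct p) \<and>
     (\<forall>p \<in> L. \<forall>q \<in> L. p \<noteq> q \<longrightarrow> set p \<inter> set q = {})"

lemma walk_prefix:
  assumes "walk E A B (p @ z # q)"
  shows "walk E A {z} (p @ [z])"
  using assms by (auto simp: walk_def successively_append_iff hd_append split: if_splits)

lemma walk_suffix:
  assumes "walk E A B (p @ z # q)"
  shows "walk E {z} B (z # q)"
  using assms by (auto simp: walk_def successively_append_iff)

lemma walk_join:
  assumes "walk E A {z} (p @ [z])" "walk E {z} B (z # q)"
  shows "walk E A B (p @ z # q)"
  using assms by (auto simp: walk_def successively_append_iff hd_append split: if_splits)

lemma walk_mono: "walk E A B p \<Longrightarrow> E \<subseteq> E' \<Longrightarrow> A \<subseteq> A' \<Longrightarrow> B \<subseteq> B' \<Longrightarrow> walk E' A' B' p"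
  unfolding walk_def using successively_mono[of "\<lambda>x y. (x, y) \<in> E" p "\<lambda>x y. (x, y) \<in> E'"] by blast

text \<open>Cuts a walk at its first use of \<open>(x, y)\<close>, so that the part up to
  \<open>x\<close> lives in the smaller graph.\<close>

lemma successively_first_new_edge:
  assumes "successively (\<lambda>a b. (a, b) \<in> E) p"
  shows "successively (\<lambda>a b. (a, b) \<in> E - {(x, y)}) p \<or>
    (\<exists>q r. p = q @ x # y # r \<and> successively (\<lambda>a b. (a, b) \<in> E - {(x, y)}) (q @ [x]))"
  using assms
proof (induction p)
  case (Cons a p)
  show ?case
  proof (cases p)
    case (Cons b r)
    with Cons.prems have ab: "(a, b) \<in> E" and sp: "successively (\<lambda>a b. (a, b) \<in> E) p" by auto
    show ?thesis
    proof (cases "(a, b) = (x, y)")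
      case True
      then show ?thesis using Cons by (intro disjI2 exI[of _ "[]"] exI[of _ r]) auto
    next
      case False
      from Cons.IH[OF sp] show ?thesis
      proof
        assume "successively (\<lambda>a b. (a, b) \<in> E - {(x, y)}) p"
        then show ?thesis using Cons ab False by auto
      next
        assume "\<exists>q r. p = q @ x # y # r \<and> successively (\<lambda>a b. (a, b) \<in> E - {(x, y)}) (q @ [x])"
        then obtain q r where qr: "p = q @ x # y # r"
          "successively (\<lambda>a b. (a, b) \<in> E - {(x, y)}) (q @ [x])" by blast
        have "successively (\<lambda>a b. (a, b) \<in> E - {(x, y)}) ((a # q) @ [x])"
          using qr Cons ab False by (cases q) auto
        then show ?thesis using qr(1) by (intro disjI2 exI[of _ "a # q"] exI[of _ r]) auto
      qed
    qed
  qed simp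
qed simp

text \<open>Mirror image: the part after the last use of the edge lives in the smaller
  graph.\<close>

lemma successively_last_new_edge:
  assumes "successively (\<lambda>a b. (a, b) \<in> E) p"
  shows "successively (\<lambda>a b. (a, b) \<in> E - {(x, y)}) p \<or>
    (\<exists>q r. p = q @ x # y # r \<and> successively (\<lambda>a b. (a, b) \<in> E - {(x, y)}) (y # r))"
  using assms
proof (induction p)
  case (Cons a p)
  show ?case
  proof (cases p)
    case (Cons b r)
    with Cons.prems have ab: "(a, b) \<in> E" and sp: "successively (\<lambda>a b. (a, b) \<in> E) p" by auto
    from Cons.IH[OF sp] show ?thesis
    proof
      assume *: "successively (\<lambda>a b. (a, b) \<in> E - {(x, y)}) p"
      show ?thesis
      proof (cases "(a, b) = (x, y)")
        case True
        then show ?thesis using Cons * by (intro disjI2 exI[of _ "[]"] exI[of _ r]) auto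
      next
        case False
        then show ?thesis using Cons ab * by auto
      qed
    next
      assume "\<exists>q r. p = q @ x # y # r \<and> successively (\<lambda>a b. (a, b) \<in> E - {(x, y)}) (y # r)"
      then show ?thesis by (metis append_Cons)
    qed
  qed simp
qed simp

text \<open>Every \<open>A\<close>-\<open>B\<close> walk has an initial segment from
  \<open>A\<close> to \<open>insert x S\<close> in the smaller graph: it either avoids the deleted
  edge and meets \<open>S\<close>, or it reaches \<open>x\<close> just before using that edge for
  the first time. \<open>W\<close> meets this segment.\<close>

lemma separates_before_edge:
  assumes S: "separates (E - {(x, y)}) A B S"
    and W: "separates (E - {(x, y)}) A (insert x S) W"
  shows "separates E A B W"
  unfolding separates_def
proof (intro allI impI)
  let ?E = "E - {(x, y)}"
  fix p assume p: "walk E A B p"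
  have "\<exists>q z r. p = q @ z # r \<and> walk (E - {(x, y)}) A (insert x S) (q @ [z])"
  proof -
    from p have "successively (\<lambda>a b. (a, b) \<in> E) p" by (simp add: walk_def)
    from successively_first_new_edge[OF this, of x y] show ?thesis
    proof
      assume "successively (\<lambda>a b. (a, b) \<in> E - {(x, y)}) p"
      then have w: "walk (E - {(x, y)}) A B p" using p by (simp add: walk_def)
      then obtain z where "z \<in> set p" "z \<in> S" using S by (auto simp: separates_def)
      then obtain q r where "p = q @ z # r" by (meson split_list)
      then show ?thesis using walk_prefix[of ?E A B q z r] w \<open>z \<in> S\<close>
          walk_mono[of ?E A "{z}" "q @ [z]" ?E A "insert x S"] by blast
    next
      assume "\<exists>q r. p = q @ x # y # r \<and> successively (\<lambda>a b. (a, b) \<in> E - {(x, y)}) (q @ [x])"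
      then obtain q r where qr: "p = q @ x # y # r"
        "successively (\<lambda>a b. (a, b) \<in> E - {(x, y)}) (q @ [x])" by blast
      then have "walk (E - {(x, y)}) A (insert x S) (q @ [x])"
        using p by (cases q) (auto simp: walk_def)
      then show ?thesis using qr by blast
    qed
  qed
  then obtain q z r where "p = q @ z # r" "walk (E - {(x, y)}) A (insert x S) (q @ [z])" by blast
  with W show "set p \<inter> W \<noteq> {}" unfolding separates_def by fastforce
qed

text \<open>The same argument for final segments: after its last use of the deleted edge the walk
  continues from \<open>y\<close>.\<close>

lemma separates_after_edge:
  assumes S: "separates (E - {(x, y)}) A B S"
    and W: "separates (E - {(x, y)}) (insert y S) B W"
  shows "separates E A B W"
  unfolding separates_def
proof (intro allI impI)
  let ?E = "E - {(x, y)}"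
  fix p assume p: "walk E A B p"
  have "\<exists>q z r. p = q @ z # r \<and> walk (E - {(x, y)}) (insert y S) B (z # r)"
  proof -
    from p have "successively (\<lambda>a b. (a, b) \<in> E) p" by (simp add: walk_def)
    from successively_last_new_edge[OF this, of x y] show ?thesis
    proof
      assume "successively (\<lambda>a b. (a, b) \<in> E - {(x, y)}) p"
      then have w: "walk (E - {(x, y)}) A B p" using p by (simp add: walk_def)
      then obtain z where "z \<in> set p" "z \<in> S" using S by (auto simp: separates_def)
      then obtain q r where "p = q @ z # r" by (meson split_list)
      then show ?thesis using walk_suffix[of ?E A B q z r] w \<open>z \<in> S\<close>
          walk_mono[of ?E "{z}" B "z # r" ?E "insert y S" B] by blast
    next
      assume "\<exists>q r. p = q @ x # y # r \<and> successively (\<lambda>a b. (a, b) \<in> E - {(x, y)}) (y # r)"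
      then obtain q r where qr: "p = (q @ [x]) @ y # r"
        "successively (\<lambda>a b. (a, b) \<in> E - {(x, y)}) (y # r)" by auto
      then have "walk (E - {(x, y)}) (insert y S) B (y # r)"
        using p by (auto simp: walk_def)
      then show ?thesis using qr by blast
    qed
  qed
  then obtain q z r where "p = q @ z # r" "walk (E - {(x, y)}) (insert y S) B (z # r)" by blast
  with W show "set p \<inter> W \<noteq> {}" unfolding separates_def by fastforce
qed

text \<open>Disjointness makes the choice of one vertex of \<open>C\<close> per path injective, so
  the cardinality bound forces all of \<open>C\<close> to be used.\<close>

lemma linkage_image_bij:
  assumes L: "linkage E A B L" and f: "\<And>p. p \<in> L \<Longrightarrow> f p \<in> set p \<inter> C"
    and C: "finite C" "card C \<le> card L"
  shows "bij_betw f L C"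
proof -
  have inj: "inj_on f L"
    using L f unfolding linkage_def inj_on_def by (metis IntD1 disjoint_iff)
  have "f ` L \<subseteq> C" using f by auto
  moreover have "card (f ` L) = card L" using inj by (rule card_image)
  ultimately show ?thesis using inj C by (metis bij_betw_def card_seteq)
qed

text \<open>If deleting \<open>(x, y)\<close> admits a separator \<open>S\<close> with fewer than
  \<open>k\<close> elements, then adding \<open>x\<close> or \<open>y\<close> to \<open>S\<close>
  gives exactly \<open>k\<close>. By induction \<open>k\<close> disjoint paths lead from
  \<open>A\<close> to \<open>insert x S\<close> and \<open>k\<close> from \<open>insert y S\<close>
  to \<open>B\<close>; they are glued at \<open>S\<close> and through the deleted edge.\<close>

theorem menger:
  assumes "finite E" and "\<And>S. finite S \<Longrightarrow> separates E A B S \<Longrightarrow> k \<le> card S"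
    and "finite A" "finite B"
  shows "\<exists>L. linkage E A B L \<and> card L = k"
  using assms
proof (induction "card E" arbitrary: E A B)
  case 0
  then have E: "E = {}" by simp
  have "separates E A B (A \<inter> B)"
    unfolding separates_def
  proof (intro allI impI)
    fix p assume p: "walk E A B p"
    obtain z where "p = [z]"
      using p E by (cases p; cases "tl p") (auto simp: walk_def)
    then show "set p \<inter> (A \<inter> B) \<noteq> {}" using p by (auto simp: walk_def)
  qed
  then have "k \<le> card (A \<inter> B)" using 0 by blast
  then obtain C where C: "C \<subseteq> A \<inter> B" "card C = k" "finite C"
    using obtain_subset_with_card_n by metis
  then have "linkage E A B ((\<lambda>z. [z]) ` C)"
    by (auto simp: linkage_def walk_def)
  moreover have "card ((\<lambda>z. [z]) ` C) = k" using C by (simp add: card_image inj_on_def)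
  ultimately show ?case by blast
next
  case (Suc n)
  then obtain x y where xy: "(x, y) \<in> E" by (metis card.empty equals0I nat.distinct(1) surj_pair)
  let ?E = "E - {(x, y)}"
  have n: "n = card ?E" using Suc xy by simp
  have fE: "finite ?E" using Suc by simp
  show ?case
  proof (cases "\<forall>S. finite S \<longrightarrow> separates ?E A B S \<longrightarrow> k \<le> card S")
    case True
    then obtain L where "linkage ?E A B L" "card L = k"
      using Suc.hyps(1)[OF n fE, of A B] Suc.prems by blast
    then show ?thesis using walk_mono[of ?E A B _ E A B]
      by (intro exI[of _ L]) (auto simp: linkage_def)
  next
    case False
    then obtain S where S: "finite S" "separates ?E A B S" "card S < k"
      by (metis not_le_imp_less)
    have kx: "k \<le> card W" if "finite W" "separates ?E A (insert x S) W" for W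
      using Suc.prems(2)[OF that(1) separates_before_edge[OF S(2) that(2)]] .
    have ky: "k \<le> card W" if "finite W" "separates ?E (insert y S) B W" for W
      using Suc.prems(2)[OF that(1) separates_after_edge[OF S(2) that(2)]] .
    obtain L where L: "linkage ?E A (insert x S) L" "card L = k"
      using Suc.hyps(1)[OF n fE kx] Suc.prems(3) S(1) by auto
    obtain M where M: "linkage ?E (insert y S) B M" "card M = k"
      using Suc.hyps(1)[OF n fE ky] Suc.prems(4) S(1) by auto
    \<comment> \<open>A target set separates trivially. Together with \<open>card S < k\<close> this
      puts \<open>x\<close> and \<open>y\<close> outside \<open>S\<close> and gives both sets size
      exactly \<open>k\<close>.\<close>
    have "separates ?E A (insert x S) (insert x S)" "separates ?E (insert y S) B (insert y S)"
      by (auto simp: separates_def walk_def dest: last_in_set hd_in_set)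
    then have "k \<le> card (insert x S)" "k \<le> card (insert y S)"
      using kx ky S(1) by auto
    then have xS: "x \<notin> S" and yS: "y \<notin> S"
      using S by (auto simp: card_insert_if split: if_splits)
    have cS: "card (insert x S) \<le> k" "card (insert y S) \<le> k"
      using S xS yS by auto
    have bL: "bij_betw last L (insert x S)"
      by (rule linkage_image_bij[OF L(1)]) (use L cS S in \<open>auto simp: linkage_def walk_def\<close>)
    have bM: "bij_betw hd M (insert y S)"
      by (rule linkage_image_bij[OF M(1)]) (use M cS S in \<open>auto simp: linkage_def walk_def\<close>)
    define f where "f = inv_into L last"
    define g where "g = inv_into M hd"
    have f: "f s \<in> L" "last (f s) = s" if "s \<in> insert x S" for s
      using bL that by (auto simp: f_def bij_betw_def inv_into_into f_inv_into_f)
    have g: "g s \<in> M" "hd (g s) = s" if "s \<in> insert y S" for s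
      using bM that by (auto simp: g_def bij_betw_def inv_into_into f_inv_into_f)
    have fw: "walk ?E A (insert x S) (f s)" "distinct (f s)" if "s \<in> insert x S" for s
      using f[OF that] L by (auto simp: linkage_def)
    have gw: "walk ?E (insert y S) B (g s)" "distinct (g s)" if "s \<in> insert y S" for s
      using g[OF that] M by (auto simp: linkage_def)
    have fd: "set (f s) \<inter> set (f s') = {}"
      if "s \<in> insert x S" "s' \<in> insert x S" "s \<noteq> s'" for s s'
      using f[OF that(1)] f[OF that(2)] L that(3) unfolding linkage_def by metis
    have gd: "set (g s) \<inter> set (g s') = {}"
      if "s \<in> insert y S" "s' \<in> insert y S" "s \<noteq> s'" for s s'
      using g[OF that(1)] g[OF that(2)] M that(3) unfolding linkage_def by metis
    have fS: "z = s" if "z \<in> set (f s)" "z \<in> insert x S" "s \<in> insert x S" for z s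
    proof (rule ccontr)
      assume "z \<noteq> s"
      moreover have "z \<in> set (f z)"
        using f[OF that(2)] fw[OF that(2)] by (metis last_in_set walk_def)
      ultimately show False using fd[OF that(2,3)] that(1) by auto
    qed
    have gS: "z = s" if "z \<in> set (g s)" "z \<in> insert y S" "s \<in> insert y S" for z s
    proof (rule ccontr)
      assume "z \<noteq> s"
      moreover have "z \<in> set (g z)"
        using g[OF that(2)] gw[OF that(2)] by (metis hd_in_set walk_def)
      ultimately show False using gd[OF that(2,3)] that(1) by auto
    qed
    \<comment> \<open>Paths of the two linkages meet only at a common end in \<open>S\<close>:
      otherwise the first path up to \<open>z\<close> followed by the second from \<open>z\<close>
      on would be an \<open>A\<close>-\<open>B\<close> walk missing \<open>S\<close>.\<close>
    have fg: "z = s \<and> z = s' \<and> z \<in> S"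
      if z: "z \<in> set (f s)" "z \<in> set (g s')" and s: "s \<in> insert x S" "s' \<in> insert y S" for z s s'
    proof -
      obtain p r where p: "f s = p @ z # r" using split_list[OF z(1)] by blast
      obtain q t where q: "g s' = q @ z # t" using split_list[OF z(2)] by blast
      have "walk ?E A {z} (p @ [z])" using walk_prefix fw(1)[OF s(1)] p by metis
      moreover have "walk ?E {z} B (z # t)" using walk_suffix gw(1)[OF s(2)] q by metis
      ultimately have "walk ?E A B (p @ z # t)" by (rule walk_join)
      then obtain c where c: "c \<in> set p \<union> set (z # t)" "c \<in> S"
        using S(2) unfolding separates_def by fastforce
      from c(1) show ?thesis
      proof
        assume "c \<in> set p"
        then have "c = s" using fS[of c s] c s p by auto
        moreover have "s = last (z # r)" using f(2)[OF s(1)] p by simp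
        ultimately have False using \<open>c \<in> set p\<close> fw(2)[OF s(1)] p
          by (metis disjoint_iff distinct_append last_in_set list.distinct(1))
        then show ?thesis ..
      next
        assume ct: "c \<in> set (z # t)"
        then have cs: "c = s'" using gS[of c s'] c s q by auto
        have "s' = hd (q @ [z])" using g(2)[OF s(2)] q by (cases q) auto
        then have "c \<in> set (q @ [z])" using cs by (metis hd_in_set snoc_eq_iff_butlast)
        then have cz: "c = z" using ct gw(2)[OF s(2)] q by auto
        then show ?thesis using fS[of z s] c z s cs by auto
      qed
    qed
    \<comment> \<open>\<open>\<sigma> s\<close> is the start of the path that continues
      \<open>f s\<close>. For \<open>s = x\<close> the two paths are joined by the edge
      \<open>(x, y)\<close> and nothing is dropped; otherwise the shared vertex \<open>s\<close>
      would occur twice, hence \<open>tl\<close>.\<close>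
    define \<sigma> where "\<sigma> s = (if s = x then y else s)" for s
    define h where "h s = f s @ (if s = x then g y else tl (g s))" for s
    have \<sigma>: "\<sigma> s \<in> insert y S" if "s \<in> insert x S" for s using that by (auto simp: \<sigma>_def)
    have \<sigma>_inj: "\<sigma> s \<noteq> \<sigma> s'" if "s \<in> insert x S" "s' \<in> insert x S" "s \<noteq> s'" for s s'
      using that xS yS by (auto simp: \<sigma>_def)
    have hset: "set (h s) \<subseteq> set (f s) \<union> set (g (\<sigma> s))" for s
      unfolding h_def \<sigma>_def by (cases "g s") (auto split: if_splits)
    have hw: "walk E A B (h s)" "distinct (h s)" if s: "s \<in> insert x S" for s
    proof -
      have F: "walk E A (insert x S) (f s)" using fw(1)[OF s] by (rule walk_mono) auto
      have G: "walk E (insert y S) B (g (\<sigma> s))" using gw(1)[OF \<sigma>[OF s]] by (rule walk_mono) auto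
      obtain p where p: "f s = p @ [s]"
        using f(2)[OF s] F by (metis append_butlast_last_id walk_def)
      obtain q where q: "g (\<sigma> s) = \<sigma> s # q"
        using g(2)[OF \<sigma>[OF s]] G by (metis list.collapse walk_def)
      have eq: "h s = p @ s # (if s = x then y # q else q)"
        using p q by (auto simp: h_def \<sigma>_def)
      show "walk E A B (h s)"
        using F G xy unfolding eq p q
        by (auto simp: walk_def successively_append_iff \<sigma>_def successively_Cons hd_append
            split: if_splits)
      show "distinct (h s)"
      proof (cases "s = x")
        case True
        then have "set (f s) \<inter> set (g (\<sigma> s)) = {}"
          using fg[OF _ _ s \<sigma>[OF s]] xS by auto
        then show ?thesis using True fw(2)[OF s] gw(2)[OF \<sigma>[OF s]] by (simp add: h_def \<sigma>_def)
      next
        case False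
        then have "set (f s) \<inter> set q = {}"
          using fg[OF _ _ s \<sigma>[OF s]] q gw(2)[OF \<sigma>[OF s]] by (auto simp: \<sigma>_def)
        then show ?thesis using False q fw(2)[OF s] gw(2)[OF \<sigma>[OF s]] by (simp add: h_def \<sigma>_def)
      qed
    qed
    have hd: "set (h s) \<inter> set (h s') = {}"
      if s: "s \<in> insert x S" "s' \<in> insert x S" "s \<noteq> s'" for s s'
    proof -
      have *: "set (f a) \<inter> set (g (\<sigma> b)) = {}"
        if a: "a \<in> insert x S" and b: "b \<in> insert x S" and ab: "a \<noteq> b" for a b
      proof (rule ccontr)
        assume "set (f a) \<inter> set (g (\<sigma> b)) \<noteq> {}"
        then obtain z where "z = a" "z = \<sigma> b" "z \<in> S"
          using fg[OF _ _ a \<sigma>[OF b]] by blast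
        then show False using ab yS by (auto simp: \<sigma>_def split: if_splits)
      qed
      have "set (f s) \<inter> set (g (\<sigma> s')) = {}" "set (f s') \<inter> set (g (\<sigma> s)) = {}"
        using *[OF s] *[OF s(2,1)] s(3) by auto
      then show ?thesis
        using hset[of s] hset[of s'] fd[OF s] gd[OF \<sigma>[OF s(1)] \<sigma>[OF s(2)] \<sigma>_inj[OF s]] by blast
    qed
    have "inj_on h (insert x S)"
    proof (rule inj_onI)
      fix s s' assume "s \<in> insert x S" "s' \<in> insert x S" "h s = h s'"
      then show "s = s'" using hd[of s s'] hw(1)[of s] by (auto simp: walk_def)
    qed
    then have "card (h ` insert x S) = k"
      using card_image[of h "insert x S"] cS(1) \<open>k \<le> card (insert x S)\<close> by linarith
    moreover have "linkage E A B (h ` insert x S)"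
      unfolding linkage_def
    proof (intro conjI ballI impI)
      fix p q assume "p \<in> h ` insert x S" "q \<in> h ` insert x S" "p \<noteq> q"
      then obtain s s' where "s \<in> insert x S" "s' \<in> insert x S" "p = h s" "q = h s'" "s \<noteq> s'"
        by blast
      then show "set p \<inter> set q = {}" using hd[of s s'] by simp
    qed (use hw S(1) in auto)
    ultimately show ?thesis by blast
  qed
qed

section \<open>Mixed separations of multigraphs\<close>

definition crossing :: "('v \<Rightarrow> 'v \<Rightarrow> nat) \<Rightarrow> 'v set \<Rightarrow> 'v set \<Rightarrow> nat" where
  "crossing w X Y = (\<Sum>a\<in>X. \<Sum>b\<in>Y. w a b)"

definition cut_order :: "'v set \<Rightarrow> ('v \<Rightarrow> 'v \<Rightarrow> nat) \<Rightarrow> 'v set \<Rightarrow> 'v set \<Rightarrow> nat" where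
  "cut_order V w X Y = card (V - X - Y) + crossing w X Y"

definition separation :: "'v set \<Rightarrow> 'v set \<Rightarrow> 'v set \<Rightarrow> bool" where
  "separation V X Y \<longleftrightarrow> X \<subseteq> V \<and> Y \<subseteq> V \<and> X \<inter> Y = {} \<and> X \<noteq> {} \<and> Y \<noteq> {}"

definition uniform3 :: "'v set \<Rightarrow> ('v \<Rightarrow> 'v \<Rightarrow> nat) \<Rightarrow> bool" where
  "uniform3 V w \<longleftrightarrow> 4 \<le> card V \<and> (\<forall>X Y. separation V X Y \<longrightarrow> 3 \<le> cut_order V w X Y) \<and>
     (\<forall>u \<in> V. \<forall>v \<in> V. u \<noteq> v \<longrightarrow>
        (\<exists>X Y. separation V X Y \<and> u \<in> X \<and> v \<in> Y \<and> cut_order V w X Y \<le> 3))"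

section \<open>Multiplicities and the easy half of Menger's theorem\<close>

definition edge_mult :: "'v mgraph \<Rightarrow> 'v \<Rightarrow> 'v \<Rightarrow> nat" where
  "edge_mult G a b = count (edges G) {a, b}"

lemma edge_mult_commute: "edge_mult G a b = edge_mult G b a"
  by (simp add: edge_mult_def insert_commute)

lemma edge_mult_pos: "multigraph G \<Longrightarrow> 0 < edge_mult G a b \<Longrightarrow> a \<in> verts G \<and> b \<in> verts G \<and> a \<noteq> b"
  by (cases "a = b") (force simp: edge_mult_def multigraph_def)+

lemma edge_mult_refl: "multigraph G \<Longrightarrow> edge_mult G a a = 0"
  using edge_mult_pos by fastforce

text \<open>A place to which a path from \<open>X\<close> to \<open>Y\<close> can be charged: a
  separator vertex, or one particular parallel edge given by its ends, ordered from \<open>X\<close>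
  to \<open>Y\<close>, and its index. The number of possible markers is the order of the
  pair.\<close>

definition crossing_marker :: "'v mgraph \<Rightarrow> 'v set \<Rightarrow> 'v set \<Rightarrow> 'v path \<Rightarrow> 'v + ('v \<times> 'v) \<times> nat \<Rightarrow> bool" where
  "crossing_marker G X Y P m \<longleftrightarrow> (case m of
     Inl z \<Rightarrow> z \<in> path_verts P \<and> z \<in> verts G - X - Y
   | Inr ((a, b), i) \<Rightarrow> a \<in> X \<and> b \<in> Y \<and> i < edge_mult G a b \<and>
       (\<exists>j < length (snd P). fst P ! j = a \<and> fst P ! Suc j = b \<and> snd P ! j = ({a, b}, i)))"

text \<open>Consider the first vertex outside \<open>X\<close>: it lies in the separator or in
  \<open>Y\<close>, and in the latter case the step leading to it is a crossing edge.\<close>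

lemma crossing_marker_exists:
  assumes P: "P \<in> paths_between G u v" and uv: "u \<in> X" "v \<in> Y" "X \<inter> Y = {}"
  shows "\<exists>m. crossing_marker G X Y P m"
proof -
  obtain vs es where Peq: "P = (vs, es)" by fastforce
  have len: "length vs = Suc (length es)" and sub: "set vs \<subseteq> verts G"
    and hd: "hd vs = u" and last: "last vs = v"
    using P by (auto simp: Peq paths_between_def is_path_def)
  have es: "es ! k = ({vs ! k, vs ! Suc k}, snd (es ! k)) \<and>
      snd (es ! k) < edge_mult G (vs ! k) (vs ! Suc k)" if "k < length es" for k
    using P that by (cases "es ! k") (auto simp: Peq paths_between_def is_path_def edge_mult_def)
  define k where "k = (LEAST k. vs ! k \<notin> X)"
  have "vs ! length es = v" using last len by (simp add: last_conv_nth flip: length_greater_0_conv)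
  then have out: "vs ! length es \<notin> X" using uv by auto
  have kX: "vs ! k \<notin> X" and kle: "k \<le> length es" unfolding k_def
    using LeastI[of "\<lambda>k. vs ! k \<notin> X", OF out] Least_le[of "\<lambda>k. vs ! k \<notin> X", OF out] by auto
  have "vs ! 0 = u" using hd len by (simp add: hd_conv_nth flip: length_greater_0_conv)
  then obtain j where j: "k = Suc j" using kX uv by (cases k) auto
  have jX: "vs ! j \<in> X" using not_less_Least[of j "\<lambda>k. vs ! k \<notin> X"] j k_def by auto
  have jl: "j < length es" using kle j by simp
  have kv: "vs ! k \<in> set vs" using kle len by simp
  show ?thesis
  proof (cases "vs ! k \<in> Y")
    case True
    then show ?thesis using True jX jl j Peq es[OF jl]
      by (intro exI[of _ "Inr ((vs ! j, vs ! k), snd (es ! j))"]) (auto simp: crossing_marker_def)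
  next
    case False
    then show ?thesis using kX kv sub Peq
      by (intro exI[of _ "Inl (vs ! k)"]) (auto simp: crossing_marker_def path_verts_def)
  qed
qed

text \<open>Since the vertices of a path are distinct, a step from its first end to its last leaves
  room for nothing else.\<close>

lemma direct_path_unique:
  assumes P: "P \<in> paths_between G u v" and uv: "u \<noteq> v"
    and j: "j < length (snd P)" "fst P ! j = u" "fst P ! Suc j = v" "snd P ! j = e"
  shows "P = ([u, v], [e])"
proof -
  obtain vs es where Peq: "P = (vs, es)" by fastforce
  have len: "length vs = Suc (length es)" and d: "distinct vs"
    and hd: "hd vs = u" and last: "last vs = v"
    using P by (auto simp: Peq paths_between_def is_path_def)
  have "vs ! 0 = u" using hd len by (simp add: hd_conv_nth flip: length_greater_0_conv)
  then have j0: "j = 0" using j d len Peq nth_eq_iff_index_eq[OF d, of j 0] by auto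
  have "vs ! length es = v" using last len by (simp add: last_conv_nth flip: length_greater_0_conv)
  then have "length es = 1"
    using j j0 d len Peq nth_eq_iff_index_eq[OF d, of "Suc j" "length es"] by auto
  then show ?thesis using j j0 len \<open>vs ! 0 = u\<close> Peq
    by (auto simp: length_Suc_conv)
qed

text \<open>Charging paths to markers is injective: a shared separator vertex would be an inner
  vertex of two paths, and a shared edge has both ends shared, so it joins \<open>u\<close> to
  \<open>v\<close> and is the whole of both paths.\<close>

lemma independent_paths_le_cut_order:
  assumes G: "multigraph G" and sep: "separation (verts G) X Y" and uv: "u \<in> X" "v \<in> Y"
    and \<P>: "\<P> \<subseteq> paths_between G u v" "independent_paths \<P>"
  shows "finite \<P> \<and> card \<P> \<le> cut_order (verts G) (edge_mult G) X Y"
proof -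
  let ?C = "Sigma (X \<times> Y) (\<lambda>(a, b). {..<edge_mult G a b})"
  let ?M = "(verts G - X - Y) <+> ?C"
  have fin: "finite (verts G)" "finite X" "finite Y"
    using G sep finite_subset by (auto simp: multigraph_def separation_def)
  have XY: "X \<inter> Y = {}" and neq: "u \<noteq> v" using sep uv by (auto simp: separation_def)
  define m where "m P = (SOME m. crossing_marker G X Y P m)" for P
  have m: "crossing_marker G X Y P (m P)" if "P \<in> \<P>" for P
    unfolding m_def using crossing_marker_exists[of P G u v X Y] \<P> that uv XY
    by (intro someI_ex[of "crossing_marker G X Y P"]) auto
  have sub: "m ` \<P> \<subseteq> ?M"
  proof
    fix x assume "x \<in> m ` \<P>"
    then obtain P where "crossing_marker G X Y P x" using m by auto
    then show "x \<in> ?M" by (auto simp: crossing_marker_def split: sum.splits)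
  qed
  have inj: "inj_on m \<P>"
  proof (rule inj_onI, rule ccontr)
    fix P Q assume PQ: "P \<in> \<P>" "Q \<in> \<P>" "m P = m Q" "P \<noteq> Q"
    have P: "P \<in> paths_between G u v" and Q: "Q \<in> paths_between G u v" using PQ \<P> by auto
    have ends: "z = u \<or> z = v" if "z \<in> path_verts P" "z \<in> path_verts Q" for z
    proof -
      have "z \<in> path_ends P" using that PQ \<P>(2) unfolding independent_paths_def by blast
      then show ?thesis using P by (auto simp: path_ends_def paths_between_def)
    qed
    show False
    proof (cases "m P")
      case (Inl z)
      then show False using m[OF PQ(1)] m[OF PQ(2)] PQ(3) ends[of z] uv
        by (auto simp: crossing_marker_def)
    next
      case (Inr r)
      obtain a b i where r: "r = ((a, b), i)" by (metis prod.collapse)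
      have len: "length (fst R) = Suc (length (snd R))" if "R \<in> paths_between G u v" for R
        using that by (auto simp: paths_between_def is_path_def)
      from m[OF PQ(1)] obtain j where j: "a \<in> X" "b \<in> Y" "j < length (snd P)" "fst P ! j = a"
        "fst P ! Suc j = b" "snd P ! j = ({a, b}, i)"
        by (auto simp: Inr r crossing_marker_def)
      from m[OF PQ(2)] obtain l where l: "l < length (snd Q)" "fst Q ! l = a"
        "fst Q ! Suc l = b" "snd Q ! l = ({a, b}, i)"
        by (auto simp: Inr r PQ(3)[symmetric] crossing_marker_def)
      have "a \<in> path_verts P" "b \<in> path_verts P"
        using j len[OF P] by (auto simp: path_verts_def)
      moreover have "a \<in> path_verts Q" "b \<in> path_verts Q"
        using l len[OF Q] by (auto simp: path_verts_def)
      ultimately have "a = u" "b = v" using ends[of a] ends[of b] j uv XY by auto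
      then show False
        using direct_path_unique[OF P neq j(3)] direct_path_unique[OF Q neq l(1)] j l PQ(4) by simp
    qed
  qed
  have finM: "finite ?M" using fin by auto
  have "card \<P> = card (m ` \<P>)" using inj by (simp add: card_image)
  also have "\<dots> \<le> card ?M" using sub finM by (rule card_mono[rotated])
  also have "\<dots> = card (verts G - X - Y) + card ?C" using fin by (intro card_Plus) auto
  also have "card ?C = (\<Sum>(a, b)\<in>X \<times> Y. edge_mult G a b)"
    using fin by (subst card_SigmaI) (auto intro!: sum.cong)
  also have "\<dots> = crossing (edge_mult G) X Y"
    by (simp add: crossing_def sum.cartesian_product)
  finally have "card \<P> \<le> cut_order (verts G) (edge_mult G) X Y" by (simp add: cut_order_def)
  moreover have "finite \<P>" using inj sub finM finite_imageD finite_subset by blast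
  ultimately show ?thesis by blast
qed

section \<open>From disjoint walks to independent paths\<close>

definition list_path :: "'v list \<Rightarrow> 'v path" where
  "list_path vs = (vs, map (\<lambda>j. ({vs ! j, vs ! Suc j}, 0)) [0..<length vs - 1])"

lemma list_path_is_path:
  assumes "vs \<noteq> []" "distinct vs" "set vs \<subseteq> verts G" "successively (\<lambda>a b. 0 < edge_mult G a b) vs"
  shows "is_path G (list_path vs)"
  using assms unfolding list_path_def is_path_def
  by (auto simp: edge_mult_def successively_conv_nth Suc_le_eq)

lemma walk_verts:
  assumes "walk E A B p" "E \<subseteq> D \<times> D" "A \<subseteq> D"
  shows "set p \<subseteq> D"
proof -
  have "successively (\<lambda>x y. (x, y) \<in> E) p" "p \<noteq> []" "hd p \<in> D" using assms by (auto simp: walk_def)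
  then show ?thesis
  proof (induction p)
    case (Cons a p)
    then show ?case using assms(2) by (cases p) auto
  qed simp
qed

text \<open>The directed theorem is applied without \<open>u\<close> and \<open>v\<close>, between
  the neighbours of \<open>u\<close> and those of \<open>v\<close>. Direct edges contribute
  \<open>min (?w u v) k\<close> paths and walks the remaining \<open>k - ?w u v\<close>; truncated
  subtraction covers the case of more than \<open>k\<close> direct edges.\<close>

lemma menger_mixed:
  assumes G: "multigraph G" and u: "u \<in> verts G" and v: "v \<in> verts G" and uv: "u \<noteq> v"
    and k: "\<And>X Y. separation (verts G) X Y \<Longrightarrow> u \<in> X \<Longrightarrow> v \<in> Y \<Longrightarrow> k \<le> cut_order (verts G) (edge_mult G) X Y"
  shows "\<exists>\<P>. finite \<P> \<and> \<P> \<subseteq> paths_between G u v \<and> independent_paths \<P> \<and> card \<P> = k"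
proof -
  let ?w = "edge_mult G" and ?D = "verts G - {u, v}"
  define E where "E = {(a, b). a \<in> ?D \<and> b \<in> ?D \<and> 0 < ?w a b}"
  define A where "A = {a \<in> ?D. 0 < ?w u a}"
  define B where "B = {b \<in> ?D. 0 < ?w b v}"
  have fin: "finite (verts G)" using G by (simp add: multigraph_def)
  have "E \<subseteq> ?D \<times> ?D" by (auto simp: E_def)
  then have finE: "finite E" using fin by (meson finite_Diff finite_SigmaI finite_subset)
  have k': "k - ?w u v \<le> card S" if S: "finite S" "separates E A B S" for S
  proof -
    \<comment> \<open>The side of \<open>u\<close> consists of everything reachable from
      \<open>A\<close> without touching \<open>S\<close>. Only direct edges lead from it to
      \<open>Y\<close>, so the order is at most \<open>card S + ?w u v\<close>.\<close>
    define R where "R = {z \<in> ?D - S. \<exists>p. walk E A {z} p \<and> set p \<inter> S = {}}"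
    define X where "X = insert u R"
    define Y where "Y = verts G - (S \<inter> ?D) - X"
    have sep: "separation (verts G) X Y" "u \<in> X" "v \<in> Y"
      using u v uv by (auto simp: separation_def X_def Y_def R_def)
    have cross: "?w a b = (if a = u \<and> b = v then ?w u v else 0)" if a: "a \<in> X" and b: "b \<in> Y" for a b
    proof (rule ccontr)
      assume neg: "\<not> ?thesis"
      then have pos: "0 < ?w a b" and ne: "\<not> (a = u \<and> b = v)" by (auto split: if_splits)
      have bS: "b \<notin> S" if "b \<noteq> v" using b that by (auto simp: Y_def X_def)
      have bD: "b \<in> ?D" if "b \<noteq> v" using b that by (auto simp: Y_def X_def)
      have bR: "b \<notin> R" using b by (auto simp: Y_def X_def)
      show False
      proof (cases "a = u")
        case True
        then have bv: "b \<noteq> v" using ne by simp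
        then have "walk E A {b} [b]" using pos True bD by (auto simp: walk_def A_def)
        then have "b \<in> R" using bS[OF bv] bD[OF bv] by (auto simp: R_def intro!: exI[of _ "[b]"])
        then show False using bR by simp
      next
        case False
        then have aR: "a \<in> R" using a by (simp add: X_def)
        then obtain p where p: "walk E A {a} p" "set p \<inter> S = {}" by (auto simp: R_def)
        have aD: "a \<in> ?D" using aR by (auto simp: R_def)
        show False
        proof (cases "b = v")
          case True
          then have "a \<in> B" using pos aD by (auto simp: B_def)
          then have "walk E A B p" using p by (auto simp: walk_def)
          then show False using S(2) p(2) by (auto simp: separates_def)
        next
          case bv: False
          have "walk E A {b} (p @ [b])"
            using p(1) pos aD bD[OF bv] by (auto simp: walk_def successively_append_iff E_def)
          then have "b \<in> R" using p(2) bS[OF bv] bD[OF bv]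
            by (auto simp: R_def intro!: exI[of _ "p @ [b]"])
          then show False using bR by simp
        qed
      qed
    qed
    have fXY: "finite X" "finite Y" using fin sep finite_subset by (auto simp: separation_def)
    have "crossing ?w X Y = (\<Sum>a\<in>X. \<Sum>b\<in>Y. if a = u then if b = v then ?w u v else 0 else 0)"
      unfolding crossing_def by (intro sum.cong refl) (use cross in auto)
    also have "\<dots> = (\<Sum>a\<in>X. if a = u then ?w u v else 0)"
      using fXY sep by (intro sum.cong refl) auto
    also have "\<dots> = ?w u v" using fXY sep by simp
    finally have "crossing ?w X Y = ?w u v" .
    moreover have "verts G - X - Y = S \<inter> ?D" by (auto simp: X_def Y_def R_def u)
    ultimately have "k \<le> card (S \<inter> ?D) + ?w u v" using k[OF sep] by (simp add: cut_order_def)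
    moreover have "card (S \<inter> ?D) \<le> card S" using S(1) by (intro card_mono) auto
    ultimately show ?thesis by simp
  qed
  have finAB: "finite A" "finite B" using fin by (auto simp: A_def B_def)
  obtain L where L: "linkage E A B L" "card L = k - ?w u v"
    using menger[OF finE k' finAB] by blast
  \<comment> \<open>Paths with inner vertices are told apart by their vertices, so index 0 for each
    edge is enough; only the direct edges in \<open>g\<close> need their indices.\<close>
  define f where "f p = list_path (u # p @ [v])" for p
  define g where "g i = ([u, v], [({u, v}, i :: nat)])" for i
  let ?I = "{..<min (?w u v) k}"
  define \<P> where "\<P> = f ` L \<union> g ` ?I"
  have Lp: "p \<noteq> []" "set p \<subseteq> ?D" "distinct p" "hd p \<in> A" "last p \<in> B"
    "successively (\<lambda>a b. 0 < ?w a b) p" if "p \<in> L" for p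
  proof -
    have w: "walk E A B p" "distinct p" using L(1) that by (auto simp: linkage_def)
    then show "p \<noteq> []" "distinct p" "hd p \<in> A" "last p \<in> B" by (auto simp: walk_def)
    show "set p \<subseteq> ?D" by (rule walk_verts[OF w(1)]) (auto simp: E_def A_def)
    show "successively (\<lambda>a b. 0 < ?w a b) p"
      using w(1) unfolding walk_def by (auto simp: E_def elim!: successively_mono)
  qed
  have fp: "f p \<in> paths_between G u v" if "p \<in> L" for p
  proof -
    have "is_path G (f p)" unfolding f_def
    proof (rule list_path_is_path)
      show "successively (\<lambda>a b. 0 < ?w a b) (u # p @ [v])"
        using Lp[OF that] by (auto simp: successively_Cons successively_append_iff A_def B_def)
    qed (use Lp[OF that] u v uv in auto)
    then show ?thesis by (simp add: paths_between_def f_def list_path_def)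
  qed
  have gp: "g i \<in> paths_between G u v" if "i \<in> ?I" for i
    using that u v uv by (simp add: paths_between_def g_def is_path_def edge_mult_def)
  have fv: "path_verts (f p) = insert u (insert v (set p))" for p
    by (auto simp: path_verts_def f_def list_path_def)
  have gv: "path_verts (g p) = {u, v}" for p by (auto simp: path_verts_def g_def)
  have sub: "\<P> \<subseteq> paths_between G u v" using fp gp by (auto simp: \<P>_def)
  have ends: "path_ends P = {u, v}" if "P \<in> \<P>" for P
    using sub that by (auto simp: paths_between_def path_ends_def)
  have ind: "independent_paths \<P>"
    unfolding independent_paths_def
  proof (intro allI impI ballI)
    fix x P assume ex: "\<exists>P\<in>\<P>. \<exists>Q\<in>\<P>. P \<noteq> Q \<and> x \<in> path_verts P \<and> x \<in> path_verts Q" and P: "P \<in> \<P>"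
    from ex obtain P' Q where PQ: "P' \<in> \<P>" "Q \<in> \<P>" "P' \<noteq> Q" "x \<in> path_verts P'" "x \<in> path_verts Q"
      by blast
    have "x = u \<or> x = v"
    proof (rule ccontr)
      assume x: "\<not> ?thesis"
      then obtain p q where "P' = f p" "Q = f q" "p \<in> L" "q \<in> L" "x \<in> set p" "x \<in> set q"
        using PQ fv gv by (auto simp: \<P>_def)
      then show False using PQ(3) L(1) unfolding linkage_def by (metis disjoint_iff)
    qed
    then show "x \<in> path_ends P" using ends[OF P] by auto
  qed
  have injf: "inj_on f L" by (auto simp: inj_on_def f_def list_path_def)
  have injg: "inj_on g ?I" by (auto simp: inj_on_def g_def)
  have "f ` L \<inter> g ` ?I = {}" using Lp(1) by (auto simp: f_def g_def list_path_def)
  then have "card \<P> = card L + min (?w u v) k"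
    using L(1) injf injg unfolding \<P>_def linkage_def
    by (subst card_Un_disjoint) (auto simp: card_image)
  then have "card \<P> = k" using L(2) by auto
  moreover have "finite \<P>" using L(1) by (auto simp: \<P>_def linkage_def)
  ultimately show ?thesis using sub ind by blast
qed

text \<open>The hard half is used twice: with \<open>k\<close> it yields \<open>k\<close> paths, and
  since \<open>k + 1\<close> paths do not exist, its contrapositive with \<open>Suc k\<close> yields
  a pair of order at most \<open>k\<close>.\<close>

lemma max_independent_paths_eq_iff:
  assumes G: "multigraph G" and uv: "u \<in> verts G" "v \<in> verts G" "u \<noteq> v"
  shows "max_independent_paths G u v = k \<longleftrightarrow>
    (\<forall>X Y. separation (verts G) X Y \<and> u \<in> X \<and> v \<in> Y \<longrightarrow> k \<le> cut_order (verts G) (edge_mult G) X Y) \<and>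
    (\<exists>X Y. separation (verts G) X Y \<and> u \<in> X \<and> v \<in> Y \<and> cut_order (verts G) (edge_mult G) X Y \<le> k)"
    (is "_ \<longleftrightarrow> ?lower \<and> ?upper")
proof -
  let ?N = "{card \<P> | \<P>. finite \<P> \<and> \<P> \<subseteq> paths_between G u v \<and> independent_paths \<P>}"
  have le: "n \<le> cut_order (verts G) (edge_mult G) X Y"
    if "n \<in> ?N" "separation (verts G) X Y" "u \<in> X" "v \<in> Y" for n X Y
    using that independent_paths_le_cut_order[OF G that(2-4)] by auto
  \<comment> \<open>The cut around \<open>u\<close> bounds all families, so \<open>Max\<close> is
    taken over a finite set.\<close>
  have "separation (verts G) {u} (verts G - {u})" using uv by (auto simp: separation_def)
  then have "?N \<subseteq> {..cut_order (verts G) (edge_mult G) {u} (verts G - {u})}"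
    using le[of _ "{u}" "verts G - {u}"] uv by auto
  then have fN: "finite ?N" using finite_subset by blast
  have "0 \<in> ?N" by (auto simp: independent_paths_def intro!: exI[of _ "{}"])
  then have ne: "?N \<noteq> {}" by blast
  have max: "max_independent_paths G u v = k \<longleftrightarrow> k \<in> ?N \<and> (\<forall>n\<in>?N. n \<le> k)"
    unfolding max_independent_paths_def by (rule Max_eq_iff[OF fN ne])
  have mem: "k' \<in> ?N" if "\<And>X Y. separation (verts G) X Y \<Longrightarrow> u \<in> X \<Longrightarrow> v \<in> Y \<Longrightarrow>
      k' \<le> cut_order (verts G) (edge_mult G) X Y" for k'
    using menger_mixed[OF G uv that] by fastforce
  show ?thesis
  proof
    assume "max_independent_paths G u v = k"
    then have kN: "k \<in> ?N" and kmax: "\<forall>n\<in>?N. n \<le> k" using max by auto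
    have "Suc k \<notin> ?N" using kmax by (meson Suc_n_not_le_n)
    then have ?upper using mem[of "Suc k"] by (metis not_less_eq_eq)
    then show "?lower \<and> ?upper" using le[OF kN] by blast
  next
    assume *: "?lower \<and> ?upper"
    then have "k \<in> ?N" using mem[of k] by blast
    moreover have "\<forall>n\<in>?N. n \<le> k" using * le by (meson le_trans)
    ultimately show "max_independent_paths G u v = k" using max by blast
  qed
qed

lemma uniformly_3_connected_iff:
  assumes G: "multigraph G"
  shows "uniformly_3_connected G \<longleftrightarrow> uniform3 (verts G) (edge_mult G)"
proof
  assume u3: "uniformly_3_connected G"
  have *: "max_independent_paths G u v = 3" if "u \<in> verts G" "v \<in> verts G" "u \<noteq> v" for u v
    using u3 that by (simp add: uniformly_3_connected_def)
  show "uniform3 (verts G) (edge_mult G)" unfolding uniform3_def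
  proof (intro conjI allI ballI impI)
    show "4 \<le> card (verts G)" using u3 by (simp add: uniformly_3_connected_def)
    fix X Y assume sep: "separation (verts G) X Y"
    then obtain u v where "u \<in> X" "v \<in> Y" by (auto simp: separation_def)
    moreover from this have "u \<in> verts G" "v \<in> verts G" "u \<noteq> v"
      using sep by (auto simp: separation_def)
    ultimately have uv: "u \<in> X" "v \<in> Y" "u \<in> verts G" "v \<in> verts G" "u \<noteq> v" .
    show "3 \<le> cut_order (verts G) (edge_mult G) X Y"
      using *[OF uv(3-5)] sep uv(1,2) unfolding max_independent_paths_eq_iff[OF G uv(3-5)] by blast
  next
    fix u v assume uv: "u \<in> verts G" "v \<in> verts G" "u \<noteq> v"
    show "\<exists>X Y. separation (verts G) X Y \<and> u \<in> X \<and> v \<in> Y \<and> cut_order (verts G) (edge_mult G) X Y \<le> 3"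
      using *[OF uv] unfolding max_independent_paths_eq_iff[OF G uv] by blast
  qed
next
  assume "uniform3 (verts G) (edge_mult G)"
  then show "uniformly_3_connected G"
    by (auto simp: uniformly_3_connected_def uniform3_def max_independent_paths_eq_iff[OF G])
qed

section \<open>Arithmetic of crossing edges and orders\<close>

lemma crossing_empty [simp]: "crossing w {} Y = 0" "crossing w X {} = 0"
  by (simp_all add: crossing_def)

lemma crossing_union_left:
  assumes "finite X" "finite X'" "X \<inter> X' = {}"
  shows "crossing w (X \<union> X') Y = crossing w X Y + crossing w X' Y"
  using assms by (simp add: crossing_def sum.union_disjoint)

lemma crossing_union_right:
  assumes "finite Y" "finite Y'" "Y \<inter> Y' = {}"
  shows "crossing w X (Y \<union> Y') = crossing w X Y + crossing w X Y'"
  using assms by (simp add: crossing_def sum.union_disjoint sum.distrib)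

lemma crossing_insert_left:
  "finite X \<Longrightarrow> s \<notin> X \<Longrightarrow> crossing w (insert s X) Y = crossing w {s} Y + crossing w X Y"
  by (simp add: crossing_def)

lemma crossing_insert_right:
  "finite Y \<Longrightarrow> s \<notin> Y \<Longrightarrow> crossing w X (insert s Y) = crossing w X {s} + crossing w X Y"
  by (simp add: crossing_def sum.distrib)

lemma crossing_mono:
  assumes "finite X'" "finite Y'" "X \<subseteq> X'" "Y \<subseteq> Y'"
  shows "crossing w X Y \<le> crossing w X' Y'"
proof -
  have "crossing w X Y \<le> (\<Sum>a\<in>X. \<Sum>b\<in>Y'. w a b)"
    unfolding crossing_def using assms by (intro sum_mono sum_mono2) auto
  also have "\<dots> \<le> crossing w X' Y'"
    unfolding crossing_def using assms by (intro sum_mono2) auto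
  finally show ?thesis .
qed

lemma crossing_cong:
  assumes "\<And>a b. a \<in> X \<Longrightarrow> b \<in> Y \<Longrightarrow> w a b = w' a b"
  shows "crossing w X Y = crossing w' X Y"
  unfolding crossing_def using assms by (intro sum.cong refl) auto

lemma crossing_ge_card:
  assumes "\<And>q. q \<in> X \<Longrightarrow> k \<le> crossing w {q} Y"
  shows "card X * k \<le> crossing w X Y"
proof -
  have "card X * k = (\<Sum>q\<in>X. k)" by simp
  also have "\<dots> \<le> (\<Sum>q\<in>X. crossing w {q} Y)" using assms by (intro sum_mono) auto
  also have "\<dots> = crossing w X Y" by (simp add: crossing_def)
  finally show ?thesis .
qed

lemma crossing_le_card:
  assumes "\<And>q. q \<in> X \<Longrightarrow> crossing w {q} Y \<le> k"
  shows "crossing w X Y \<le> card X * k"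
proof -
  have "crossing w X Y = (\<Sum>q\<in>X. crossing w {q} Y)" by (simp add: crossing_def)
  also have "\<dots> \<le> (\<Sum>q\<in>X. k)" using assms by (intro sum_mono) auto
  finally show ?thesis by simp
qed

lemma separation_commute: "separation V X Y \<Longrightarrow> separation V Y X"
  by (auto simp: separation_def)

text \<open>A loopless multigraph given by its multiplicities. As \<open>w\<close> is total and
  vanishes off \<open>V\<close>, a graph and its contraction or extension can be compared pointwise
  although their vertex sets differ.\<close>

locale weighted_graph =
  fixes V :: "'v set" and w :: "'v \<Rightarrow> 'v \<Rightarrow> nat"
  assumes finite_V: "finite V"
    and sym: "w a b = w b a"
    and supp: "0 < w a b \<Longrightarrow> a \<in> V \<and> b \<in> V \<and> a \<noteq> b"
begin

lemma irrefl [simp]: "w a a = 0"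
  using supp[of a a] by blast

lemma finite_subset_V: "X \<subseteq> V \<Longrightarrow> finite X"
  using finite_V finite_subset by blast

lemma crossing_commute: "crossing w X Y = crossing w Y X"
  unfolding crossing_def by (subst sum.swap) (simp add: sym)

lemma cut_order_commute: "cut_order V w X Y = cut_order V w Y X"
proof -
  have "V - X - Y = V - Y - X" by auto
  then show ?thesis by (simp add: cut_order_def crossing_commute[of X Y])
qed

lemma separation_finite: "separation V X Y \<Longrightarrow> finite X \<and> finite Y"
  using finite_V finite_subset by (auto simp: separation_def)

text \<open>Additive form of the definition, free of subtraction on \<open>nat\<close>, so that
  inequalities between orders can be left to linear arithmetic.\<close>

lemma cut_order_eq:
  assumes "X \<subseteq> V" "Y \<subseteq> V" "X \<inter> Y = {}"
  shows "cut_order V w X Y + card X + card Y = card V + crossing w X Y"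
proof -
  have fin: "finite X" "finite Y" using assms by (auto intro: finite_subset_V)
  have V: "V = (V - X - Y) \<union> (X \<union> Y)" using assms by auto
  have "card V = card (V - X - Y) + card (X \<union> Y)"
    by (subst V, rule card_Un_disjoint) (use fin finite_V in auto)
  also have "card (X \<union> Y) = card X + card Y" using fin assms by (intro card_Un_disjoint)
  finally show ?thesis by (simp add: cut_order_def)
qed

lemma cut_order_partition:
  assumes "X \<union> Y = V"
  shows "cut_order V w X Y = crossing w X Y"
proof -
  have "V - X - Y = {}" using assms by auto
  then show ?thesis unfolding cut_order_def by (metis card.empty add_0)
qed

text \<open>Moving \<open>s\<close> out of the separator saves one vertex and turns the edges from
  \<open>s\<close> to the opposite side into crossing edges. Read backwards, moving a vertex into
  the separator lowers the order as soon as it has two edges across.\<close>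

lemma cut_order_insert_left:
  assumes "X \<subseteq> V" "Y \<subseteq> V" "X \<inter> Y = {}" "s \<in> V - X - Y"
  shows "cut_order V w (insert s X) Y + 1 = cut_order V w X Y + crossing w {s} Y"
proof -
  have fin: "finite X" using assms by (auto intro: finite_subset_V)
  have "V - insert s X - Y = (V - X - Y) - {s}" by auto
  then have "card (V - insert s X - Y) + 1 = card (V - X - Y)"
    using assms(4) finite_V by (metis Suc_eq_plus1 card_Suc_Diff1 finite_Diff)
  moreover have "crossing w (insert s X) Y = crossing w {s} Y + crossing w X Y"
    using crossing_insert_left[OF fin] assms(4) by blast
  ultimately show ?thesis unfolding cut_order_def by linarith
qed

lemma cut_order_insert_right:
  assumes "X \<subseteq> V" "Y \<subseteq> V" "X \<inter> Y = {}" "s \<in> V - X - Y"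
  shows "cut_order V w X (insert s Y) + 1 = cut_order V w X Y + crossing w {s} X"
  using cut_order_insert_left[of Y X s] assms
  by (auto simp: cut_order_commute[of X] Int_commute)

text \<open>All crossing numbers become sums over one index set, so that submodularity can be
  checked for each pair of vertices.\<close>

lemma crossing_indicator:
  assumes "X \<subseteq> V" "Y \<subseteq> V"
  shows "crossing w X Y = (\<Sum>(a, b)\<in>V \<times> V. if a \<in> X \<and> b \<in> Y then w a b else 0)"
proof -
  have "crossing w X Y = (\<Sum>(a, b)\<in>X \<times> Y. w a b)"
    by (simp add: crossing_def sum.cartesian_product)
  also have "\<dots> = (\<Sum>(a, b)\<in>V \<times> V. if a \<in> X \<and> b \<in> Y then w a b else 0)"
    using assms finite_V by (intro sum.mono_neutral_cong_left) (auto split: if_splits)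
  finally show ?thesis .
qed

text \<open>The cardinalities of intersections and unions cancel exactly, and each ordered pair
  \<open>(a, b)\<close> is counted on the left at most as often as on the right.\<close>

lemma cut_order_submodular:
  assumes XY: "X \<subseteq> V" "Y \<subseteq> V" "X \<inter> Y = {}" and PQ: "P \<subseteq> V" "Q \<subseteq> V" "P \<inter> Q = {}"
  shows "cut_order V w (X \<inter> P) (Y \<union> Q) + cut_order V w (X \<union> P) (Y \<inter> Q)
    \<le> cut_order V w X Y + cut_order V w P Q"
proof -
  have "crossing w (X \<inter> P) (Y \<union> Q) + crossing w (X \<union> P) (Y \<inter> Q) =
    (\<Sum>(a, b)\<in>V \<times> V. (if a \<in> X \<inter> P \<and> b \<in> Y \<union> Q then w a b else 0) +
       (if a \<in> X \<union> P \<and> b \<in> Y \<inter> Q then w a b else 0))"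
    using assms by (subst (1 2) crossing_indicator) (auto simp: sum.distrib[symmetric] case_prod_unfold)
  also have "\<dots> \<le> (\<Sum>(a, b)\<in>V \<times> V. (if a \<in> X \<and> b \<in> Y then w a b else 0) +
       (if a \<in> P \<and> b \<in> Q then w a b else 0))"
    by (intro sum_mono) auto
  also have "\<dots> = crossing w X Y + crossing w P Q"
    using assms by (subst (1 2) crossing_indicator) (auto simp: sum.distrib[symmetric] case_prod_unfold)
  finally have cr: "crossing w (X \<inter> P) (Y \<union> Q) + crossing w (X \<union> P) (Y \<inter> Q)
    \<le> crossing w X Y + crossing w P Q" .
  have fin: "finite X" "finite Y" "finite P" "finite Q" using assms by (auto intro: finite_subset_V)
  have c: "card (X \<inter> P) + card (X \<union> P) = card X + card P"
    "card (Y \<inter> Q) + card (Y \<union> Q) = card Y + card Q"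
    using card_Un_Int[of X P] card_Un_Int[of Y Q] fin by auto
  have "cut_order V w (X \<inter> P) (Y \<union> Q) + card (X \<inter> P) + card (Y \<union> Q)
      = card V + crossing w (X \<inter> P) (Y \<union> Q)"
    "cut_order V w (X \<union> P) (Y \<inter> Q) + card (X \<union> P) + card (Y \<inter> Q)
      = card V + crossing w (X \<union> P) (Y \<inter> Q)"
    by (rule cut_order_eq; use assms in auto)+
  then show ?thesis using cr c cut_order_eq[OF XY] cut_order_eq[OF PQ] by linarith
qed

lemma degree_partition:
  assumes "X \<union> Y = V" "X \<inter> Y = {}"
  shows "crossing w {s} V = crossing w {s} X + crossing w {s} Y"
  using assms finite_V by (metis crossing_union_right finite_Un)

lemma singleton_cut:
  assumes "s \<in> V"
  shows "cut_order V w {s} (V - {s}) = crossing w {s} V"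
proof -
  have "crossing w {s} V = crossing w {s} {s} + crossing w {s} (V - {s})"
    by (rule degree_partition) (use assms in auto)
  then show ?thesis using assms by (simp add: cut_order_partition insert_absorb crossing_def)
qed

text \<open>The order of the cut around \<open>s\<close> is the degree of \<open>s\<close>.\<close>

lemma separated_by_degree_3:
  assumes "s \<in> V" "r \<in> V" "s \<noteq> r" "crossing w {s} V \<le> 3"
  shows "\<exists>X Y. separation V X Y \<and> s \<in> X \<and> r \<in> Y \<and> cut_order V w X Y \<le> 3"
    and "\<exists>X Y. separation V X Y \<and> r \<in> X \<and> s \<in> Y \<and> cut_order V w X Y \<le> 3"
proof -
  have *: "separation V {s} (V - {s})" using assms by (auto simp: separation_def)
  have "cut_order V w {s} (V - {s}) \<le> 3" using singleton_cut[OF assms(1)] assms(4) by simp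
  then show "\<exists>X Y. separation V X Y \<and> s \<in> X \<and> r \<in> Y \<and> cut_order V w X Y \<le> 3"
    "\<exists>X Y. separation V X Y \<and> r \<in> X \<and> s \<in> Y \<and> cut_order V w X Y \<le> 3"
    using * separation_commute[OF *] assms(2,3) cut_order_commute[of "{s}" "V - {s}"]
    by (metis Diff_iff singletonD singletonI)+
qed

text \<open>A vertex of degree at most 3 sends at most one edge to one of the two sides, and moving it
  to the other side does not increase the order.\<close>

lemma extend_to_edge_cut:
  assumes "X \<subseteq> V" "Y \<subseteq> V" "X \<inter> Y = {}" "cut_order V w X Y \<le> 3"
    and "\<And>s. s \<in> V - X - Y \<Longrightarrow> crossing w {s} V \<le> 3"
  shows "\<exists>A B. X \<subseteq> A \<and> Y \<subseteq> B \<and> A \<union> B = V \<and> A \<inter> B = {} \<and> crossing w A B \<le> 3"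
  using assms
proof (induction "card (V - X - Y)" arbitrary: X Y)
  case 0
  then have "V - X - Y = {}" using finite_V by simp
  then have "X \<union> Y = V" using 0 by auto
  then show ?case using 0 cut_order_partition[of X Y] by (metis order_refl)
next
  case (Suc n)
  then obtain s where s: "s \<in> V - X - Y" by (metis card.empty equals0I nat.distinct(1))
  have fin: "finite X" "finite Y" using Suc.prems by (auto intro: finite_subset_V)
  have "crossing w {s} (X \<union> Y) \<le> crossing w {s} V"
    by (rule crossing_mono) (use finite_V Suc.prems in auto)
  then have "crossing w {s} X + crossing w {s} Y \<le> 3"
    using Suc.prems(3) Suc.prems(5)[OF s] fin by (simp add: crossing_union_right)
  then consider "crossing w {s} X \<le> 1" | "crossing w {s} Y \<le> 1" by linarith
  then show ?case
  proof cases
    case 1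
    have "V - X - insert s Y = V - X - Y - {s}" by auto
    then have "n = card (V - X - insert s Y)" using Suc.hyps(2) s by simp
    moreover have "cut_order V w X (insert s Y) \<le> 3"
      using cut_order_insert_right[OF Suc.prems(1-3) s] 1 Suc.prems(4) by linarith
    ultimately have "\<exists>A B. X \<subseteq> A \<and> insert s Y \<subseteq> B \<and> A \<union> B = V \<and> A \<inter> B = {} \<and> crossing w A B \<le> 3"
      using Suc.prems s by (intro Suc.hyps(1)) auto
    then show ?thesis by blast
  next
    case 2
    have "V - insert s X - Y = V - X - Y - {s}" by auto
    then have "n = card (V - insert s X - Y)" using Suc.hyps(2) s by simp
    moreover have "cut_order V w (insert s X) Y \<le> 3"
      using cut_order_insert_left[OF Suc.prems(1-3) s] 2 Suc.prems(4) by linarith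
    ultimately have "\<exists>A B. insert s X \<subseteq> A \<and> Y \<subseteq> B \<and> A \<union> B = V \<and> A \<inter> B = {} \<and> crossing w A B \<le> 3"
      using Suc.prems s by (intro Suc.hyps(1)) auto
    then show ?thesis by blast
  qed
qed

text \<open>Suppose \<open>a\<close> and \<open>b\<close> are joined twice, and take a pair of order
  at most 3 separating them. If the side of \<open>a\<close> had a further vertex, moving
  \<open>a\<close> into the separator would trade at least two edges for one vertex and give order
  at most 2. So both sides are single vertices, and the order is at least (4 - 2) + 2 = 4.\<close>

lemma uniform3_multiplicity:
  assumes U: "uniform3 V w"
  shows "w a b \<le> 1"
proof (rule ccontr)
  assume "\<not> w a b \<le> 1"
  then have two: "2 \<le> w a b" by simp
  then have ab: "a \<in> V" "b \<in> V" "a \<noteq> b" using supp[of a b] by auto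
  obtain X Y where sep: "separation V X Y" and aX: "a \<in> X" and bY: "b \<in> Y"
    and c: "cut_order V w X Y \<le> 3"
    using U ab unfolding uniform3_def by blast
  have XY: "X \<subseteq> V" "Y \<subseteq> V" "X \<inter> Y = {}" and fin: "finite X" "finite Y"
    using sep separation_finite by (auto simp: separation_def)
  have single: "P = {p}" if "p \<in> P" "q \<in> Q" "2 \<le> w p q" "separation V P Q" "cut_order V w P Q \<le> 3"
    for p q P Q
  proof (rule ccontr)
    assume "P \<noteq> {p}"
    then have sep': "separation V (P - {p}) Q" using that by (auto simp: separation_def)
    have fPQ: "finite P" "finite Q" using that separation_finite by auto
    have "3 \<le> cut_order V w (P - {p}) Q" using U sep' by (auto simp: uniform3_def)
    moreover have "cut_order V w (insert p (P - {p})) Q + 1 = cut_order V w (P - {p}) Q + crossing w {p} Q"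
      by (rule cut_order_insert_left) (use that in \<open>auto simp: separation_def\<close>)
    moreover have "insert p (P - {p}) = P" using that by auto
    moreover have "crossing w {p} {q} \<le> crossing w {p} Q" by (rule crossing_mono) (use that fPQ in auto)
    ultimately show False using that by (simp add: crossing_def)
  qed
  have "X = {a}" by (rule single[OF aX bY two sep c])
  moreover have "Y = {b}"
    using single[OF bY aX _ separation_commute[OF sep]] two c sym[of a b] cut_order_commute[of X Y] by simp
  ultimately show False
    using cut_order_eq[OF XY] c two U by (simp add: uniform3_def crossing_def)
qed

end

section \<open>Vertices of degree at least 4\<close>

text \<open>Sides with one vertex are excluded because every vertex of degree 3 gives such a
  cut.\<close>

definition nontrivial_edge_cut :: "'v set \<Rightarrow> ('v \<Rightarrow> 'v \<Rightarrow> nat) \<Rightarrow> 'v set \<Rightarrow> 'v set \<Rightarrow> bool" where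
  "nontrivial_edge_cut V w A B \<longleftrightarrow> A \<union> B = V \<and> A \<inter> B = {} \<and> 2 \<le> card A \<and> 2 \<le> card B \<and>
     crossing w A B \<le> 3"

context weighted_graph
begin

lemma uniform3_crossing_le:
  assumes "uniform3 V w" "finite Y"
  shows "crossing w {s} Y \<le> card Y"
proof -
  have "crossing w {s} Y = (\<Sum>b\<in>Y. w s b)" by (simp add: crossing_def)
  also have "\<dots> \<le> (\<Sum>b\<in>Y. 1)" by (intro sum_mono uniform3_multiplicity[OF assms(1)])
  finally show ?thesis by simp
qed

lemma uniform3_crossing_less:
  assumes "uniform3 V w" "finite Y" "s \<in> Y"
  shows "crossing w {s} Y + 1 \<le> card Y"
proof -
  have Y: "Y = insert s (Y - {s})" using assms by auto
  have "crossing w {s} (insert s (Y - {s})) = crossing w {s} {s} + crossing w {s} (Y - {s})"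
    by (rule crossing_insert_right) (use assms in auto)
  then have "crossing w {s} Y = crossing w {s} (Y - {s})" using Y by (simp add: crossing_def)
  moreover have "crossing w {s} (Y - {s}) \<le> card (Y - {s})"
    using uniform3_crossing_le[OF assms(1)] assms(2) by simp
  moreover have "card (Y - {s}) + 1 = card Y" using assms
    by (metis Suc_eq_plus1 card_Suc_Diff1)
  ultimately show ?thesis by linarith
qed

text \<open>The two pairs divide \<open>V\<close> into nine cells, of which
  \<open>Y \<inter> Q\<close> is empty. All that is known is linear in the cell sizes and the edge
  numbers between cells: the two orders, the size comparisons, the degree of \<open>t\<close>
  bounded cell by cell, and the edges that each separator vertex sends to \<open>X\<close> and
  \<open>Y\<close>.\<close>

lemma uncross_high_degree:
  assumes U: "uniform3 V w"
    and XY: "separation V X Y" "cut_order V w X Y \<le> 3"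
    and PQ: "separation V P Q" "cut_order V w P Q \<le> 3"
    and t: "t \<in> X \<inter> P" "4 \<le> crossing w {t} V"
    and s: "s \<in> Q" "s \<in> V - X - Y"
    and YQ: "Y \<inter> Q = {}"
    and cards: "card X \<le> card Q" "card X \<le> card Y" "2 \<le> card X"
    and SX: "\<And>q. q \<in> V - X - Y \<Longrightarrow> 2 \<le> crossing w {q} X"
    and SY: "\<And>q. q \<in> V - X - Y \<Longrightarrow> 1 \<le> crossing w {q} Y"
  shows "\<exists>A B. nontrivial_edge_cut V w A B"
proof -
  let ?e = "crossing w"
  \<comment> \<open>The first letter stands for \<open>X\<close>, its separator \<open>S\<close>, or
    \<open>Y\<close>; the second for \<open>P\<close>, its separator \<open>R\<close>, or
    \<open>Q\<close>. \<open>YR\<close> is just \<open>Y - P\<close> because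
    \<open>Y \<inter> Q\<close> is empty.\<close>
  obtain XP XR XQ SP SR SQ YP YR where cells:
    "XP = X \<inter> P" "XR = X - P - Q" "XQ = X \<inter> Q"
    "SP = P - X - Y" "SR = V - X - Y - P - Q" "SQ = Q - X - Y"
    "YP = Y \<inter> P" "YR = Y - P" by blast
  have sub: "X \<subseteq> V" "Y \<subseteq> V" "P \<subseteq> V" "Q \<subseteq> V" "X \<inter> Y = {}" "P \<inter> Q = {}"
    using XY PQ by (auto simp: separation_def)
  have csub: "XP \<subseteq> V" "XR \<subseteq> V" "XQ \<subseteq> V" "SP \<subseteq> V" "SR \<subseteq> V" "SQ \<subseteq> V" "YP \<subseteq> V" "YR \<subseteq> V"
    using sub by (auto simp: cells)
  note fin = csub[THEN finite_subset_V]
  have disj: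
    "XP \<inter> XR = {}" "XP \<inter> XQ = {}" "XP \<inter> SP = {}" "XP \<inter> SR = {}" "XP \<inter> SQ = {}" "XP \<inter> YP = {}" "XP \<inter> YR = {}"
    "XR \<inter> XQ = {}" "XR \<inter> SP = {}" "XR \<inter> SR = {}" "XR \<inter> SQ = {}" "XR \<inter> YP = {}" "XR \<inter> YR = {}"
    "XQ \<inter> SP = {}" "XQ \<inter> SR = {}" "XQ \<inter> SQ = {}" "XQ \<inter> YP = {}" "XQ \<inter> YR = {}"
    "SP \<inter> SR = {}" "SP \<inter> SQ = {}" "SP \<inter> YP = {}" "SP \<inter> YR = {}"
    "SR \<inter> SQ = {}" "SR \<inter> YP = {}" "SR \<inter> YR = {}"
    "SQ \<inter> YP = {}" "SQ \<inter> YR = {}" "YP \<inter> YR = {}"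
    using sub by (auto simp: cells)
  note un = crossing_union_left crossing_union_right card_Un_disjoint fin disj Int_Un_distrib2 Int_Un_distrib
  have X: "X = XP \<union> XR \<union> XQ" and Y: "Y = YP \<union> YR" and P: "P = XP \<union> SP \<union> YP" and Q: "Q = XQ \<union> SQ"
    and S: "V - X - Y = SP \<union> SR \<union> SQ" and R: "V - P - Q = XR \<union> SR \<union> YR"
    and V: "V = XP \<union> XR \<union> XQ \<union> SP \<union> SR \<union> SQ \<union> YP \<union> YR"
    using sub YQ by (auto simp: cells)
  have cX: "card X = card XP + card XR + card XQ" and cY: "card Y = card YP + card YR"
    and cQ: "card Q = card XQ + card SQ"
    unfolding X Y Q by (simp_all add: un)
  have tXP: "t \<in> XP" using t by (simp add: cells)
  have sSQ: "s \<in> SQ" using s by (simp add: cells)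
  have "0 < card XP" "0 < card SQ" using tXP sSQ fin card_gt_0_iff by blast+
  then have pos: "1 \<le> card XP" "1 \<le> card SQ" by simp_all
  have a: "card SP + card SR + card SQ + (?e XP YP + ?e XP YR + ?e XR YP + ?e XR YR + ?e XQ YP + ?e XQ YR) \<le> 3"
    using XY(2) unfolding cut_order_def S unfolding X Y by (simp add: un)
  have b: "card XR + card SR + card YR + (?e XP XQ + ?e XP SQ + ?e SP XQ + ?e SP SQ + ?e YP XQ + ?e YP SQ) \<le> 3"
    using PQ(2) unfolding cut_order_def R unfolding P Q by (simp add: un)
  \<comment> \<open>The first inequality is \<open>card X \<le> card Q\<close> with the common cell
    \<open>XQ\<close> cancelled.\<close>
  have c: "card XP + card XR \<le> card SQ" "card XP + card XR + card XQ \<le> card YP + card YR"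
    "2 \<le> card XP + card XR + card XQ"
    using cards unfolding cX cY cQ by simp_all
  have degree: "?e {z} V = ?e {z} XP + ?e {z} XR + ?e {z} XQ + ?e {z} SP + ?e {z} SR + ?e {z} SQ
      + ?e {z} YP + ?e {z} YR" for z
    by (subst V) (simp add: un)
  have toX: "?e {z} X = ?e {z} XP + ?e {z} XR + ?e {z} XQ" for z unfolding X by (simp add: un)
  have toY: "?e {z} Y = ?e {z} YP + ?e {z} YR" for z unfolding Y by (simp add: un)
  have mono1: "?e {z} B \<le> ?e A B" if "z \<in> A" "finite A" "finite B" for z A B
    using that by (intro crossing_mono) auto
  have t1: "?e {t} XP + 1 \<le> card XP" using uniform3_crossing_less[OF U] fin tXP by blast
  have t2: "?e {t} XR \<le> card XR" "?e {t} XQ \<le> card XQ" "?e {t} SP \<le> card SP" "?e {t} SR \<le> card SR"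
     "?e {t} SQ \<le> card SQ" "?e {t} YR \<le> card YR"
    using uniform3_crossing_le[OF U] fin by blast+
  have t3: "?e {t} XQ \<le> ?e XP XQ" "?e {t} SQ \<le> ?e XP SQ" "?e {t} YP \<le> ?e XP YP" "?e {t} YR \<le> ?e XP YR"
    using mono1 tXP fin by blast+
  note t4 = t(2)[unfolded degree]
  have SQ: "2 \<le> ?e {q} XP + ?e {q} XR + ?e {q} XQ" "1 \<le> ?e {q} YP + ?e {q} YR"
    "?e {q} XP \<le> card XP" "?e {q} XR \<le> card XR" "?e {q} XQ \<le> card XQ" "?e {q} YR \<le> card YR"
    if "q \<in> SP \<union> SR \<union> SQ" for q
    using SX[of q] SY[of q] that uniform3_crossing_le[OF U] fin unfolding S toX toY by blast+
  show ?thesis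
  proof (cases "XQ = {} \<or> YP = {}")
    case False
    \<comment> \<open>The opposite corners of \<open>(X, Y)\<close> and \<open>(Q, P)\<close>. Both
      orders are at least 3 while submodularity bounds their sum by 6, so no edge can exist that
      only the original pairs count.\<close>
    have sep: "separation V XQ (Y \<union> P)" "separation V (X \<union> SQ) YP"
      using False csub sub s t by (auto simp: separation_def cells)
    have "3 \<le> cut_order V w XQ (Y \<union> P)" using U sep by (simp add: uniform3_def)
    moreover have "V - XQ - (Y \<union> P) = XR \<union> SR \<union> SQ" using sub YQ by (auto simp: cells)
    moreover have "Y \<union> P = XP \<union> SP \<union> YP \<union> YR" using P Y by auto
    ultimately have d: "3 \<le> card XR + card SR + card SQ + (?e XQ XP + ?e XQ SP + ?e XQ YP + ?e XQ YR)"
      by (simp add: cut_order_def un)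
    have "3 \<le> cut_order V w (X \<union> SQ) YP" using U sep by (simp add: uniform3_def)
    moreover have "V - (X \<union> SQ) - YP = SP \<union> SR \<union> YR" using sub YQ by (auto simp: cells)
    moreover have "X \<union> SQ = XP \<union> XR \<union> XQ \<union> SQ" using X by auto
    ultimately have e: "3 \<le> card SP + card SR + card YR + (?e XP YP + ?e XR YP + ?e XQ YP + ?e SQ YP)"
      by (simp add: cut_order_def un)
    note comm = crossing_commute[of XQ XP] crossing_commute[of XQ SP] crossing_commute[of XQ YP]
      crossing_commute[of SQ YP]
    have z: "?e XP YR = 0" "?e XR YR = 0" "?e XP SQ = 0" "?e SP SQ = 0"
      using a b d e comm by linarith+
    \<comment> \<open>As \<open>XP\<close> has no edges to \<open>YR\<close> or \<open>SQ\<close>,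
      the degree of \<open>t\<close> has to be found in the remaining cells.\<close>
    have bound: "4 \<le> card XP - 1 + card XR + ?e XP XQ + card SP + card SR + ?e XP YP"
      using t1 t2(1,3,4) t3 t4 z by linarith
    have one: "card SQ + card XR + card SR \<le> 1"
      using bound a b c(1) d e comm z pos by linarith
    then have o: "card SQ = 1" "card XR = 0" "card SR = 0" "card XP = 1"
      using pos c(1) by linarith+
    have xq: "?e XP XQ = 2" "?e SP XQ = 0"
      using bound a b d e comm z o by linarith+
    \<comment> \<open>A vertex of \<open>SP\<close> needs two edges into \<open>X\<close>, but
      \<open>XP\<close> has one vertex, \<open>XR\<close> none, and no edge joins \<open>SP\<close>
      to \<open>XQ\<close>.\<close>
    have "SP = {}"
    proof (rule ccontr)
      assume "SP \<noteq> {}"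
      then obtain q where q: "q \<in> SP" by blast
      then have "?e {q} XQ \<le> ?e SP XQ" using mono1 fin by blast
      then show False using SQ(1,3,4)[of q] q xq o by simp
    qed
    moreover have "SR = {}" using o(3) fin by simp
    moreover have "SQ = {s}" using o(1) sSQ by (metis card_1_singletonE singletonD)
    ultimately have Ss: "V - X - Y = {s}" using S by simp
    have "?e {s} YP \<le> ?e SQ YP" "?e {s} YR \<le> card YR" using mono1 sSQ fin SQ(6) by blast+
    \<comment> \<open>Now \<open>s\<close> is the only separator vertex; with at most one edge to
      \<open>Y\<close> it can be moved to \<open>X\<close>, which leaves an edge cut.\<close>
    then have "?e {s} Y \<le> 1" using b xq comm unfolding toY by linarith
    then have "cut_order V w (insert s X) Y \<le> 3"
      using cut_order_insert_left[OF sub(1,2,5) s(2)] XY(2) by linarith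
    moreover have V': "insert s X \<union> Y = V" using Ss sub by auto
    ultimately have "?e (insert s X) Y \<le> 3" using cut_order_partition by metis
    moreover have "insert s X \<inter> Y = {}" using s sub by auto
    moreover have "card X \<le> card (insert s X)"
      by (rule card_mono) (use finite_subset_V sub in auto)
    ultimately have "nontrivial_edge_cut V w (insert s X) Y"
      using V' cards by (simp add: nontrivial_edge_cut_def)
    then show ?thesis by blast
  next
    case True
    have False
    proof (cases "XQ = {}")
      case XQ: True
      have sq: "2 \<le> card SQ" using c XQ by simp
      \<comment> \<open>Of the at least two edges from a vertex of \<open>SQ\<close> into
        \<open>X\<close>, at most \<open>card XR\<close> end in \<open>XR\<close>; for larger
        \<open>XR\<close> the truncated bound is 0.\<close>
      have SQXP: "card SQ * (2 - card XR) \<le> ?e SQ XP"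
      proof (rule crossing_ge_card)
        fix q assume "q \<in> SQ"
        then show "2 - card XR \<le> ?e {q} XP" using SQ(1,4)[of q] XQ by simp
      qed
      have SQYP: "card SQ * (1 - card YR) \<le> ?e SQ YP"
      proof (rule crossing_ge_card)
        fix q assume "q \<in> SQ"
        then show "1 - card YR \<le> ?e {q} YP" using SQ(2,6)[of q] by simp
      qed
      have yq: "1 \<le> card YR + ?e YP SQ"
        using SQYP sq crossing_commute[of SQ YP] by (cases "card YR") auto
      note comm = crossing_commute[of SQ XP]
      consider "card XR = 0" | "card XR = 1" | "2 \<le> card XR" by linarith
      then show False
      proof cases
        case 1
        then show False using SQXP sq b comm by simp
      next
        case 2
        then show False using SQXP sq b comm yq by simp
      next
        case 3
        \<comment> \<open>\<open>XR\<close> and the contribution from \<open>yq\<close> exhaust the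
          order of \<open>(P, Q)\<close>, and three vertices in \<open>SQ\<close> exhaust that of
          \<open>(X, Y)\<close>; so \<open>t\<close> has at most the two neighbours in
          \<open>XR\<close>.\<close>
        then have "card XR = 2" "?e XP SQ = 0" using b yq by linarith+
        moreover have "card SQ = 3" "card XP = 1" using a c pos 3 by linarith+
        ultimately show False using a t1 t2 t3 t4 XQ by simp
      qed
    next
      case False
      then have YP: "YP = {}" using True by simp
      have xq: "1 \<le> card XQ" using False fin by (simp add: Suc_le_eq card_gt_0_iff)
      have cc: "card YR \<ge> 2" "card YR \<le> 3" using c b xq pos YP by simp_all
      then consider "card YR = 3" | "card YR = 2" by linarith
      then show False
      proof cases
        case 1
        \<comment> \<open>The order of \<open>(P, Q)\<close> is spent on \<open>YR\<close>. Once
          \<open>XP\<close> is just \<open>t\<close>, the neighbours of \<open>t\<close> lie in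
          \<open>SP\<close> and \<open>Y\<close>, and the order of \<open>(X, Y)\<close> also pays
          for \<open>SQ\<close>, so there are at most two.\<close>
        then have z: "card XR = 0" "card SR = 0" "?e XP XQ = 0" "?e XP SQ = 0" using b by linarith+
        have "?e {s} XP \<le> ?e SQ XP" using mono1 sSQ fin by blast
        then have "?e {s} XP = 0" using z crossing_commute[of SQ XP] by simp
        then have "2 \<le> card XQ" using SQ(1,4,5)[of s] z sSQ by simp
        then have "card XP = 1" using c 1 YP pos by simp
        then show False using z t1 t2 t3 t4 a pos YP by simp
      next
        case 2
        then have o: "card XP = 1" "card XQ = 1" "card XR = 0" using c YP pos xq by simp_all
        \<comment> \<open>Two edges lead into \<open>X\<close>, and at most one of them to the
          single vertex of \<open>XQ\<close>.\<close>
        have deg1: "1 \<le> ?e {q} XP" if "q \<in> SQ" for q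
          using SQ(1,4,5)[of q] o that by simp
        have "card SQ * 1 \<le> ?e SQ XP" by (rule crossing_ge_card) (use deg1 in simp)
        then have z: "card SQ = 1" "?e XP SQ = 1" "?e SP XQ = 0" "?e XP XQ = 0" "card SR = 0"
          using b 2 pos crossing_commute[of SQ XP] by linarith+
        have "SP = {}"
        proof (rule ccontr)
          assume "SP \<noteq> {}"
          then obtain q where q: "q \<in> SP" by blast
          then have "?e {q} XQ \<le> ?e SP XQ" using mono1 fin by blast
          then show False using SQ(1,3,4)[of q] q z o by simp
        qed
        then show False using z o 2 t1 t2 t3 t4 YP by simp
      qed
    qed
    then show ?thesis ..
  qed
qed

text \<open>If no separator vertex of the extremal pair has high degree, the pair extends to an edge
  cut directly. Otherwise some \<open>(P, Q)\<close> separates \<open>t\<close> from a high-degree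
  separator vertex \<open>s\<close>, and the extremal choice forces
  \<open>Y \<inter> Q = {}\<close>, as \<open>uncross_high_degree\<close> requires.\<close>

lemma nontrivial_edge_cut_of_two_high_degrees:
  assumes U: "uniform3 V w" and ab: "a \<in> V" "b \<in> V" "a \<noteq> b"
    and deg: "4 \<le> crossing w {a} V" "4 \<le> crossing w {b} V"
  shows "\<exists>A B. nontrivial_edge_cut V w A B"
proof -
  let ?e = "crossing w"
  define T where "T = {v \<in> V. 4 \<le> ?e {v} V}"
  define good where "good X Y \<longleftrightarrow> separation V X Y \<and> cut_order V w X Y \<le> 3 \<and> X \<inter> T \<noteq> {} \<and> Y \<inter> T \<noteq> {}"
    for X Y
  have lower: "3 \<le> cut_order V w X Y" if "separation V X Y" for X Y
    using U that by (simp add: uniform3_def)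
  have goodI: "\<exists>X Y. good X Y \<and> p \<in> X \<and> q \<in> Y" if "p \<in> T" "q \<in> T" "p \<noteq> q" for p q
    using U that unfolding good_def uniform3_def T_def by blast
  have good_commute: "good X Y \<Longrightarrow> good Y X" for X Y
    using separation_commute cut_order_commute[of X Y] by (auto simp: good_def)
  have "a \<in> T" "b \<in> T" using ab deg by (auto simp: T_def)
  then obtain X1 Y1 where "good X1 Y1" using goodI ab(3) by blast
  then obtain X2 Y2 where min: "good X2 Y2" "\<And>X Y. good X Y \<Longrightarrow> card X2 \<le> card X"
    using ex_has_least_nat[of "\<lambda>p. good (fst p) (snd p)" "(X1, Y1)" "\<lambda>p. card (fst p)"] by auto
  define best where "best p \<longleftrightarrow> good (fst p) (snd p) \<and> card (fst p) = card X2" for p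
  have "best (X2, Y2)" using min by (simp add: best_def)
  then obtain p where p: "best p" "\<And>q. best q \<Longrightarrow> card V - card (snd p) \<le> card V - card (snd q)"
    using ex_has_least_nat[of best "(X2, Y2)" "\<lambda>p. card V - card (snd p)"] by auto
  obtain X Y where p_def: "p = (X, Y)" by fastforce
  have good: "good X Y" and minX: "\<And>P Q. good P Q \<Longrightarrow> card X \<le> card P"
    using p(1) min(2) by (auto simp: best_def p_def)
  have maxY: "Y' = Y" if "good X Y'" "Y \<subseteq> Y'" for Y'
  proof -
    have "best (X, Y')" using p(1) that by (simp add: best_def p_def)
    then have "card V - card Y \<le> card V - card Y'" using p(2) by (auto simp: p_def)
    moreover have Y': "Y' \<subseteq> V" using that by (auto simp: good_def separation_def)
    moreover have "card Y' \<le> card V" using Y' finite_V by (rule card_mono[rotated])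
    ultimately have "card Y' \<le> card Y" by linarith
    then show ?thesis using card_seteq[of Y' Y] that Y' finite_subset_V by auto
  qed
  have sep: "separation V X Y" and c: "cut_order V w X Y \<le> 3" using good by (auto simp: good_def)
  have sub: "X \<subseteq> V" "Y \<subseteq> V" "X \<inter> Y = {}" using sep by (auto simp: separation_def)
  note fin = sub(1,2)[THEN finite_subset_V]
  \<comment> \<open>With at most one edge into \<open>X\<close>, the vertex could join
    \<open>Y\<close> without raising the order, against the maximality of \<open>Y\<close>.\<close>
  have SX: "2 \<le> ?e {q} X" if q: "q \<in> V - X - Y" for q
  proof (rule ccontr)
    assume "\<not> 2 \<le> ?e {q} X"
    then have "cut_order V w X (insert q Y) \<le> 3" using cut_order_insert_right[OF sub q] c by linarith
    then have "good X (insert q Y)" using good q by (auto simp: good_def separation_def)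
    then show False using maxY[of "insert q Y"] q by blast
  qed
  \<comment> \<open>Without an edge into \<open>Y\<close>, the vertex could join \<open>X\<close>
    and push the order below 3.\<close>
  have SY: "1 \<le> ?e {q} Y" if q: "q \<in> V - X - Y" for q
  proof -
    have "separation V (insert q X) Y" using sep q by (auto simp: separation_def)
    then show ?thesis using lower cut_order_insert_left[OF sub q] c by fastforce
  qed
  obtain t where t: "t \<in> X" "t \<in> T" using good by (auto simp: good_def)
  have deg_t: "4 \<le> ?e {t} V" using t by (simp add: T_def)
  \<comment> \<open>If \<open>X\<close> were just \<open>t\<close>, each edge at \<open>t\<close>
    would end in \<open>Y\<close> or in the separator and be charged to the order, so the degree
    would be at most 3.\<close>
  have X2: "2 \<le> card X"
  proof (rule ccontr)
    assume "\<not> 2 \<le> card X"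
    moreover have "0 < card X" using t(1) fin(1) card_gt_0_iff by blast
    ultimately have "card X = 1" by linarith
    then have X: "X = {t}" using t(1) by (metis card_1_singletonE singletonD)
    have "?e {t} V = ?e {t} (X \<union> Y) + ?e {t} (V - X - Y)"
      by (rule degree_partition) (use sub in auto)
    also have "?e {t} (X \<union> Y) = ?e {t} {t} + ?e {t} Y"
      unfolding X[symmetric] by (rule crossing_union_right) (use fin sub in auto)
    also have "?e {t} (V - X - Y) \<le> card (V - X - Y)"
      by (rule uniform3_crossing_le[OF U]) (use finite_V in auto)
    finally show False using deg_t c X by (simp add: cut_order_def crossing_def)
  qed
  have Y2: "card X \<le> card Y" using minX good_commute[OF good] by blast
  show ?thesis
  proof (cases "(V - X - Y) \<inter> T = {}")
    case True
    have "?e {q} V \<le> 3" if "q \<in> V - X - Y" for q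
      using True that by (fastforce simp: T_def)
    then obtain A B where AB: "X \<subseteq> A" "Y \<subseteq> B" "A \<union> B = V" "A \<inter> B = {}" "?e A B \<le> 3"
      using extend_to_edge_cut[OF sub c] by blast
    have "card X \<le> card A" "card Y \<le> card B"
      by (rule card_mono; use AB finite_subset_V in auto)+
    then have "2 \<le> card A" "2 \<le> card B" using X2 Y2 by linarith+
    then show ?thesis using AB unfolding nontrivial_edge_cut_def by blast
  next
    case False
    then obtain s where s: "s \<in> V - X - Y" "s \<in> T" by blast
    then have "t \<noteq> s" using t by auto
    then obtain P Q where PQ: "good P Q" "t \<in> P" "s \<in> Q" using goodI t s by blast
    have sepPQ: "separation V P Q" "cut_order V w P Q \<le> 3" using PQ by (auto simp: good_def)
    have subPQ: "P \<subseteq> V" "Q \<subseteq> V" "P \<inter> Q = {}" using sepPQ by (auto simp: separation_def)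
    \<comment> \<open>Otherwise both corners are pairs, so
      \<open>(X \<inter> P, Y \<union> Q)\<close> has order at most 3 and is good, with
      \<open>t\<close> and \<open>s\<close> as its high-degree vertices. Minimality gives
      \<open>X \<inter> P = X\<close> and maximality then \<open>Q \<subseteq> Y\<close>, but
      \<open>s\<close> is not in \<open>Y\<close>.\<close>
    have "Y \<inter> Q = {}"
    proof (rule ccontr)
      assume ne: "Y \<inter> Q \<noteq> {}"
      have s1: "separation V (X \<inter> P) (Y \<union> Q)" and s2: "separation V (X \<union> P) (Y \<inter> Q)"
        using sub subPQ t PQ ne by (auto simp: separation_def)
      have "cut_order V w (X \<inter> P) (Y \<union> Q) \<le> 3"
        using cut_order_submodular[OF sub subPQ] lower[OF s2] c sepPQ(2) by linarith
      then have g: "good (X \<inter> P) (Y \<union> Q)" using s1 t PQ s by (auto simp: good_def)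
      then have "card X \<le> card (X \<inter> P)" by (rule minX)
      then have "X \<inter> P = X" using fin(1) by (simp add: card_seteq)
      then have "Y \<union> Q = Y" using maxY g by simp
      then show False using s PQ by auto
    qed
    moreover have "card X \<le> card Q" using minX good_commute[OF PQ(1)] by blast
    ultimately show ?thesis
      using uncross_high_degree[OF U sep c sepPQ _ deg_t PQ(3) s(1) _ _ Y2 X2 SX SY] t PQ by blast
  qed
qed

end

section \<open>Contraction, join and extension\<close>

context weighted_graph
begin

lemma nontrivial_edge_cut_commute: "nontrivial_edge_cut V w A B \<Longrightarrow> nontrivial_edge_cut V w B A"
  by (auto simp: nontrivial_edge_cut_def crossing_commute[of A B])

text \<open>A vertex of \<open>A\<close> with two edges to \<open>B\<close> could be moved into the
  separator, lowering the order to at most 2. So the three edges have distinct ends in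
  \<open>A\<close>, and by symmetry they form a matching.\<close>

lemma nontrivial_edge_cut_matching:
  assumes U: "uniform3 V w" and AB: "nontrivial_edge_cut V w A B"
  shows "crossing w A B = 3" and "a \<in> A \<Longrightarrow> crossing w {a} B \<le> 1" and "3 \<le> card A"
proof -
  have V: "A \<union> B = V" "A \<inter> B = {}" and card: "2 \<le> card A" "2 \<le> card B" and e: "crossing w A B \<le> 3"
    using AB by (auto simp: nontrivial_edge_cut_def)
  have fin: "finite A" "finite B" using V finite_V by auto
  have ne: "A \<noteq> {}" "B \<noteq> {}" using card by auto
  have "separation V A B" using V ne by (auto simp: separation_def)
  then have "3 \<le> cut_order V w A B" using U by (simp add: uniform3_def)
  then show e3: "crossing w A B = 3" using e cut_order_partition[OF V(1)] by linarith
  have one: "crossing w {a} B \<le> 1" if a: "a \<in> A" for a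
  proof -
    have ins: "insert a (A - {a}) = A" using a by auto
    have "A - {a} \<noteq> {}"
    proof
      assume "A - {a} = {}"
      then have "A = {a}" using a by auto
      then show False using card(1) by simp
    qed
    then have sep: "separation V (A - {a}) B" using V ne by (auto simp: separation_def)
    then have "3 \<le> cut_order V w (A - {a}) B" using U by (simp add: uniform3_def)
    moreover have "cut_order V w (insert a (A - {a})) B + 1 =
        cut_order V w (A - {a}) B + crossing w {a} B"
      by (rule cut_order_insert_left) (use V a in auto)
    ultimately show ?thesis using e cut_order_partition[OF V(1)] unfolding ins by linarith
  qed
  then show "a \<in> A \<Longrightarrow> crossing w {a} B \<le> 1" .
  have "crossing w A B \<le> card A * 1" by (rule crossing_le_card) (use one in auto)
  then show "3 \<le> card A" using e3 by simp
qed

end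

text \<open>The graph on \<open>insert v A\<close> arises from the graph on \<open>A \<union> B\<close> by contracting \<open>B\<close> to \<open>v\<close>.\<close>

locale contraction = weighted_graph V w + quotient: weighted_graph "insert v A" w'
  for V :: "'v set" and w A B and v :: 'v and w' +
  assumes partition: "A \<union> B = V" "A \<inter> B = {}"
    and new: "v \<notin> A"
    and inner: "a \<in> A \<Longrightarrow> b \<in> A \<Longrightarrow> w' a b = w a b"
    and outer: "a \<in> A \<Longrightarrow> w' v a = crossing w {a} B"
begin

text \<open>The share of the order that lies inside \<open>A\<close>. It is the same in the graph
  and in the quotient and thus serves to translate pairs.\<close>

definition inner_order :: "'v set \<Rightarrow> 'v set \<Rightarrow> nat" where
  "inner_order X Y = card (A - X - Y) + crossing w X Y"

lemma fin: "finite A" "finite B"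
  using partition finite_V by auto

lemma crossing_inner: "X \<subseteq> A \<Longrightarrow> Y \<subseteq> A \<Longrightarrow> crossing w' X Y = crossing w X Y"
  by (rule crossing_cong) (auto intro!: inner)

lemma crossing_new: "Y \<subseteq> A \<Longrightarrow> crossing w' {v} Y = crossing w Y B"
  unfolding crossing_def[of w'] by (auto simp: crossing_def[of w] outer intro!: sum.cong)

text \<open>Together with \<open>cut_order_expand\<close>: having \<open>v\<close> on a side of the
  quotient gives the same order as having all of \<open>B\<close> on that side of the graph.\<close>

lemma quotient_cut_in:
  assumes "X \<subseteq> A" "Y \<subseteq> A" "X \<inter> Y = {}"
  shows "cut_order (insert v A) w' (insert v X) Y = inner_order X Y + crossing w Y B"
    and "cut_order (insert v A) w' Y (insert v X) = inner_order X Y + crossing w Y B"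
proof -
  have "insert v A - insert v X - Y = A - X - Y" using new by auto
  moreover have "crossing w' (insert v X) Y = crossing w' {v} Y + crossing w' X Y"
    by (rule crossing_insert_left) (use assms fin new finite_subset in auto)
  ultimately show "cut_order (insert v A) w' (insert v X) Y = inner_order X Y + crossing w Y B"
    using assms by (simp add: cut_order_def inner_order_def crossing_inner crossing_new)
  then show "cut_order (insert v A) w' Y (insert v X) = inner_order X Y + crossing w Y B"
    by (simp add: quotient.cut_order_commute)
qed

text \<open>The case without a direct counterpart: as a separator vertex \<open>v\<close> costs 1,
  whereas \<open>B\<close> in the separator would cost \<open>card B\<close>.\<close>

lemma quotient_cut_out:
  assumes "X \<subseteq> A" "Y \<subseteq> A"
  shows "cut_order (insert v A) w' X Y = inner_order X Y + 1"
proof -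
  have "insert v A - X - Y = insert v (A - X - Y)" using new assms by auto
  then show ?thesis using assms new fin by (simp add: cut_order_def inner_order_def crossing_inner)
qed

lemma cut_order_expand:
  assumes "X \<subseteq> A" "Y \<subseteq> A" "X \<inter> Y = {}"
  shows "cut_order V w (X \<union> B) Y = inner_order X Y + crossing w Y B"
    and "cut_order V w Y (X \<union> B) = inner_order X Y + crossing w Y B"
proof -
  have "V - (X \<union> B) - Y = A - X - Y" using partition by auto
  moreover have "crossing w (X \<union> B) Y = crossing w X Y + crossing w B Y"
    by (rule crossing_union_left) (use assms fin partition finite_subset in auto)
  ultimately show "cut_order V w (X \<union> B) Y = inner_order X Y + crossing w Y B"
    by (simp add: cut_order_def inner_order_def crossing_commute[of B])
  then show "cut_order V w Y (X \<union> B) = inner_order X Y + crossing w Y B"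
    by (simp add: cut_order_commute)
qed

lemma inner_order_commute: "inner_order X Y = inner_order Y X"
proof -
  have "A - X - Y = A - Y - X" by auto
  then show ?thesis by (simp add: inner_order_def crossing_commute[of X])
qed

lemma crossing_disjoint_le:
  assumes "X \<subseteq> A" "Y \<subseteq> A" "X \<inter> Y = {}"
  shows "crossing w X B + crossing w Y B \<le> crossing w A B"
proof -
  have "crossing w (X \<union> Y) B \<le> crossing w A B"
    by (rule crossing_mono) (use assms fin in auto)
  then show ?thesis using assms fin by (simp add: crossing_union_left finite_subset)
qed

lemma uniform3_quotient:
  assumes U: "uniform3 V w" and AB: "nontrivial_edge_cut V w A B"
  shows "uniform3 (insert v A) w'"
proof -
  have e3: "crossing w A B = 3" and cA: "3 \<le> card A" and cB: "3 \<le> card B"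
    using nontrivial_edge_cut_matching[OF U AB]
      nontrivial_edge_cut_matching[OF U nontrivial_edge_cut_commute[OF AB]] by auto
  have neB: "B \<noteq> {}" using cB by auto
  have lower: "3 \<le> cut_order V w X Y" if "separation V X Y" for X Y
    using U that by (simp add: uniform3_def)
  have expand: "3 \<le> inner_order X Y + crossing w Y B"
    if "X \<subseteq> A" "Y \<subseteq> A" "X \<inter> Y = {}" "Y \<noteq> {}" for X Y
  proof -
    have "separation V (X \<union> B) Y" using that neB partition by (auto simp: separation_def)
    then show ?thesis using lower cut_order_expand[OF that(1-3)] by fastforce
  qed
  have low': "3 \<le> cut_order (insert v A) w' X Y" if "separation (insert v A) X Y" for X Y
  proof -
    have XY: "X \<subseteq> insert v A" "Y \<subseteq> insert v A" "X \<inter> Y = {}" "X \<noteq> {}" "Y \<noteq> {}"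
      using that by (auto simp: separation_def)
    consider "v \<in> X" | "v \<in> Y" | "v \<notin> X" "v \<notin> Y" by blast
    then show ?thesis
    proof cases
      case 1
      then have X: "insert v (X - {v}) = X" and sub: "X - {v} \<subseteq> A" "Y \<subseteq> A" "(X - {v}) \<inter> Y = {}"
        using XY by auto
      show ?thesis using quotient_cut_in(1)[OF sub] expand[OF sub XY(5)] unfolding X by simp
    next
      case 2
      then have Y: "insert v (Y - {v}) = Y" and sub: "Y - {v} \<subseteq> A" "X \<subseteq> A" "(Y - {v}) \<inter> X = {}"
        using XY by auto
      show ?thesis using quotient_cut_in(2)[OF sub] expand[OF sub XY(4)] unfolding Y by simp
    next
      case 3
      then have sub: "X \<subseteq> A" "Y \<subseteq> A" using XY by auto
      \<comment> \<open>Only three edges leave \<open>A\<close>, so one of the sides sends at most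
        one edge to \<open>B\<close>; the inner order is then at least 2, and \<open>v\<close>
        supplies the third unit.\<close>
      have "3 \<le> inner_order X Y + crossing w Y B" "3 \<le> inner_order X Y + crossing w X B"
        using expand[OF sub XY(3,5)] expand[OF sub(2,1) _ XY(4)] XY(3) inner_order_commute[of X Y]
        by auto
      then show ?thesis using crossing_disjoint_le[OF sub XY(3)] e3 quotient_cut_out[OF sub] by linarith
    qed
  qed
  have up1: "\<exists>X Y. separation (insert v A) X Y \<and> s \<in> X \<and> r \<in> Y \<and> cut_order (insert v A) w' X Y \<le> 3"
    if sr: "s \<in> A" "r \<in> A" "s \<noteq> r" for s r
  proof -
    \<comment> \<open>A separating pair of the whole graph is uncrossed with \<open>(A, B)\<close>:
      if one side meets \<open>B\<close>, the corner inside \<open>B\<close> has order at least 3,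
      so the opposite corner, with all of \<open>B\<close> on that side, has order at most
      3.\<close>
    obtain X Y where XY: "separation V X Y" "s \<in> X" "r \<in> Y" "cut_order V w X Y \<le> 3"
      using U sr partition unfolding uniform3_def by blast
    have sub: "X \<subseteq> V" "Y \<subseteq> V" "X \<inter> Y = {}" using XY by (auto simp: separation_def)
    have subA: "A \<subseteq> V" "B \<subseteq> V" "A \<inter> B = {}" "B \<inter> A = {}" using partition by auto
    have cAB: "cut_order V w A B = 3" using cut_order_partition partition e3 by simp
    have subXY: "X \<inter> A \<subseteq> A" "Y \<inter> A \<subseteq> A" "(X \<inter> A) \<inter> (Y \<inter> A) = {}" "(Y \<inter> A) \<inter> (X \<inter> A) = {}"
      using sub by auto
    have sepA: "separation (insert v A) (X \<inter> A) (insert v (Y \<inter> A))"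
      "separation (insert v A) (insert v (X \<inter> A)) (Y \<inter> A)"
      using XY sr sub new by (auto simp: separation_def)
    consider "Y \<inter> B \<noteq> {}" | "X \<inter> B \<noteq> {}" | "Y \<inter> B = {}" "X \<inter> B = {}" by blast
    then show ?thesis
    proof cases
      case 1
      then have "separation V (X \<union> A) (Y \<inter> B)" using sub subA sr by (auto simp: separation_def)
      then have "cut_order V w (X \<inter> A) (Y \<union> B) \<le> 3"
        using lower cut_order_submodular[OF sub subA(1-3)] cAB XY(4) by fastforce
      moreover have "Y \<union> B = (Y \<inter> A) \<union> B" using sub partition by auto
      ultimately have "cut_order (insert v A) w' (X \<inter> A) (insert v (Y \<inter> A)) \<le> 3"
        using cut_order_expand(2)[OF subXY(2,1,4)] quotient_cut_in(2)[OF subXY(2,1,4)] by simp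
      then show ?thesis using sepA(1) XY sr by blast
    next
      case 2
      then have "separation V (X \<inter> B) (Y \<union> A)" using sub subA sr by (auto simp: separation_def)
      then have "cut_order V w (X \<union> B) (Y \<inter> A) \<le> 3"
        using lower cut_order_submodular[OF sub subA(2,1,4)] cAB XY(4) cut_order_commute[of A B]
        by fastforce
      moreover have "X \<union> B = (X \<inter> A) \<union> B" using sub partition by auto
      ultimately have "cut_order (insert v A) w' (insert v (X \<inter> A)) (Y \<inter> A) \<le> 3"
        using cut_order_expand(1)[OF subXY(1,2,3)] quotient_cut_in(1)[OF subXY(1,2,3)] by simp
      then show ?thesis using sepA(2) XY sr by blast
    next
      case 3
      \<comment> \<open>Here \<open>B\<close> lies in the separator. Having at least three vertices
        it is the whole separator and no edge crosses; with \<open>v\<close> on the side of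
        \<open>Y\<close> only the edges from \<open>X\<close> to \<open>B\<close> remain.\<close>
      then have BS: "B \<subseteq> V - X - Y" and XYA: "X \<subseteq> A" "Y \<subseteq> A" using sub partition by auto
      have "card (V - X - Y) \<le> card B" using XY(4) cB by (simp add: cut_order_def)
      then have S: "V - X - Y = B" using BS finite_V card_seteq[of "V - X - Y" B] by auto
      then have "A - Y - X = {}" using partition by auto
      moreover have "crossing w Y X = 0"
        using XY(4) cB S by (simp add: cut_order_def crossing_commute[of Y])
      ultimately have "inner_order Y X = 0"
        unfolding inner_order_def by (metis add_0 card.empty)
      moreover have "crossing w X B \<le> 3"
        using crossing_disjoint_le[OF XYA sub(3)] e3 by simp
      ultimately have "cut_order (insert v A) w' X (insert v Y) \<le> 3"
        using quotient_cut_in(2)[OF XYA(2,1)] sub(3) by (simp add: Int_commute)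
      then show ?thesis using sepA(1) XYA XY(2,3) by (simp add: Int_absorb2) blast
    qed
  qed
  have up2: "separation (insert v A) A {v}" "cut_order (insert v A) w' A {v} \<le> 3"
    using new cA e3 quotient_cut_in(2)[of "{}" A] by (auto simp: separation_def inner_order_def)
  note up3 = separation_commute[OF up2(1)] up2(2)[unfolded quotient.cut_order_commute[of A]]
  show ?thesis unfolding uniform3_def
  proof (intro conjI allI ballI impI)
    show "4 \<le> card (insert v A)" using cA new fin by simp
    show "3 \<le> cut_order (insert v A) w' X Y" if "separation (insert v A) X Y" for X Y
      using low' that .
    fix s r assume sr: "s \<in> insert v A" "r \<in> insert v A" "s \<noteq> r"
    then consider "s \<in> A" "r \<in> A" | "s \<in> A" "r = v" | "s = v" "r \<in> A" by blast
    then show "\<exists>X Y. separation (insert v A) X Y \<and> s \<in> X \<and> r \<in> Y \<and> cut_order (insert v A) w' X Y \<le> 3"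
      by cases (use up1 sr up2 up3 in blast)+
  qed
qed

section \<open>From the quotients back to the whole graph\<close>

lemma quotient_lower:
  assumes U: "uniform3 (insert v A) w'" and XY: "X \<subseteq> A" "Y \<subseteq> A" "X \<inter> Y = {}"
  shows "X \<noteq> {} \<Longrightarrow> Y \<noteq> {} \<Longrightarrow> 2 \<le> inner_order X Y"
    and "Y \<noteq> {} \<Longrightarrow> 3 \<le> inner_order X Y + crossing w Y B"
proof -
  have lower: "3 \<le> cut_order (insert v A) w' X Y" if "separation (insert v A) X Y" for X Y
    using U that by (simp add: uniform3_def)
  show "2 \<le> inner_order X Y" if "X \<noteq> {}" "Y \<noteq> {}"
  proof -
    \<comment> \<open>The vertex \<open>v\<close> is in the separator and accounts for one of the
      three.\<close>
    have "separation (insert v A) X Y" using that XY by (auto simp: separation_def)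
    then show ?thesis using lower quotient_cut_out[OF XY(1,2)] by fastforce
  qed
  show "3 \<le> inner_order X Y + crossing w Y B" if "Y \<noteq> {}"
  proof -
    have "separation (insert v A) (insert v X) Y" using that XY new by (auto simp: separation_def)
    then show ?thesis using lower quotient_cut_in(1)[OF XY] by fastforce
  qed
qed

text \<open>A pair of the quotient is lifted by replacing \<open>v\<close> with \<open>B\<close>. If
  \<open>v\<close> is a separator vertex, the inner order is at most 2, and \<open>B\<close> is put
  opposite to a side that sends at most one edge to it.\<close>

lemma quotient_upper:
  assumes U: "uniform3 (insert v A) w'" and e3: "crossing w A B = 3"
    and sr: "s \<in> A" "r \<in> A" "s \<noteq> r"
  shows "\<exists>X Y. separation V X Y \<and> s \<in> X \<and> r \<in> Y \<and> cut_order V w X Y \<le> 3"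
proof -
  have "\<exists>X Y. separation (insert v A) X Y \<and> s \<in> X \<and> r \<in> Y \<and>
      cut_order (insert v A) w' X Y \<le> 3"
    using U sr unfolding uniform3_def by blast
  then obtain X Y where XY: "separation (insert v A) X Y" "s \<in> X" "r \<in> Y"
    "cut_order (insert v A) w' X Y \<le> 3" by blast
  have sub: "X \<subseteq> insert v A" "Y \<subseteq> insert v A" "X \<inter> Y = {}" using XY by (auto simp: separation_def)
  have left: ?thesis if X: "X' \<subseteq> A" "Y' \<subseteq> A" "X' \<inter> Y' = {}" "s \<in> X'" "r \<in> Y'"
    "inner_order X' Y' + crossing w Y' B \<le> 3" for X' Y'
  proof -
    have "separation V (X' \<union> B) Y'" using X partition by (auto simp: separation_def)
    then show ?thesis using X cut_order_expand(1)[OF X(1-3)] by fastforce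
  qed
  have right: ?thesis if X: "X' \<subseteq> A" "Y' \<subseteq> A" "X' \<inter> Y' = {}" "s \<in> X'" "r \<in> Y'"
    "inner_order Y' X' + crossing w X' B \<le> 3" for X' Y'
  proof -
    have "separation V X' (Y' \<union> B)" using X partition by (auto simp: separation_def)
    then show ?thesis using X cut_order_expand(2)[OF X(2,1)] by fastforce
  qed
  consider "v \<in> X" | "v \<in> Y" | "v \<notin> X" "v \<notin> Y" by blast
  then show ?thesis
  proof cases
    case 1
    then have X: "insert v (X - {v}) = X" and X': "X - {v} \<subseteq> A" "Y \<subseteq> A" "(X - {v}) \<inter> Y = {}"
      using sub by auto
    show ?thesis
      by (rule left[OF X']) (use XY sr new quotient_cut_in(1)[OF X'] X in auto)
  next
    case 2
    then have Y: "insert v (Y - {v}) = Y" and Y': "Y - {v} \<subseteq> A" "X \<subseteq> A" "(Y - {v}) \<inter> X = {}"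
      using sub by auto
    show ?thesis
      by (rule right[OF Y'(2,1)]) (use XY sr new quotient_cut_in(2)[OF Y'] Y Y' in auto)
  next
    case 3
    then have XYA: "X \<subseteq> A" "Y \<subseteq> A" using sub by auto
    then have "inner_order X Y \<le> 2" using XY quotient_cut_out by simp
    moreover have "crossing w X B + crossing w Y B \<le> 3"
      using crossing_disjoint_le[OF XYA sub(3)] e3 by simp
    ultimately consider "inner_order X Y + crossing w Y B \<le> 3" | "inner_order Y X + crossing w X B \<le> 3"
      using inner_order_commute[of X Y] by linarith
    then show ?thesis by cases (use left right XYA sub XY in blast)+
  qed
qed

end

text \<open>The order splits into the inner orders on \<open>A\<close> and \<open>B\<close> and the
  matching edges. If both sides meet both parts, the inner orders give 2 + 2. If a side misses a
  part, its matching edges towards that part are charged to crossing edges or to separator vertices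
  there.\<close>

lemma uniform3_join:
  assumes C1: "contraction V w A B v wA" and C2: "contraction V w B A u wB"
    and U1: "uniform3 (insert v A) wA" and U2: "uniform3 (insert u B) wB"
    and e3: "crossing w A B = 3"
    and match: "\<And>a. a \<in> A \<Longrightarrow> crossing w {a} B \<le> 1" "\<And>b. b \<in> B \<Longrightarrow> crossing w {b} A \<le> 1"
  shows "uniform3 V w"
proof -
  interpret C1: contraction V w A B v wA by fact
  interpret C2: contraction V w B A u wB by fact
  let ?e = "crossing w"
  have V: "A \<union> B = V" "A \<inter> B = {}" using C1.partition .
  have fin: "finite A" "finite B" using C1.fin .
  have eBA: "?e B A = 3" using e3 C1.crossing_commute by metis
  have cardA: "3 \<le> card A" using U1 fin C1.new by (simp add: uniform3_def)
  have cardB: "3 \<le> card B" using U2 fin C2.new by (simp add: uniform3_def)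
  have split: "cut_order V w X Y = C1.inner_order (X \<inter> A) (Y \<inter> A) + C2.inner_order (X \<inter> B) (Y \<inter> B)
      + ?e (X \<inter> A) (Y \<inter> B) + ?e (X \<inter> B) (Y \<inter> A)"
    if "X \<subseteq> V" "Y \<subseteq> V" for X Y
  proof -
    have S: "V - X - Y = (A - X \<inter> A - Y \<inter> A) \<union> (B - X \<inter> B - Y \<inter> B)" using V by auto
    have cS: "card (V - X - Y) = card (A - X \<inter> A - Y \<inter> A) + card (B - X \<inter> B - Y \<inter> B)"
      unfolding S by (rule card_Un_disjoint) (use fin V in auto)
    have X: "X = (X \<inter> A) \<union> (X \<inter> B)" and Y: "Y = (Y \<inter> A) \<union> (Y \<inter> B)" using that V by auto
    have dj: "(Z \<inter> A) \<inter> (Z \<inter> B) = {}" for Z using V by auto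
    have "?e X Y = ?e (X \<inter> A) Y + ?e (X \<inter> B) Y"
      by (subst X, rule crossing_union_left) (use fin dj in auto)
    also have "?e (X \<inter> A) Y = ?e (X \<inter> A) (Y \<inter> A) + ?e (X \<inter> A) (Y \<inter> B)"
      by (subst Y, rule crossing_union_right) (use fin dj in auto)
    also have "?e (X \<inter> B) Y = ?e (X \<inter> B) (Y \<inter> A) + ?e (X \<inter> B) (Y \<inter> B)"
      by (subst Y, rule crossing_union_right) (use fin dj in auto)
    finally show ?thesis using cS by (simp add: cut_order_def C1.inner_order_def C2.inner_order_def)
  qed
  have matchA: "?e Z B \<le> card Z" if "Z \<subseteq> A" for Z
    using crossing_le_card[of Z w B 1] match(1) that by auto
  have matchB: "?e A Z \<le> card Z" if "Z \<subseteq> B" for Z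
    using crossing_le_card[of Z w A 1] match(2) that C1.crossing_commute[of A Z] by auto
  \<comment> \<open>Because of the matching, the edges from \<open>Z\<close> that miss
    \<open>W\<close> end in different vertices of \<open>B - W\<close>.\<close>
  have three: "?e Z B \<le> card (B - W) + ?e Z W" if "Z \<subseteq> A" "W \<subseteq> B" for Z W
  proof -
    have "?e Z B = ?e Z (W \<union> (B - W))" using that by (simp add: Un_absorb1)
    also have "\<dots> = ?e Z W + ?e Z (B - W)"
      by (rule crossing_union_right) (use fin that finite_subset in auto)
    also have "?e Z (B - W) \<le> ?e A (B - W)" by (rule crossing_mono) (use fin that in auto)
    also have "\<dots> \<le> card (B - W)" by (rule matchB) auto
    finally show ?thesis by simp
  qed
  have three': "?e Z A \<le> card (A - W) + ?e Z W" if "Z \<subseteq> B" "W \<subseteq> A" for Z W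
  proof -
    have "?e Z A = ?e Z (W \<union> (A - W))" using that by (simp add: Un_absorb1)
    also have "\<dots> = ?e Z W + ?e Z (A - W)"
      by (rule crossing_union_right) (use fin that finite_subset in auto)
    also have "?e Z (A - W) \<le> ?e B (A - W)" by (rule crossing_mono) (use fin that in auto)
    also have "\<dots> \<le> card (A - W)" using matchA[of "A - W"] C1.crossing_commute[of B] by auto
    finally show ?thesis by simp
  qed
  have lower1: "3 \<le> cut_order V w X Y"
    if XY: "X \<subseteq> V" "Y \<subseteq> V" "X \<inter> Y = {}" and A: "X \<inter> A \<noteq> {}" "Y \<inter> A \<noteq> {}" for X Y
  proof -
    let ?XA = "X \<inter> A" and ?YA = "Y \<inter> A" and ?XB = "X \<inter> B" and ?YB = "Y \<inter> B"
    have dA: "?XA \<subseteq> A" "?YA \<subseteq> A" "?XA \<inter> ?YA = {}" "?YA \<inter> ?XA = {}" using XY by auto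
    have dB: "?XB \<subseteq> B" "?YB \<subseteq> B" "?XB \<inter> ?YB = {}" using XY by auto
    have two: "2 \<le> C1.inner_order ?XA ?YA" by (rule C1.quotient_lower(1)[OF U1 dA(1-3) A])
    consider "?XB \<noteq> {}" "?YB \<noteq> {}" | "?YB = {}" | "?XB = {}" by blast
    then show ?thesis
    proof cases
      case 1
      have "2 \<le> C2.inner_order ?XB ?YB" by (rule C2.quotient_lower(1)[OF U2 dB 1])
      then show ?thesis using two split[OF XY(1,2)] by linarith
    next
      case 2
      then have "C2.inner_order ?XB ?YB = card (B - ?XB)" by (simp add: C2.inner_order_def)
      moreover have "3 \<le> C1.inner_order ?XA ?YA + ?e ?YA B"
        by (rule C1.quotient_lower(2)[OF U1 dA(1-3) A(2)])
      moreover have "?e ?YA B \<le> card (B - ?XB) + ?e ?YA ?XB" using three dA dB by blast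
      ultimately show ?thesis
        using split[OF XY(1,2)] C1.crossing_commute[of ?YA ?XB] by linarith
    next
      case 3
      then have "C2.inner_order ?XB ?YB = card (B - ?YB)" by (simp add: C2.inner_order_def)
      moreover have "3 \<le> C1.inner_order ?YA ?XA + ?e ?XA B"
        by (rule C1.quotient_lower(2)[OF U1 dA(2,1,4) A(1)])
      moreover have "?e ?XA B \<le> card (B - ?YB) + ?e ?XA ?YB" using three dA dB by blast
      ultimately show ?thesis
        using split[OF XY(1,2)] C1.inner_order_commute[of ?XA ?YA] by linarith
    qed
  qed
  have lower2: "3 \<le> cut_order V w X Y"
    if XY: "X \<subseteq> V" "Y \<subseteq> V" "X \<inter> Y = {}" and B: "X \<inter> B \<noteq> {}" "Y \<inter> B \<noteq> {}" for X Y
  proof -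
    let ?XA = "X \<inter> A" and ?YA = "Y \<inter> A" and ?XB = "X \<inter> B" and ?YB = "Y \<inter> B"
    have dA: "?XA \<subseteq> A" "?YA \<subseteq> A" "?XA \<inter> ?YA = {}" "?YA \<inter> ?XA = {}" using XY by auto
    have dB: "?XB \<subseteq> B" "?YB \<subseteq> B" "?XB \<inter> ?YB = {}" "?YB \<inter> ?XB = {}" using XY by auto
    have two: "2 \<le> C2.inner_order ?XB ?YB" by (rule C2.quotient_lower(1)[OF U2 dB(1-3) B])
    consider "?XA \<noteq> {}" "?YA \<noteq> {}" | "?YA = {}" | "?XA = {}" by blast
    then show ?thesis
    proof cases
      case 1
      have "2 \<le> C1.inner_order ?XA ?YA" by (rule C1.quotient_lower(1)[OF U1 dA(1-3) 1])
      then show ?thesis using two split[OF XY(1,2)] by linarith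
    next
      case 2
      then have "C1.inner_order ?XA ?YA = card (A - ?XA)" by (simp add: C1.inner_order_def)
      moreover have "3 \<le> C2.inner_order ?XB ?YB + ?e ?YB A"
        by (rule C2.quotient_lower(2)[OF U2 dB(1-3) B(2)])
      moreover have "?e ?YB A \<le> card (A - ?XA) + ?e ?YB ?XA" using three' dA dB by blast
      ultimately show ?thesis
        using split[OF XY(1,2)] C1.crossing_commute[of ?YB ?XA] by linarith
    next
      case 3
      then have "C1.inner_order ?XA ?YA = card (A - ?YA)" by (simp add: C1.inner_order_def)
      moreover have "3 \<le> C2.inner_order ?YB ?XB + ?e ?XB A"
        by (rule C2.quotient_lower(2)[OF U2 dB(2,1,4) B(1)])
      moreover have "?e ?XB A \<le> card (A - ?YA) + ?e ?XB ?YA" using three' dA dB by blast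
      ultimately show ?thesis
        using split[OF XY(1,2)] C2.inner_order_commute[of ?XB ?YB] by linarith
    qed
  qed
  \<comment> \<open>Each of the three matching edges either crosses or has an end in the
    separator.\<close>
  have lower3: "3 \<le> cut_order V w X Y" if "X \<subseteq> A" "Y \<subseteq> B" for X Y
  proof -
    have "?e A B \<le> ?e X B + card (A - X)"
      using three'[of B X] that C1.crossing_commute[of B] by auto
    also have "?e X B \<le> card (B - Y) + ?e X Y" using three that by blast
    finally have "3 \<le> card (B - Y) + ?e X Y + card (A - X)" using e3 by simp
    moreover have "V - X - Y = (A - X) \<union> (B - Y)" "(A - X) \<inter> (B - Y) = {}" using V that by auto
    ultimately show ?thesis using fin by (simp add: cut_order_def card_Un_disjoint)
  qed
  have "separation V A B" using V cardA cardB by (auto simp: separation_def)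
  moreover have "cut_order V w A B \<le> 3" using C1.cut_order_partition V e3 by simp
  ultimately have AB: "separation V A B" "cut_order V w A B \<le> 3"
    "separation V B A" "cut_order V w B A \<le> 3"
    using separation_commute C1.cut_order_commute by metis+
  show ?thesis unfolding uniform3_def
  proof (intro conjI allI ballI impI)
    have "card V = card A + card B" using card_Un_disjoint[OF fin V(2)] V(1) by simp
    then show "4 \<le> card V" using cardA cardB by simp
  next
    fix X Y assume "separation V X Y"
    then have XY: "X \<subseteq> V" "Y \<subseteq> V" "X \<inter> Y = {}" "X \<noteq> {}" "Y \<noteq> {}" by (auto simp: separation_def)
    consider "X \<inter> A \<noteq> {}" "Y \<inter> A \<noteq> {}" | "X \<inter> B \<noteq> {}" "Y \<inter> B \<noteq> {}"
      | "X \<subseteq> A" "Y \<subseteq> B" | "Y \<subseteq> A" "X \<subseteq> B" using XY V by blast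
    then show "3 \<le> cut_order V w X Y"
    proof cases
      case 4
      then show ?thesis using lower3 C1.cut_order_commute by metis
    qed (use lower1 lower2 lower3 XY in auto)
  next
    fix s r assume "s \<in> V" "r \<in> V" "s \<noteq> r"
    then consider "s \<in> A" "r \<in> A" | "s \<in> B" "r \<in> B" | "s \<in> A" "r \<in> B" | "s \<in> B" "r \<in> A"
      using V by blast
    then show "\<exists>X Y. separation V X Y \<and> s \<in> X \<and> r \<in> Y \<and> cut_order V w X Y \<le> 3"
    proof cases
      case 1
      then show ?thesis using C1.quotient_upper[OF U1 e3] \<open>s \<noteq> r\<close> by blast
    next
      case 2
      then show ?thesis using C2.quotient_upper[OF U2 eBA] \<open>s \<noteq> r\<close> by blast
    qed (use AB in blast)+
  qed
qed

text \<open>The graph \<open>(insert u V, w')\<close> arises from \<open>(V, w)\<close> by subdividing the edge \<open>pq\<close> by \<open>u\<close>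
  and adding the edge \<open>ux\<close>.\<close>

locale extension = weighted_graph V w + ext: weighted_graph "insert u V" w'
  for V :: "'v set" and w and u p q x :: 'v and w' +
  assumes new: "u \<notin> V" and pqx: "p \<in> V" "q \<in> V" "x \<in> V" "distinct [p, q, x]"
    and inner: "a \<in> V \<Longrightarrow> b \<in> V \<Longrightarrow> w a b = w' a b + (if {a, b} = {p, q} then 1 else 0)"
    and outer: "a \<in> V \<Longrightarrow> w' u a = (if a \<in> {p, q, x} then 1 else 0)"
begin

section \<open>Orders before and after the extension\<close>

definition cross_pq :: "'v set \<Rightarrow> 'v set \<Rightarrow> nat" where
  "cross_pq X Y = (if p \<in> X \<and> q \<in> Y \<or> q \<in> X \<and> p \<in> Y then 1 else 0)"

definition hits :: "'v set \<Rightarrow> nat" where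
  "hits Y = card ({p, q, x} \<inter> Y)"

lemma crossing_new: "Y \<subseteq> V \<Longrightarrow> crossing w' {u} Y = hits Y"
proof -
  assume Y: "Y \<subseteq> V"
  then have fin: "finite Y" by (rule finite_subset_V)
  have "crossing w' {u} Y = (\<Sum>a\<in>Y. if a \<in> {p, q, x} then 1 else 0)"
    unfolding crossing_def using Y outer by (auto intro!: sum.cong)
  also have "\<dots> = card (Y \<inter> {p, q, x})" using fin by (subst sum.inter_restrict[symmetric]) auto
  finally show ?thesis by (simp add: hits_def Int_commute)
qed

lemma crossing_inner:
  assumes "X \<subseteq> V" "Y \<subseteq> V" "X \<inter> Y = {}"
  shows "crossing w X Y = crossing w' X Y + cross_pq X Y"
proof -
  have fin: "finite X" "finite Y" using assms by (auto intro: finite_subset_V)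
  have "crossing w X Y = (\<Sum>a\<in>X. \<Sum>b\<in>Y. w' a b + (if {a, b} = {p, q} then 1 else 0))"
    unfolding crossing_def using assms by (intro sum.cong refl inner) auto
  also have "\<dots> = crossing w' X Y + (\<Sum>a\<in>X. \<Sum>b\<in>Y. if {a, b} = {p, q} then 1 else 0)"
    by (simp add: crossing_def sum.distrib)
  also have "(\<Sum>a\<in>X. \<Sum>b\<in>Y. if {a, b} = {p, q} then 1 else 0 :: nat) =
      (\<Sum>a\<in>X. \<Sum>b\<in>Y. (if a = p then if b = q then 1 else 0 else 0) +
        (if a = q then if b = p then 1 else 0 else 0))"
    using pqx by (intro sum.cong refl) (auto simp: doubleton_eq_iff)
  also have "\<dots> = (\<Sum>a\<in>X. (if a = p then if q \<in> Y then 1 else 0 else 0)) +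
      (\<Sum>a\<in>X. (if a = q then if p \<in> Y then 1 else 0 else 0))"
    unfolding sum.distrib[symmetric] using fin pqx by (intro sum.cong refl) (auto simp: sum.distrib)
  also have "\<dots> = cross_pq X Y" using fin assms by (auto simp: cross_pq_def)
  finally show ?thesis .
qed

lemma hits_bounds: "X \<inter> Y = {} \<Longrightarrow> hits X + hits Y \<le> 3" "cross_pq X Y \<le> hits X" "cross_pq X Y \<le> hits Y"
proof -
  show "hits X + hits Y \<le> 3" if "X \<inter> Y = {}"
  proof -
    have "hits X + hits Y = card (({p, q, x} \<inter> X) \<union> ({p, q, x} \<inter> Y))"
      unfolding hits_def using that by (subst card_Un_disjoint) auto
    also have "\<dots> \<le> card {p, q, x}" by (rule card_mono) auto
    finally show ?thesis using pqx by simp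
  qed
  have "hits Z \<ge> 1" if "r \<in> Z" "r \<in> {p, q, x}" for r Z
    unfolding hits_def using that by (simp add: Suc_le_eq card_gt_0_iff) blast
  then show "cross_pq X Y \<le> hits X" "cross_pq X Y \<le> hits Y"
    by (auto simp: cross_pq_def)
qed

text \<open>With \<open>u\<close> beside \<open>X\<close>, its edges to \<open>Y\<close> cross in
  addition, and the edge \<open>pq\<close> no longer does. The loss stands on the left to avoid
  subtraction.\<close>

lemma ext_cut_in:
  assumes "X \<subseteq> V" "Y \<subseteq> V" "X \<inter> Y = {}"
  shows "cut_order (insert u V) w' (insert u X) Y + cross_pq X Y = cut_order V w X Y + hits Y"
proof -
  have "insert u V - insert u X - Y = V - X - Y" using new by auto
  moreover have "crossing w' (insert u X) Y = crossing w' {u} Y + crossing w' X Y"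
    by (rule crossing_insert_left) (use assms new finite_subset_V in auto)
  ultimately show ?thesis using crossing_inner[OF assms] crossing_new[OF assms(2)]
    by (simp add: cut_order_def)
qed

lemma ext_cut_out:
  assumes "X \<subseteq> V" "Y \<subseteq> V" "X \<inter> Y = {}"
  shows "cut_order (insert u V) w' X Y + cross_pq X Y = cut_order V w X Y + 1"
proof -
  have "insert u V - X - Y = insert u (V - X - Y)" using new assms by auto
  then show ?thesis using crossing_inner[OF assms] new finite_V by (simp add: cut_order_def)
qed

lemma cross_pq_commute: "cross_pq X Y = cross_pq Y X"
  by (auto simp: cross_pq_def)

text \<open>\<open>p\<close> and \<open>q\<close> exchange the edge \<open>pq\<close> for an edge to
  \<open>u\<close>; among the old vertices only \<open>x\<close> gains one.\<close>

lemma ext_degree: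
  assumes "a \<in> V" "a \<noteq> x"
  shows "crossing w' {a} (insert u V) = crossing w {a} V"
proof -
  have "crossing w' {a} (insert u V) = crossing w' {a} {a} + crossing w' {a} (insert u (V - {a}))"
    by (rule ext.degree_partition) (use assms new in auto)
  also have "\<dots> = crossing w' {a} (insert u (V - {a}))" by (simp add: crossing_def)
  also have "\<dots> = crossing w' {a} {u} + crossing w' {a} (V - {a})"
    by (rule crossing_insert_right) (use finite_V new in auto)
  also have "crossing w' {a} {u} = cross_pq {a} (V - {a})"
    using assms outer[OF assms(1)] ext.sym[of a u] pqx by (auto simp: crossing_def cross_pq_def)
  also have "cross_pq {a} (V - {a}) + crossing w' {a} (V - {a}) = crossing w {a} (V - {a})"
    using crossing_inner[of "{a}" "V - {a}"] assms by auto
  also have "\<dots> = crossing w {a} {a} + crossing w {a} (V - {a})" by (simp add: crossing_def)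
  also have "\<dots> = crossing w {a} V" by (rule degree_partition[symmetric]) (use assms in auto)
  finally show ?thesis .
qed

lemma ext_degree_new: "crossing w' {u} (insert u V) = 3"
proof -
  have "crossing w' {u} (insert u V) = crossing w' {u} {u} + crossing w' {u} V"
    by (rule ext.degree_partition) (use new in auto)
  also have "\<dots> = hits V" by (simp add: crossing_def[of w' "{u}" "{u}"] crossing_new)
  also have "\<dots> = 3" using pqx by (simp add: hits_def)
  finally show ?thesis .
qed

text \<open>If the lost edge \<open>pq\<close> crossed, one of its ends lies in \<open>Y\<close> and
  receives an edge from \<open>u\<close>, so adding \<open>u\<close> to \<open>X\<close> does not
  lower the order. The upper bounds come from cuts around vertices other than \<open>x\<close>, all
  of degree 3.\<close>

lemma uniform3_extension:
  assumes U: "uniform3 V w" and deg: "\<And>y. y \<in> V - {x} \<Longrightarrow> crossing w {y} V = 3"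
  shows "uniform3 (insert u V) w'"
  unfolding uniform3_def
proof (intro conjI allI ballI impI)
  show "4 \<le> card (insert u V)" using U finite_V new by (simp add: uniform3_def)
next
  have lower: "3 \<le> cut_order V w X Y" if "separation V X Y" for X Y
    using U that by (simp add: uniform3_def)
  have low_in: "3 \<le> cut_order (insert u V) w' (insert u X) Y"
    if XY: "X \<subseteq> V" "Y \<subseteq> V" "X \<inter> Y = {}" "Y \<noteq> {}" for X Y
  proof (cases "X = {}")
    case True
    \<comment> \<open>The side is \<open>u\<close> alone, and each of its three neighbours lies in
      \<open>Y\<close> or in the separator.\<close>
    have "3 = card {p, q, x}" using pqx by simp
    also have "\<dots> \<le> card (({p, q, x} \<inter> Y) \<union> (V - Y))"
      by (rule card_mono) (use pqx finite_V in auto)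
    also have "\<dots> \<le> hits Y + card (V - Y)" unfolding hits_def by (rule card_Un_le)
    also have "\<dots> \<le> hits Y + cut_order V w X Y" using True by (simp add: cut_order_def)
    finally show ?thesis using ext_cut_in[OF XY(1-3)] True by (simp add: cross_pq_def)
  next
    case False
    then have "separation V X Y" using XY by (auto simp: separation_def)
    then show ?thesis using lower ext_cut_in[OF XY(1-3)] hits_bounds(3)[of X Y] by fastforce
  qed
  fix X Y assume "separation (insert u V) X Y"
  then have XY: "X \<subseteq> insert u V" "Y \<subseteq> insert u V" "X \<inter> Y = {}" "X \<noteq> {}" "Y \<noteq> {}"
    by (auto simp: separation_def)
  consider "u \<in> X" | "u \<in> Y" | "u \<notin> X" "u \<notin> Y" by blast
  then show "3 \<le> cut_order (insert u V) w' X Y"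
  proof cases
    case 1
    then have X: "insert u (X - {u}) = X" and sub: "X - {u} \<subseteq> V" "Y \<subseteq> V" "(X - {u}) \<inter> Y = {}"
      using XY by auto
    show ?thesis using low_in[OF sub XY(5)] unfolding X .
  next
    case 2
    then have Y: "insert u (Y - {u}) = Y" and sub: "Y - {u} \<subseteq> V" "X \<subseteq> V" "(Y - {u}) \<inter> X = {}"
      using XY by auto
    show ?thesis using low_in[OF sub XY(4)] unfolding Y ext.cut_order_commute[of X] .
  next
    case 3
    then have sub: "X \<subseteq> V" "Y \<subseteq> V" using XY by auto
    then have "separation V X Y" using XY by (auto simp: separation_def)
    moreover have "cross_pq X Y \<le> 1" by (simp add: cross_pq_def)
    ultimately show ?thesis using lower ext_cut_out[OF sub XY(3)] by fastforce
  qed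
next
  fix s r assume sr: "s \<in> insert u V" "r \<in> insert u V" "s \<noteq> r"
  have deg': "crossing w' {y} (insert u V) \<le> 3" if "y \<in> insert u V" "y \<noteq> x" for y
    using that deg ext_degree ext_degree_new by auto
  show "\<exists>X Y. separation (insert u V) X Y \<and> s \<in> X \<and> r \<in> Y \<and> cut_order (insert u V) w' X Y \<le> 3"
    using ext.separated_by_degree_3[of s r] ext.separated_by_degree_3[of r s] deg'[of s] deg'[of r] sr
    by (cases "s = x") auto
qed

text \<open>A pair of order at most 2 must gain on adding \<open>u\<close> to either side, so both
  sides contain neighbours of \<open>u\<close>, while \<open>p\<close> and \<open>q\<close> are not
  opposite. Hence one side has \<open>x\<close> as its only neighbour of \<open>u\<close>, and
  adding \<open>u\<close> to the other gives a tight pair, which \<open>no_tight\<close>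
  excludes.\<close>

lemma uniform3_reduction:
  assumes U: "uniform3 (insert u V) w'"
    and deg: "\<And>y. y \<in> insert u V - {x} \<Longrightarrow> crossing w' {y} (insert u V) \<le> 3"
    and x: "4 \<le> crossing w' {x} (insert u V)"
    and nontrivial: "\<nexists>A B. nontrivial_edge_cut (insert u V) w' A B"
  shows "uniform3 V w"
  unfolding uniform3_def
proof (intro conjI allI ballI impI)
  \<comment> \<open>By simplicity, degree at least 4 at \<open>x\<close> means at least five
    vertices before \<open>u\<close> is removed.\<close>
  have "crossing w' {x} (insert u V) + 1 \<le> card (insert u V)"
    by (rule ext.uniform3_crossing_less[OF U]) (use finite_V pqx in auto)
  then show "4 \<le> card V" using x new finite_V by simp
next
  have lower: "3 \<le> cut_order (insert u V) w' X Y" if "separation (insert u V) X Y" for X Y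
    using U that by (simp add: uniform3_def)
  \<comment> \<open>As \<open>x\<close> is in \<open>Y\<close>, all separator vertices have degree
    at most 3 and a tight pair extends to an edge cut. This is nontrivial: \<open>A\<close> contains
    \<open>u\<close> and a vertex of \<open>X\<close>, and \<open>B\<close> is not just
    \<open>x\<close>, whose degree exceeds 3.\<close>
  have no_tight: "3 < cut_order (insert u V) w' (insert u X) Y"
    if XY: "X \<subseteq> V" "Y \<subseteq> V" "X \<inter> Y = {}" "X \<noteq> {}" "x \<in> Y" for X Y
  proof (rule ccontr)
    assume "\<not> ?thesis"
    then have c: "cut_order (insert u V) w' (insert u X) Y \<le> 3" by simp
    have "\<exists>A B. insert u X \<subseteq> A \<and> Y \<subseteq> B \<and> A \<union> B = insert u V \<and> A \<inter> B = {} \<and> crossing w' A B \<le> 3"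
      by (rule ext.extend_to_edge_cut) (use XY new c deg in auto)
    then obtain A B where AB: "insert u X \<subseteq> A" "Y \<subseteq> B" "A \<union> B = insert u V" "A \<inter> B = {}"
      "crossing w' A B \<le> 3" by blast
    have fAB: "finite A" "finite B" using AB(3) finite_V by (metis finite_Un finite_insert)+
    obtain y where y: "y \<in> X" using XY by blast
    have "card {u, y} \<le> card A" by (rule card_mono) (use y AB fAB in auto)
    moreover have "u \<noteq> y" using y XY new by auto
    ultimately have "2 \<le> card A" by simp
    moreover have "2 \<le> card B"
    proof (rule ccontr)
      assume "\<not> 2 \<le> card B"
      moreover have "0 < card B" using AB(2) XY(5) fAB(2) by (auto simp: card_gt_0_iff)
      ultimately have "card B = 1" by linarith
      then have B: "B = {x}" using AB(2) XY(5) by (metis card_1_singletonE singletonD subsetD)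
      have "crossing w' {x} (insert u V) = crossing w' {x} A + crossing w' {x} B"
        by (rule ext.degree_partition) (use AB in auto)
      then show False using x AB(5) ext.crossing_commute[of A] B by (simp add: crossing_def[of _ "{x}" "{x}"])
    qed
    ultimately have "nontrivial_edge_cut (insert u V) w' A B"
      using AB by (simp add: nontrivial_edge_cut_def)
    then show False using nontrivial by blast
  qed
  fix X Y assume sep: "separation V X Y"
  then have XY: "X \<subseteq> V" "Y \<subseteq> V" "X \<inter> Y = {}" "X \<noteq> {}" "Y \<noteq> {}" and YX: "Y \<inter> X = {}"
    by (auto simp: separation_def)
  have "separation (insert u V) (insert u X) Y" "separation (insert u V) (insert u Y) X"
    using XY new by (auto simp: separation_def)
  note low = this[THEN lower]
  note eqs = ext_cut_in[OF XY(1-3)] ext_cut_in[OF XY(2,1) YX] cut_order_commute[of Y X] cross_pq_commute[of Y X]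
  show "3 \<le> cut_order V w X Y"
  proof (rule ccontr)
    assume "\<not> ?thesis"
    then have c: "cut_order V w X Y \<le> 2" by simp
    have h: "cut_order V w X Y + hits Y \<ge> 3 + cross_pq X Y" "cut_order V w X Y + hits X \<ge> 3 + cross_pq X Y"
      using low eqs by linarith+
    then have "cross_pq X Y = 0" "1 \<le> hits X" "1 \<le> hits Y"
      using c hits_bounds(1)[OF XY(3)] by linarith+
    moreover have hits_sum: "hits Z = (if p \<in> Z then 1 else 0) + (if q \<in> Z then 1 else 0) + (if x \<in> Z then 1 else 0)" for Z
      using pqx by (auto simp: hits_def)
    ultimately have "x \<in> Y \<and> hits Y = 1 \<or> x \<in> X \<and> hits X = 1"
      using XY(3) pqx unfolding hits_sum cross_pq_def by (auto split: if_splits)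
    then show False
      using no_tight[OF XY(1-4)] no_tight[OF XY(2,1) YX XY(5)] eqs c \<open>cross_pq X Y = 0\<close> by linarith
  qed
next
  fix s r assume sr: "s \<in> V" "r \<in> V" "s \<noteq> r"
  have deg': "crossing w {y} V \<le> 3" if "y \<in> V" "y \<noteq> x" for y
    using that deg[of y] ext_degree[OF that] by auto
  show "\<exists>X Y. separation V X Y \<and> s \<in> X \<and> r \<in> Y \<and> cut_order V w X Y \<le> 3"
    using separated_by_degree_3[of s r] separated_by_degree_3[of r s] deg'[of s] deg'[of r] sr
    by (cases "s = x") auto
qed

end

section \<open>Multigraph operations\<close>

lemma multigraph_weighted_graph: "multigraph G \<Longrightarrow> weighted_graph (verts G) (edge_mult G)"
  by unfold_locales (simp add: multigraph_def, rule edge_mult_commute, rule edge_mult_pos)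

text \<open>An edge at \<open>v\<close> is determined by its other end \<open>b\<close>; the term
  for \<open>b = v\<close> vanishes because there are no loops.\<close>

lemma degree_eq_crossing:
  assumes G: "multigraph G" and v: "v \<in> verts G"
  shows "degree G v = crossing (edge_mult G) {v} (verts G)"
proof -
  let ?M = "{#e \<in># edges G. v \<in> e#}" and ?f = "\<lambda>b. {v, b}"
  have fin: "finite (verts G)" using G by (simp add: multigraph_def)
  have sub: "set_mset ?M \<subseteq> ?f ` verts G"
  proof
    fix e assume "e \<in> set_mset ?M"
    then have e: "e \<in># edges G" "v \<in> e" by auto
    then have "e \<subseteq> verts G" "card e = 2" using G by (auto simp: multigraph_def)
    then show "e \<in> ?f ` verts G" using e(2) by (auto simp: card_2_iff doubleton_eq_iff)
  qed
  have "degree G v = sum (count ?M) (set_mset ?M)"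
    by (simp only: degree_def size_multiset_overloaded_eq)
  also have "\<dots> = sum (count ?M) (?f ` verts G)"
    by (rule sum.mono_neutral_left) (use sub fin in \<open>auto simp: not_in_iff\<close>)
  also have "\<dots> = (\<Sum>b\<in>verts G. count ?M {v, b})"
    by (subst sum.reindex) (auto simp: inj_on_def doubleton_eq_iff)
  also have "\<dots> = crossing (edge_mult G) {v} (verts G)"
    by (simp add: crossing_def edge_mult_def)
  finally show ?thesis .
qed

lemma simple_graph_iff: "simple_graph G \<longleftrightarrow> multigraph G \<and> (\<forall>a b. edge_mult G a b \<le> 1)"
proof
  show "multigraph G \<and> (\<forall>a b. edge_mult G a b \<le> 1)" if "simple_graph G"
    using that by (simp add: simple_graph_def edge_mult_def)
  assume *: "multigraph G \<and> (\<forall>a b. edge_mult G a b \<le> 1)"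
  have "count (edges G) e \<le> 1" for e
  proof (cases "e \<in># edges G")
    case True
    then have "card e = 2" using * by (auto simp: multigraph_def)
    then obtain a b where "e = {a, b}" by (auto simp: card_2_iff)
    then show ?thesis using * by (simp add: edge_mult_def)
  next
    case False
    then have "count (edges G) e = 0" by (simp add: not_in_iff)
    then show ?thesis by simp
  qed
  then show "simple_graph G" using * by (simp add: simple_graph_def)
qed

lemma mgraph_eqI:
  assumes "multigraph G" "multigraph H" "verts G = verts H" "\<And>a b. edge_mult G a b = edge_mult H a b"
  shows "G = H"
proof -
  have "count (edges G) e = count (edges H) e" for e
  proof (cases "card e = 2")
    case True
    then obtain a b where "e = {a, b}" by (auto simp: card_2_iff)
    then show ?thesis using assms(4)[of a b] by (simp add: edge_mult_def)
  next
    case False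
    then have "e \<notin># edges G" "e \<notin># edges H" using assms by (auto simp: multigraph_def)
    then show ?thesis by (simp add: not_in_iff)
  qed
  then have "edges G = edges H" by (rule multiset_eqI)
  then show ?thesis using assms(3) by (cases G, cases H) simp
qed

lemma neighbors_iff: "b \<in> neighbors G a \<longleftrightarrow> 0 < edge_mult G a b"
  by (simp add: neighbors_def edge_mult_def)

lemma edge_mult_simps:
  "edge_mult (add_edge G v w) a b = edge_mult G a b + (if {a, b} = {v, w} then 1 else 0)"
  "edge_mult (del_edge G v w) a b = edge_mult G a b - (if {a, b} = {v, w} then 1 else 0)"
  "edge_mult (add_vert G v) a b = edge_mult G a b"
  "edge_mult (del_verts G S) a b = (if a \<in> S \<or> b \<in> S then 0 else edge_mult G a b)"
  "edge_mult (graph_union G H) a b = max (edge_mult G a b) (edge_mult H a b)"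
  by (auto simp: edge_mult_def add_edge_def del_edge_def add_vert_def del_verts_def graph_union_def)

lemma verts_simps:
  "verts (add_edge G v w) = verts G"
  "verts (del_edge G v w) = verts G"
  "verts (add_vert G v) = insert v (verts G)"
  "verts (del_verts G S) = verts G - S"
  "verts (graph_union G H) = verts G \<union> verts H"
  by (simp_all add: add_edge_def del_edge_def add_vert_def del_verts_def graph_union_def)

lemma multigraph_ops:
  "multigraph G \<Longrightarrow> v \<in> verts G \<Longrightarrow> w \<in> verts G \<Longrightarrow> v \<noteq> w \<Longrightarrow> multigraph (add_edge G v w)"
  "multigraph G \<Longrightarrow> multigraph (del_edge G v w)"
  "multigraph G \<Longrightarrow> multigraph (add_vert G v)"
  "multigraph G \<Longrightarrow> multigraph (del_verts G S)"
  "multigraph G \<Longrightarrow> multigraph H \<Longrightarrow> multigraph (graph_union G H)"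
proof -
  show "multigraph (del_edge G v w)" if "multigraph G"
    using that by (auto simp: multigraph_def del_edge_def dest: in_diffD)
  show "multigraph (graph_union G H)" if "multigraph G" "multigraph H"
    using that unfolding multigraph_def graph_union_def by auto
qed (auto simp: multigraph_def add_edge_def add_vert_def del_verts_def)

text \<open>\<open>three_connected\<close> speaks of vertex separators only, so crossing edges have
  to be eliminated. Moving an end \<open>a\<close> of such an edge into the separator does not raise
  the order, and induction applies unless \<open>X = {a}\<close>. If this fails at both ends, the
  order is at least (4 - 2) + 1.\<close>

lemma three_connected_cut_order:
  assumes G: "multigraph G" and tc: "three_connected G" and sep: "separation (verts G) X Y"
  shows "3 \<le> cut_order (verts G) (edge_mult G) X Y"
  using sep
proof (induction "card X + card Y" arbitrary: X Y rule: less_induct)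
  case less
  interpret weighted_graph "verts G" "edge_mult G" by (rule multigraph_weighted_graph[OF G])
  let ?c = "cut_order (verts G) (edge_mult G)"
  have XY: "X \<subseteq> verts G" "Y \<subseteq> verts G" "X \<inter> Y = {}" "X \<noteq> {}" "Y \<noteq> {}" and YX: "Y \<inter> X = {}"
    using less.prems by (auto simp: separation_def)
  have fin: "finite X" "finite Y" using separation_finite[OF less.prems] by auto
  show ?case
  proof (rule ccontr)
    assume "\<not> ?case"
    then have c: "?c X Y \<le> 2" by simp
    have step: "P = {a}"
      if P: "separation (verts G) P Q" "?c P Q \<le> 2" "card P + card Q = card X + card Y"
        and ab: "a \<in> P" "b \<in> Q" "0 < edge_mult G a b" for P Q a b
    proof (rule ccontr)
      assume "P \<noteq> {a}"
      then have sep': "separation (verts G) (P - {a}) Q" using P ab by (auto simp: separation_def)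
      have fPQ: "finite P" "finite Q" using separation_finite[OF P(1)] by auto
      have "card (P - {a}) < card P" using fPQ(1) ab(1) by (rule card_Diff1_less)
      then have "3 \<le> ?c (P - {a}) Q" using less.hyps[OF _ sep'] P(3) by linarith
      moreover have "?c (insert a (P - {a})) Q + 1 = ?c (P - {a}) Q + crossing (edge_mult G) {a} Q"
        by (rule cut_order_insert_left) (use P ab in \<open>auto simp: separation_def\<close>)
      moreover have "insert a (P - {a}) = P" using ab by auto
      moreover have "crossing (edge_mult G) {a} {b} \<le> crossing (edge_mult G) {a} Q"
        by (rule crossing_mono) (use ab fPQ in auto)
      ultimately show False using P(2) ab by (simp add: crossing_def)
    qed
    show False
    proof (cases "\<exists>a\<in>X. \<exists>b\<in>Y. 0 < edge_mult G a b")
      case True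
      then obtain a b where ab: "a \<in> X" "b \<in> Y" "0 < edge_mult G a b" by blast
      have "X = {a}" using step[OF less.prems c refl ab] .
      moreover have "Y = {b}"
        using step[OF separation_commute[OF less.prems] _ _ ab(2,1)] c ab edge_mult_commute[of G a b]
          cut_order_commute[of X Y] by simp
      ultimately have "?c X Y + 2 = card (verts G) + edge_mult G a b"
        using cut_order_eq[OF XY(1-3)] by (simp add: crossing_def)
      then show False using c ab tc by (simp add: three_connected_def)
    next
      \<comment> \<open>Without crossing edges the separator has at most two vertices, and a path
        avoiding it would go across a pair of order 0.\<close>
      case False
      let ?S = "verts G - X - Y"
      let ?H = "del_verts G ?S"
      have H: "multigraph ?H" by (rule multigraph_ops(4)[OF G])
      have VH: "verts ?H = X \<union> Y" using XY by (auto simp: verts_simps)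
      have cr: "crossing (edge_mult ?H) X Y = 0" using False by (simp add: crossing_def edge_mult_simps)
      have "card ?S \<le> 2" using c by (simp add: cut_order_def)
      moreover have "?S \<subseteq> verts G" by blast
      ultimately have "connected_graph ?H" using tc unfolding three_connected_def by blast
      moreover obtain x y where xy: "x \<in> X" "y \<in> Y" using XY by blast
      ultimately obtain P where P: "P \<in> paths_between ?H x y"
        unfolding connected_graph_def VH by blast
      have "separation (verts ?H) X Y" using XY VH by (auto simp: separation_def)
      then have "card {P} \<le> cut_order (verts ?H) (edge_mult ?H) X Y"
        using independent_paths_le_cut_order[OF H _ xy, of "{P}"] P by (auto simp: independent_paths_def)
      moreover have "verts ?H - X - Y = {}" unfolding VH by auto
      ultimately show False using cr unfolding cut_order_def by (metis One_nat_def add_0 card.empty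
            card.insert empty_iff finite.emptyI not_one_le_zero)
    qed
  qed
qed

lemma uniform3_degree:
  assumes "weighted_graph V w" "uniform3 V w" "v \<in> V"
  shows "3 \<le> crossing w {v} V"
proof -
  interpret weighted_graph V w by fact
  have "V \<noteq> {v}" using assms(2) by (auto simp: uniform3_def)
  then have "separation V {v} (V - {v})" using assms(3) by (auto simp: separation_def)
  then have "3 \<le> cut_order V w {v} (V - {v})" using assms(2) unfolding uniform3_def by blast
  then show ?thesis using singleton_cut[OF assms(3)] by simp
qed

text \<open>Deleting \<open>S\<close> lowers each order by at most 2, so orders stay positive and
  \<open>menger_mixed\<close> with \<open>k = 1\<close> finds a path.\<close>

lemma uniform3_three_connected:
  assumes G: "multigraph G" and U: "uniform3 (verts G) (edge_mult G)"
  shows "three_connected G"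
  unfolding three_connected_def
proof (intro conjI allI impI)
  show c4: "4 \<le> card (verts G)" using U by (simp add: uniform3_def)
  fix S assume S: "S \<subseteq> verts G" "card S \<le> 2"
  let ?H = "del_verts G S"
  have H: "multigraph ?H" by (rule multigraph_ops(4)[OF G])
  have VH: "verts ?H = verts G - S" by (simp add: verts_simps)
  have fin: "finite (verts G)" "finite S" using G S finite_subset by (auto simp: multigraph_def)
  show "connected_graph ?H" unfolding connected_graph_def
  proof (intro conjI ballI)
    show "verts ?H \<noteq> {}"
    proof
      assume "verts ?H = {}"
      then have "verts G = S" using VH S by auto
      then show False using c4 S by simp
    qed
    fix u v assume uv: "u \<in> verts ?H" "v \<in> verts ?H"
    show "paths_between ?H u v \<noteq> {}"
    proof (cases "u = v")
      case True
      have "([u], []) \<in> paths_between ?H u v"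
        using uv True by (simp add: paths_between_def is_path_def)
      then show ?thesis by blast
    next
      case False
      have "1 \<le> cut_order (verts ?H) (edge_mult ?H) X Y" if sep: "separation (verts ?H) X Y" for X Y
      proof -
        have "separation (verts G) X Y" using sep VH by (auto simp: separation_def)
        then have "3 \<le> cut_order (verts G) (edge_mult G) X Y" using U by (simp add: uniform3_def)
        moreover have "verts G - X - Y = (verts ?H - X - Y) \<union> S"
          using sep S VH by (auto simp: separation_def)
        then have "card (verts G - X - Y) \<le> card (verts ?H - X - Y) + card S"
          using card_Un_le by metis
        moreover have "crossing (edge_mult G) X Y = crossing (edge_mult ?H) X Y"
          using sep VH by (intro crossing_cong) (auto simp: separation_def edge_mult_simps)
        ultimately show ?thesis using S by (simp add: cut_order_def)
      qed
      then obtain \<P> where "\<P> \<subseteq> paths_between ?H u v" "card \<P> = 1"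
        using menger_mixed[OF H uv False, of 1] by blast
      then show ?thesis by (metis card.empty subset_empty zero_neq_one)
    qed
  qed
qed

lemma cubic_uniform3:
  assumes G: "multigraph G" and tc: "three_connected G" and reg: "regular 3 G"
  shows "uniform3 (verts G) (edge_mult G)"
proof -
  interpret weighted_graph "verts G" "edge_mult G" by (rule multigraph_weighted_graph[OF G])
  have "crossing (edge_mult G) {v} (verts G) \<le> 3" if "v \<in> verts G" for v
    using reg degree_eq_crossing[OF G that] that by (simp add: regular_def)
  then show ?thesis unfolding uniform3_def
    using three_connected_cut_order[OF G tc] separated_by_degree_3(1) tc
    by (auto simp: three_connected_def)
qed

section \<open>Three matching edges\<close>

definition matched :: "('v \<times> 'v) list \<Rightarrow> 'v \<Rightarrow> 'v \<Rightarrow> nat" where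
  "matched ps a b = (if (a, b) \<in> set ps then 1 else 0)"

lemma sum_matched:
  assumes "finite B" "distinct [x1, x2, x3]" "{y1, y2, y3} \<subseteq> B"
  shows "(\<Sum>b\<in>B. matched [(x1, y1), (x2, y2), (x3, y3)] a b) = (if a \<in> {x1, x2, x3} then 1 else 0)"
proof -
  have "(\<Sum>b\<in>B. matched [(x1, y1), (x2, y2), (x3, y3)] a b) =
      (\<Sum>b\<in>B. if b = (if a = x1 then y1 else if a = x2 then y2 else y3)
        then (if a \<in> {x1, x2, x3} then 1 else 0) else 0)"
    using assms(2) by (intro sum.cong refl) (auto simp: matched_def)
  also have "\<dots> = (if a \<in> {x1, x2, x3} then 1 else 0)"
    using assms by (subst sum.delta) auto
  finally show ?thesis .
qed

lemma crossing_matched: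
  assumes fin: "finite A" "finite B" and x: "distinct [x1, x2, x3]" "{x1, x2, x3} \<subseteq> A"
    and y: "{y1, y2, y3} \<subseteq> B"
    and w: "\<And>a b. a \<in> A \<Longrightarrow> b \<in> B \<Longrightarrow> w a b = matched [(x1, y1), (x2, y2), (x3, y3)] a b"
  shows "a \<in> A \<Longrightarrow> crossing w {a} B = (if a \<in> {x1, x2, x3} then 1 else 0)"
    and "crossing w A B = 3"
proof -
  have *: "crossing w {a} B = (if a \<in> {x1, x2, x3} then 1 else 0)" if "a \<in> A" for a
    using sum_matched[OF fin(2) x(1) y, of a] w[OF that] by (simp add: crossing_def)
  then show "a \<in> A \<Longrightarrow> crossing w {a} B = (if a \<in> {x1, x2, x3} then 1 else 0)" .
  have "crossing w A B = (\<Sum>a\<in>A. if a \<in> {x1, x2, x3} then 1 else 0)"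
    unfolding crossing_def[of w A] using * by (intro sum.cong refl) (auto simp: crossing_def)
  also have "\<dots> = card (A \<inter> {x1, x2, x3})" using fin by (subst sum.inter_restrict[symmetric]) auto
  also have "A \<inter> {x1, x2, x3} = {x1, x2, x3}" using x by auto
  finally show "crossing w A B = 3" using x by simp
qed

section \<open>The recursive class\<close>

definition join_graphs ::
  "'v mgraph \<Rightarrow> 'v \<Rightarrow> 'v mgraph \<Rightarrow> 'v \<Rightarrow> ('v \<times> 'v) \<Rightarrow> ('v \<times> 'v) \<Rightarrow> ('v \<times> 'v) \<Rightarrow> 'v mgraph" where
  "join_graphs G1 v1 G2 v2 e1 e2 e3 =
     add_edge (add_edge (add_edge (graph_union (del_verts G1 {v1}) (del_verts G2 {v2}))
       (fst e1) (snd e1)) (fst e2) (snd e2)) (fst e3) (snd e3)"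

locale graph_join =
  fixes G1 G2 :: "'v mgraph" and v1 v2 x1 x2 x3 y1 y2 y3
  assumes G1: "multigraph G1" and G2: "multigraph G2" and disj: "verts G1 \<inter> verts G2 = {}"
    and v1: "v1 \<in> verts G1" and v2: "v2 \<in> verts G2"
    and x: "distinct [x1, x2, x3]" "neighbors G1 v1 = {x1, x2, x3}"
    and y: "distinct [y1, y2, y3]" "neighbors G2 v2 = {y1, y2, y3}"
begin

abbreviation (input) "J \<equiv> join_graphs G1 v1 G2 v2 (x1, y1) (x2, y2) (x3, y3)"
abbreviation (input) "A \<equiv> verts G1 - {v1}"
abbreviation (input) "B \<equiv> verts G2 - {v2}"

lemma join_ends: "{x1, x2, x3} \<subseteq> A" "{y1, y2, y3} \<subseteq> B"
proof -
  have "z \<in> A" if "z \<in> neighbors G1 v1" for z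
    using that edge_mult_pos[OF G1, of v1 z] by (auto simp: neighbors_iff)
  then show "{x1, x2, x3} \<subseteq> A" using x by blast
  have "z \<in> B" if "z \<in> neighbors G2 v2" for z
    using that edge_mult_pos[OF G2, of v2 z] by (auto simp: neighbors_iff)
  then show "{y1, y2, y3} \<subseteq> B" using y by blast
qed

lemma verts_join: "verts J = A \<union> B"
  by (simp add: join_graphs_def verts_simps)

lemma multigraph_join: "multigraph J"
  unfolding join_graphs_def fst_conv snd_conv
  by (intro multigraph_ops G1 G2) (use join_ends disj in \<open>auto simp: verts_simps\<close>)

lemma edge_mult_join:
  "a \<in> A \<Longrightarrow> b \<in> A \<Longrightarrow> edge_mult J a b = edge_mult G1 a b"
  "a \<in> B \<Longrightarrow> b \<in> B \<Longrightarrow> edge_mult J a b = edge_mult G2 a b"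
  "a \<in> A \<Longrightarrow> b \<in> B \<Longrightarrow> edge_mult J a b = matched [(x1, y1), (x2, y2), (x3, y3)] a b"
proof -
  have z1: "edge_mult G1 a b = 0" if "a \<notin> verts G1 \<or> b \<notin> verts G1" for a b
    using edge_mult_pos[OF G1, of a b] that by blast
  have z2: "edge_mult G2 a b = 0" if "a \<notin> verts G2 \<or> b \<notin> verts G2" for a b
    using edge_mult_pos[OF G2, of a b] that by blast
  have J: "edge_mult J a b = max (if a = v1 \<or> b = v1 then 0 else edge_mult G1 a b)
      (if a = v2 \<or> b = v2 then 0 else edge_mult G2 a b) + (if {a, b} = {x1, y1} then 1 else 0)
      + (if {a, b} = {x2, y2} then 1 else 0) + (if {a, b} = {x3, y3} then 1 else 0)" for a b
    by (simp add: join_graphs_def edge_mult_simps)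
  have ends: "x1 \<in> A" "x2 \<in> A" "x3 \<in> A" "y1 \<in> B" "y2 \<in> B" "y3 \<in> B"
    using join_ends by auto
  show "edge_mult J a b = edge_mult G1 a b" if "a \<in> A" "b \<in> A"
  proof -
    have "{a, b} \<noteq> {c, d}" if "d \<in> B" for c d
      using that \<open>a \<in> A\<close> \<open>b \<in> A\<close> disj by (auto simp: doubleton_eq_iff)
    moreover have "edge_mult G2 a b = 0" using z2[of a b] that disj by blast
    ultimately show ?thesis using that ends(4-6) by (simp add: J)
  qed
  show "edge_mult J a b = edge_mult G2 a b" if "a \<in> B" "b \<in> B"
  proof -
    have "{a, b} \<noteq> {c, d}" if "c \<in> A" for c d
      using that \<open>a \<in> B\<close> \<open>b \<in> B\<close> disj by (auto simp: doubleton_eq_iff)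
    moreover have "edge_mult G1 a b = 0" using z1[of a b] that disj by blast
    ultimately show ?thesis using that ends(1-3) by (simp add: J)
  qed
  show "edge_mult J a b = matched [(x1, y1), (x2, y2), (x3, y3)] a b" if "a \<in> A" "b \<in> B"
  proof -
    have "{a, b} = {c, d} \<longleftrightarrow> a = c \<and> b = d" if "c \<in> A" "d \<in> B" for c d
      using that \<open>a \<in> A\<close> \<open>b \<in> B\<close> disj by (auto simp: doubleton_eq_iff)
    note eq = this[OF ends(1,4)] this[OF ends(2,5)] this[OF ends(3,6)]
    have "edge_mult G2 a b = 0" "edge_mult G1 a b = 0" using z1[of a b] z2[of a b] that disj by blast+
    then have z: "(if a = v1 \<or> b = v1 then 0 else edge_mult G1 a b) = 0"
      "(if a = v2 \<or> b = v2 then 0 else edge_mult G2 a b) = 0" by auto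
    have "edge_mult J a b = (if a = x1 \<and> b = y1 then 1 else 0) + (if a = x2 \<and> b = y2 then 1 else 0)
        + (if a = x3 \<and> b = y3 then 1 else 0)"
      unfolding J eq z by simp
    then show ?thesis using x(1) by (auto simp: matched_def)
  qed
qed

text \<open>\<open>G1\<close> and \<open>G2\<close> are the two contractions of \<open>J\<close>
  along the matching cut; their simplicity makes \<open>v1\<close> and \<open>v2\<close> send
  exactly one edge to each neighbour, as a contraction along a matching must.\<close>

lemma uniform3_join_graphs:
  assumes S: "\<And>a b. edge_mult G1 a b \<le> 1" "\<And>a b. edge_mult G2 a b \<le> 1"
    and U: "uniform3 (verts G1) (edge_mult G1)" "uniform3 (verts G2) (edge_mult G2)"
  shows "uniform3 (verts J) (edge_mult J)"
proof -
  have fin: "finite A" "finite B" using G1 G2 by (auto simp: multigraph_def)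
  have ins: "insert v1 A = verts G1" "insert v2 B = verts G2" using v1 v2 by auto
  have AB: "A \<inter> B = {}" "B \<inter> A = {}" using disj by auto
  have swap: "edge_mult J b a = matched [(y1, x1), (y2, x2), (y3, x3)] b a" if "b \<in> B" "a \<in> A" for a b
    using edge_mult_join(3)[OF that(2,1)] edge_mult_commute[of J b a] by (auto simp: matched_def)
  note cA = crossing_matched[OF fin x(1) join_ends(1,2) edge_mult_join(3)]
  note cB = crossing_matched[OF fin(2,1) y(1) join_ends(2,1) swap]
  have nb1: "edge_mult G1 v1 a = (if a \<in> {x1, x2, x3} then 1 else 0)" for a
    using S(1)[of v1 a] neighbors_iff[of a G1 v1] unfolding x(2) by auto
  have nb2: "edge_mult G2 v2 b = (if b \<in> {y1, y2, y3} then 1 else 0)" for b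
    using S(2)[of v2 b] neighbors_iff[of b G2 v2] unfolding y(2) by auto
  interpret W: weighted_graph "verts J" "edge_mult J"
    by (rule multigraph_weighted_graph[OF multigraph_join])
  have "contraction (verts J) (edge_mult J) A B v1 (edge_mult G1)"
    unfolding contraction_def contraction_axioms_def ins
    using W.weighted_graph_axioms multigraph_weighted_graph[OF G1] verts_join AB edge_mult_join(1) nb1 cA(1)
    by auto
  moreover have "contraction (verts J) (edge_mult J) B A v2 (edge_mult G2)"
    unfolding contraction_def contraction_axioms_def ins
    using W.weighted_graph_axioms multigraph_weighted_graph[OF G2] verts_join AB edge_mult_join(2) nb2 cB(1)
    by auto
  ultimately show ?thesis
    by (rule uniform3_join) (use U cA cB ins in \<open>auto split: if_splits\<close>)
qed

end

section \<open>Graphs obtained by rule \<open>extend\<close>\<close>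

lemma extension_of_graph:
  assumes G: "multigraph G" and G': "multigraph G'" and V: "verts G' = insert u (verts G)"
    and u: "u \<notin> verts G" and vwx: "{v, w, x} \<subseteq> verts G" "distinct [v, w, x]"
    and inner: "\<And>a b. a \<in> verts G \<Longrightarrow> b \<in> verts G \<Longrightarrow>
      edge_mult G a b = edge_mult G' a b + (if {a, b} = {v, w} then 1 else 0)"
    and outer: "\<And>a. a \<in> verts G \<Longrightarrow> edge_mult G' u a = (if a \<in> {v, w, x} then 1 else 0)"
  shows "extension (verts G) (edge_mult G) u v w x (edge_mult G')"
  unfolding extension_def extension_axioms_def
  using multigraph_weighted_graph[OF G] multigraph_weighted_graph[OF G'] u vwx inner outer
  unfolding V by auto

definition extend_graph :: "'v mgraph \<Rightarrow> 'v \<Rightarrow> 'v \<Rightarrow> 'v \<Rightarrow> 'v \<Rightarrow> 'v mgraph" where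
  "extend_graph G v w x u =
     add_edge (add_edge (add_edge (del_edge (add_vert G u) v w) u w) u v) u x"

lemma verts_extend: "verts (extend_graph G v w x u) = insert u (verts G)"
  by (simp add: extend_graph_def verts_simps)

lemma multigraph_extend:
  assumes "multigraph G" "{v, w, x} \<subseteq> verts G" "u \<notin> verts G"
  shows "multigraph (extend_graph G v w x u)"
  unfolding extend_graph_def
  by (intro multigraph_ops) (use assms in \<open>auto simp: verts_simps\<close>)

lemma edge_mult_extend:
  assumes G: "multigraph G" and vwx: "{v, w, x} \<subseteq> verts G" "distinct [v, w, x]" and u: "u \<notin> verts G"
  shows "a \<in> verts G \<Longrightarrow> b \<in> verts G \<Longrightarrow>
      edge_mult (extend_graph G v w x u) a b = edge_mult G a b - (if {a, b} = {v, w} then 1 else 0)"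
    and "a \<in> verts G \<Longrightarrow> edge_mult (extend_graph G v w x u) u a = (if a \<in> {v, w, x} then 1 else 0)"
proof -
  have E: "edge_mult (extend_graph G v w x u) a b = edge_mult G a b - (if {a, b} = {v, w} then 1 else 0)
      + (if {a, b} = {u, w} then 1 else 0) + (if {a, b} = {u, v} then 1 else 0)
      + (if {a, b} = {u, x} then 1 else 0)" for a b
    by (simp add: extend_graph_def edge_mult_simps)
  show "edge_mult (extend_graph G v w x u) a b = edge_mult G a b - (if {a, b} = {v, w} then 1 else 0)"
    if "a \<in> verts G" "b \<in> verts G"
  proof -
    have "{a, b} \<noteq> {u, c}" for c using that u by auto
    then show ?thesis by (simp add: E)
  qed
  show "edge_mult (extend_graph G v w x u) u a = (if a \<in> {v, w, x} then 1 else 0)" if "a \<in> verts G"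
  proof -
    have z: "edge_mult G u a = 0" using u edge_mult_pos[OF G, of u a] by blast
    have eq: "{u, a} = {u, c} \<longleftrightarrow> a = c" for c by (auto simp: doubleton_eq_iff)
    have "edge_mult (extend_graph G v w x u) u a = (if a = w then 1 else 0) + (if a = v then 1 else 0)
        + (if a = x then 1 else 0)"
      unfolding E eq z by simp
    then show ?thesis using vwx(2) by auto
  qed
qed

text \<open>Simplicity is carried through the induction because the join case uses it; for the
  composed graphs it is regained from \<open>uniform3_multiplicity\<close>.\<close>

lemma graph_class_uniform3:
  assumes "G \<in> graph_class"
  shows "simple_graph G \<and> uniform3 (verts G) (edge_mult G)"
  using assms
proof induction
  case (cubic G)
  then show ?case using cubic_uniform3 by (auto simp: simple_graph_def)
next
  case (join G1 G2 v1 v2 x1 x2 x3 y1 y2 y3)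
  let ?J = "join_graphs G1 v1 G2 v2 (x1, y1) (x2, y2) (x3, y3)"
  have S: "\<And>a b. edge_mult G1 a b \<le> 1" "\<And>a b. edge_mult G2 a b \<le> 1"
    using join.IH by (auto simp: simple_graph_iff)
  interpret graph_join G1 G2 v1 v2 x1 x2 x3 y1 y2 y3
    by unfold_locales (use join.IH join.hyps in \<open>auto simp: simple_graph_iff\<close>)
  have U: "uniform3 (verts ?J) (edge_mult ?J)"
    using uniform3_join_graphs S join.IH by blast
  have J: "multigraph ?J" by (rule multigraph_join)
  interpret weighted_graph "verts ?J" "edge_mult ?J" by (rule multigraph_weighted_graph[OF J])
  have "simple_graph ?J" using J uniform3_multiplicity[OF U] by (simp add: simple_graph_iff)
  then show ?case using U by (simp add: join_graphs_def)
next
  case (extend G v w x u)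
  let ?H = "extend_graph G v w x u"
  have G: "multigraph G" and S: "\<And>a b. edge_mult G a b \<le> 1" and U: "uniform3 (verts G) (edge_mult G)"
    using extend.IH by (auto simp: simple_graph_iff)
  note vwx = extend.hyps(2,3) and u = extend.hyps(6)
  have H: "multigraph ?H" using multigraph_extend[OF G vwx(1) u] .
  \<comment> \<open>The deleted edge exists, so the truncated subtraction in
    \<open>edge_mult_extend\<close> can be undone.\<close>
  have edge: "1 \<le> edge_mult G a b" if "{a, b} = {v, w}" for a b
    using extend.hyps(4) unfolding edge_mult_def that by simp
  have "extension (verts G) (edge_mult G) u v w x (edge_mult ?H)"
    by (rule extension_of_graph[OF G H verts_extend u vwx])
      (use edge_mult_extend[OF G vwx u] edge in auto)
  then interpret E: extension "verts G" "edge_mult G" u v w x "edge_mult ?H" .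
  have UH: "uniform3 (verts ?H) (edge_mult ?H)" unfolding verts_extend
    by (rule E.uniform3_extension[OF U]) (use extend.hyps(5) degree_eq_crossing[OF G] in auto)
  interpret W: weighted_graph "verts ?H" "edge_mult ?H" by (rule multigraph_weighted_graph[OF H])
  have "simple_graph ?H" using H W.uniform3_multiplicity[OF UH] by (simp add: simple_graph_iff)
  then show ?case using UH by (simp add: extend_graph_def)
qed

section \<open>Decomposition of uniformly 3-connected graphs\<close>

definition quotient_graph :: "'v mgraph \<Rightarrow> 'v set \<Rightarrow> 'v \<Rightarrow> 'v \<Rightarrow> 'v \<Rightarrow> 'v \<Rightarrow> 'v mgraph" where
  "quotient_graph G B v x1 x2 x3 =
     add_edge (add_edge (add_edge (add_vert (del_verts G B) v) v x1) v x2) v x3"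

text \<open>As the crossing edges form a matching, a vertex of \<open>A\<close> has one edge into
  \<open>B\<close> if it is one of the three ends and none otherwise, which are exactly the weights
  at \<open>v\<close>.\<close>

lemma contraction_quotient_graph:
  assumes G: "multigraph G" and AB: "A \<union> B = verts G" "A \<inter> B = {}" and v: "v \<notin> verts G"
    and x: "distinct [x1, x2, x3]" "{x1, x2, x3} \<subseteq> A"
    and y: "{y1, y2, y3} \<subseteq> B"
    and m: "\<forall>a\<in>A. \<forall>b\<in>B. edge_mult G a b = matched [(x1, y1), (x2, y2), (x3, y3)] a b"
  defines "Q \<equiv> quotient_graph G B v x1 x2 x3"
  shows "multigraph Q" "verts Q = insert v A" "neighbors Q v = {x1, x2, x3}"
    "\<And>a b. a \<in> A \<Longrightarrow> b \<in> A \<Longrightarrow> edge_mult Q a b = edge_mult G a b"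
    "contraction (verts G) (edge_mult G) A B v (edge_mult Q)"
proof -
  have fin: "finite A" "finite B" using G AB by (metis multigraph_def finite_Un)+
  have vA: "v \<notin> A" "v \<notin> B" using v AB by auto
  show Q: "multigraph Q" unfolding Q_def quotient_graph_def
    by (intro multigraph_ops G) (use x AB vA in \<open>auto simp: verts_simps\<close>)
  show VQ: "verts Q = insert v A"
    using AB by (auto simp: Q_def quotient_graph_def verts_simps)
  have E: "edge_mult Q a b = (if a \<in> B \<or> b \<in> B then 0 else edge_mult G a b) + (if {a, b} = {v, x1} then 1 else 0)
      + (if {a, b} = {v, x2} then 1 else 0) + (if {a, b} = {v, x3} then 1 else 0)" for a b
    by (simp add: Q_def quotient_graph_def edge_mult_simps)
  have mv: "edge_mult Q v a = (if a \<in> {x1, x2, x3} then 1 else 0)" for a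
  proof -
    have z: "edge_mult G v a = 0" using v edge_mult_pos[OF G, of v a] by blast
    have eq: "{v, a} = {v, c} \<longleftrightarrow> a = c" for c by (auto simp: doubleton_eq_iff)
    have "edge_mult Q v a = (if a = x1 then 1 else 0) + (if a = x2 then 1 else 0)
        + (if a = x3 then 1 else 0)"
      unfolding E eq z by simp
    then show ?thesis using x(1) by auto
  qed
  then show "neighbors Q v = {x1, x2, x3}" by (auto simp: neighbors_iff split: if_splits)
  show mi: "edge_mult Q a b = edge_mult G a b" if "a \<in> A" "b \<in> A" for a b
  proof -
    have "{a, b} \<noteq> {v, c}" "a \<notin> B" "b \<notin> B" for c using that vA AB by auto
    then show ?thesis by (simp add: E)
  qed
  show "contraction (verts G) (edge_mult G) A B v (edge_mult Q)"
    unfolding contraction_def contraction_axioms_def VQ[symmetric]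
    using multigraph_weighted_graph[OF G] multigraph_weighted_graph[OF Q] AB vA mi mv
      crossing_matched(1)[OF fin x y m[rule_format]] by auto
qed

text \<open>With weights at most 1 the crossing edges are counted by the set \<open>C\<close> of
  pairs; two pairs sharing a vertex would give that vertex two crossing edges.\<close>

lemma edge_cut_matching:
  assumes fin: "finite A" "finite B" and e: "crossing w A B = 3" and le: "\<And>a b. w a b \<le> 1"
    and mA: "\<And>a. a \<in> A \<Longrightarrow> crossing w {a} B \<le> 1"
    and mB: "\<And>b. b \<in> B \<Longrightarrow> crossing w A {b} \<le> 1"
  obtains x1 x2 x3 y1 y2 y3 where "distinct [x1, x2, x3]" "{x1, x2, x3} \<subseteq> A"
    "distinct [y1, y2, y3]" "{y1, y2, y3} \<subseteq> B"
    "\<And>a b. a \<in> A \<Longrightarrow> b \<in> B \<Longrightarrow> w a b = matched [(x1, y1), (x2, y2), (x3, y3)] a b"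
proof -
  define C where "C = {p \<in> A \<times> B. 0 < w (fst p) (snd p)}"
  have "crossing w A B = (\<Sum>p\<in>A \<times> B. w (fst p) (snd p))"
    by (simp add: crossing_def sum.cartesian_product case_prod_beta)
  also have "\<dots> = (\<Sum>p\<in>A \<times> B. if 0 < w (fst p) (snd p) then 1 else 0)"
  proof (rule sum.cong)
    fix p
    show "w (fst p) (snd p) = (if 0 < w (fst p) (snd p) then 1 else 0)"
      using le[of "fst p" "snd p"] by auto
  qed simp
  also have "\<dots> = card C" using fin by (simp add: C_def sum.inter_filter[symmetric])
  finally have "card C = 3" using e by simp
  then obtain p1 p2 p3 where C: "C = {p1, p2, p3}" "p1 \<noteq> p2" "p2 \<noteq> p3" "p1 \<noteq> p3"
    by (metis card_3_iff)
  obtain x1 y1 x2 y2 x3 y3 where p: "p1 = (x1, y1)" "p2 = (x2, y2)" "p3 = (x3, y3)"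
    by (metis prod.collapse)
  have inC: "a \<in> A" "b \<in> B" "0 < w a b" if "(a, b) \<in> C" for a b using that by (auto simp: C_def)
  have injA: "b = b'" if "(a, b) \<in> C" "(a, b') \<in> C" for a b b'
  proof (rule ccontr)
    assume ne: "b \<noteq> b'"
    have "crossing w {a} {b, b'} \<le> crossing w {a} B"
      by (rule crossing_mono) (use inC that fin in auto)
    then show False using ne inC[OF that(1)] inC[OF that(2)] mA[of a] by (simp add: crossing_def)
  qed
  have injB: "a = a'" if "(a, b) \<in> C" "(a', b) \<in> C" for a a' b
  proof (rule ccontr)
    assume ne: "a \<noteq> a'"
    have "crossing w {a, a'} {b} \<le> crossing w A {b}"
      by (rule crossing_mono) (use inC that fin in auto)
    then show False using ne inC[OF that(1)] inC[OF that(2)] mB[of b] by (simp add: crossing_def)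
  qed
  have ne: "a \<noteq> a' \<and> b \<noteq> b'" if "(a, b) \<in> C" "(a', b') \<in> C" "(a, b) \<noteq> (a', b')" for a b a' b'
    using injA[of a b b'] injB[of a b a'] that by auto
  have mem: "(x1, y1) \<in> C" "(x2, y2) \<in> C" "(x3, y3) \<in> C" unfolding C(1) p by blast+
  show ?thesis
  proof (rule that)
    show "distinct [x1, x2, x3]" "distinct [y1, y2, y3]"
      using ne[OF mem(1,2) C(2)[unfolded p]] ne[OF mem(2,3) C(3)[unfolded p]]
        ne[OF mem(1,3) C(4)[unfolded p]] by (simp_all only: distinct.simps list.set) blast+
    show "{x1, x2, x3} \<subseteq> A" "{y1, y2, y3} \<subseteq> B" using mem[THEN inC(1)] mem[THEN inC(2)] by blast+
    fix a b assume "a \<in> A" "b \<in> B"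
    then have "0 < w a b \<longleftrightarrow> (a, b) \<in> C" by (simp add: C_def)
    also have "C = set [(x1, y1), (x2, y2), (x3, y3)]" unfolding C(1) p by (simp only: list.set)
    finally have "0 < w a b \<longleftrightarrow> (a, b) \<in> set [(x1, y1), (x2, y2), (x3, y3)]" .
    then show "w a b = matched [(x1, y1), (x2, y2), (x3, y3)] a b"
      using le[of a b] unfolding matched_def by (cases "w a b") (simp_all del: list.set)
  qed
qed

text \<open>Each side has at least three vertices, so replacing one side by a single vertex gives a
  smaller graph, to which the induction hypothesis applies.\<close>

lemma graph_class_of_nontrivial_edge_cut:
  fixes G :: "'v :: infinite mgraph"
  assumes G: "multigraph G" and U: "uniform3 (verts G) (edge_mult G)"
    and cut: "nontrivial_edge_cut (verts G) (edge_mult G) A B"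
    and IH: "\<And>H :: 'v mgraph. card (verts H) < card (verts G) \<Longrightarrow> multigraph H \<Longrightarrow>
      uniform3 (verts H) (edge_mult H) \<Longrightarrow> H \<in> graph_class"
  shows "G \<in> graph_class"
proof -
  interpret weighted_graph "verts G" "edge_mult G" by (rule multigraph_weighted_graph[OF G])
  have AB: "A \<union> B = verts G" "A \<inter> B = {}" "B \<union> A = verts G" "B \<inter> A = {}"
    using cut by (auto simp: nontrivial_edge_cut_def)
  have fin: "finite A" "finite B" using finite_V AB(1) by (metis finite_Un)+
  note cut' = nontrivial_edge_cut_commute[OF cut]
  note m1 = nontrivial_edge_cut_matching[OF U cut] and m2 = nontrivial_edge_cut_matching[OF U cut']
  have m2': "crossing (edge_mult G) A {b} \<le> 1" if "b \<in> B" for b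
    using m2(2)[OF that] crossing_commute[of A] by simp
  obtain x1 x2 x3 y1 y2 y3 where x: "distinct [x1, x2, x3]" "{x1, x2, x3} \<subseteq> A"
    and y: "distinct [y1, y2, y3]" "{y1, y2, y3} \<subseteq> B"
    and m: "\<And>a b. a \<in> A \<Longrightarrow> b \<in> B \<Longrightarrow> edge_mult G a b = matched [(x1, y1), (x2, y2), (x3, y3)] a b"
    using edge_cut_matching[OF fin m1(1) uniform3_multiplicity[OF U] m1(2) m2'] by metis
  have m': "edge_mult G b a = matched [(y1, x1), (y2, x2), (y3, x3)] b a" if "b \<in> B" "a \<in> A" for a b
    using m[OF that(2,1)] edge_mult_commute[of G b a] by (auto simp: matched_def)
  have mA: "\<forall>a\<in>A. \<forall>b\<in>B. edge_mult G a b = matched [(x1, y1), (x2, y2), (x3, y3)] a b"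
    and mB: "\<forall>b\<in>B. \<forall>a\<in>A. edge_mult G b a = matched [(y1, x1), (y2, x2), (y3, x3)] b a"
    using m m' by blast+
  \<comment> \<open>Two different new vertices make the quotients disjoint, as rule
    \<open>join\<close> demands; the infinite vertex type provides them.\<close>
  obtain v1 where v1: "v1 \<notin> verts G" using ex_new_if_finite[OF infinite_UNIV finite_V] by blast
  obtain v2 where v2: "v2 \<notin> insert v1 (verts G)"
    using ex_new_if_finite[OF infinite_UNIV, of "insert v1 (verts G)"] finite_V by blast
  define G1 where "G1 = quotient_graph G B v1 x1 x2 x3"
  define G2 where "G2 = quotient_graph G A v2 y1 y2 y3"
  have v2': "v2 \<notin> verts G" using v2 by simp
  note Q1 = contraction_quotient_graph[OF G AB(1,2) v1 x y(2) mA, folded G1_def]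
  note Q2 = contraction_quotient_graph[OF G AB(3,4) v2' y x(2) mB, folded G2_def]
  have cards: "card (verts G) = card A + card B" using card_Un_disjoint[OF fin AB(2)] AB(1) by simp
  have v12: "v1 \<notin> A" "v1 \<notin> B" "v2 \<notin> A" "v2 \<notin> B" "v1 \<noteq> v2" using v1 v2 AB by auto
  have "uniform3 (verts G1) (edge_mult G1)"
    unfolding Q1(2) by (rule contraction.uniform3_quotient[OF Q1(5) U cut])
  moreover have "card (verts G1) < card (verts G)"
    using Q1(2) v12 fin cards m2(3) by simp
  ultimately have G1: "G1 \<in> graph_class" using IH Q1(1) by blast
  have "uniform3 (verts G2) (edge_mult G2)"
    unfolding Q2(2) by (rule contraction.uniform3_quotient[OF Q2(5) U cut'])
  moreover have "card (verts G2) < card (verts G)"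
    using Q2(2) v12 fin cards m1(3) by simp
  ultimately have G2: "G2 \<in> graph_class" using IH Q2(1) by blast
  have disj: "verts G1 \<inter> verts G2 = {}" using Q1(2) Q2(2) v12 AB by auto
  have v: "v1 \<in> verts G1" "v2 \<in> verts G2" using Q1(2) Q2(2) by auto
  have A: "verts G1 - {v1} = A" and B: "verts G2 - {v2} = B" using Q1(2) Q2(2) v12 by auto
  let ?J = "join_graphs G1 v1 G2 v2 (x1, y1) (x2, y2) (x3, y3)"
  interpret J: graph_join G1 G2 v1 v2 x1 x2 x3 y1 y2 y3
    by unfold_locales (use Q1 Q2 disj v x y in auto)
  note J = J.multigraph_join J.verts_join[unfolded A B]
  note mJ = J.edge_mult_join[unfolded A B]
  have "G = ?J"
  proof (rule mgraph_eqI[OF G J(1)])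
    show V: "verts G = verts ?J" using J(2) AB by simp
    fix a b
    consider "a \<in> A" "b \<in> A" | "a \<in> B" "b \<in> B" | "a \<in> A" "b \<in> B" | "a \<in> B" "b \<in> A"
      | "a \<notin> verts G \<or> b \<notin> verts G" using AB by blast
    then show "edge_mult G a b = edge_mult ?J a b"
    proof cases
      case 1
      then show ?thesis using Q1(4) mJ(1) by simp
    next
      case 2
      then show ?thesis using Q2(4) mJ(2) by simp
    next
      case 3
      then show ?thesis using m mJ(3) by simp
    next
      case 4
      then show ?thesis using m mJ(3) edge_mult_commute[of _ a b] by simp
    next
      case 5
      then have "edge_mult G a b = 0" "edge_mult ?J a b = 0"
        using edge_mult_pos[OF G, of a b] edge_mult_pos[OF J(1), of a b] unfolding V by blast+
      then show ?thesis by simp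
    qed
  qed
  moreover have "?J \<in> graph_class"
    using graph_class.join[OF G1 G2 disj v x(1) Q1(3) y(1) Q2(3)] by (simp add: join_graphs_def)
  ultimately show ?thesis by simp
qed

text \<open>Rule \<open>extend\<close> is inverted at a neighbour \<open>u\<close> of
  \<open>x\<close>: \<open>H\<close> is \<open>G - u + vw\<close>, where \<open>v\<close> and
  \<open>w\<close> are the other two neighbours of \<open>u\<close>. All vertices of
  \<open>H\<close> except possibly \<open>x\<close> have degree 3, as the rule requires.\<close>

lemma graph_class_of_unique_high_degree:
  fixes G :: "'v :: infinite mgraph"
  assumes G: "multigraph G" and U: "uniform3 (verts G) (edge_mult G)"
    and no_cut: "\<nexists>A B. nontrivial_edge_cut (verts G) (edge_mult G) A B"
    and x: "x \<in> verts G" "4 \<le> crossing (edge_mult G) {x} (verts G)"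
    and deg: "\<And>y. y \<in> verts G - {x} \<Longrightarrow> crossing (edge_mult G) {y} (verts G) = 3"
    and IH: "\<And>H :: 'v mgraph. card (verts H) < card (verts G) \<Longrightarrow> multigraph H \<Longrightarrow>
      uniform3 (verts H) (edge_mult H) \<Longrightarrow> H \<in> graph_class"
  shows "G \<in> graph_class"
proof -
  interpret weighted_graph "verts G" "edge_mult G" by (rule multigraph_weighted_graph[OF G])
  let ?e = "crossing (edge_mult G)"
  have le: "edge_mult G a b \<le> 1" for a b by (rule uniform3_multiplicity[OF U])
  have deg_card: "?e {a} (verts G) = card {b \<in> verts G. 0 < edge_mult G a b}" for a
  proof -
    have "?e {a} (verts G) = (\<Sum>b\<in>verts G. if 0 < edge_mult G a b then 1 else 0)"
      unfolding crossing_def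
    proof (simp, intro sum.cong refl)
      fix b
      show "edge_mult G a b = (if 0 < edge_mult G a b then 1 else 0)" using le[of a b] by auto
    qed
    then show ?thesis using finite_V by (simp add: sum.inter_filter[symmetric])
  qed
  have "{b \<in> verts G. 0 < edge_mult G x b} \<noteq> {}" using x deg_card[of x] by (metis card.empty not_numeral_le_zero)
  then obtain u where u: "u \<in> verts G" "0 < edge_mult G x u" by blast
  have ux: "u \<noteq> x" "0 < edge_mult G u x" using u edge_mult_pos[OF G, of x u] edge_mult_commute[of G] by auto
  let ?N = "{b \<in> verts G. 0 < edge_mult G u b}"
  have "card ?N = 3" using deg[of u] u ux deg_card[of u] by simp
  then have "card (?N - {x}) = 2" using ux x by (simp add: card_Diff_singleton)
  then obtain v w where vw: "?N - {x} = {v, w}" "v \<noteq> w" by (auto simp: card_2_iff)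
  moreover have "x \<in> ?N" using ux x by simp
  ultimately have N: "?N = {v, w, x}" by blast
  have nb: "0 < edge_mult G u a \<longleftrightarrow> a \<in> {v, w, x}" for a
  proof -
    have "0 < edge_mult G u a \<longleftrightarrow> a \<in> ?N" using edge_mult_pos[OF G, of u a] by blast
    then show ?thesis unfolding N .
  qed
  have "u \<notin> ?N" using edge_mult_refl[OF G, of u] by simp
  then have vwx: "{v, w, x} \<subseteq> verts G - {u}" unfolding N[symmetric] by blast
  have "v \<in> ?N - {x}" "w \<in> ?N - {x}" unfolding vw(1) by blast+
  then have distinct: "distinct [v, w, x]" using vw(2) by simp
  note vwx = vwx distinct
  \<comment> \<open>In a triangle \<open>u\<close>, \<open>v\<close>, \<open>w\<close> each vertex
    would have at most one further edge, so the triangle would be a side of a nontrivial edge cut.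
    Hence the new edge of \<open>H\<close> has no parallel.\<close>
  have "edge_mult G v w = 0"
  proof (rule ccontr)
    assume "edge_mult G v w \<noteq> 0"
    then have pos: "1 \<le> edge_mult G v w" "1 \<le> edge_mult G w v" using edge_mult_commute[of G v w] by auto
    let ?A = "{u, v, w}" and ?B = "verts G - {u, v, w}"
    have uv: "1 \<le> edge_mult G u v" "1 \<le> edge_mult G u w" "1 \<le> edge_mult G v u" "1 \<le> edge_mult G w u"
      using nb[of v] nb[of w] edge_mult_commute[of G u] by auto
    have d: "u \<noteq> v" "u \<noteq> w" "v \<noteq> w" using vwx by auto
    have A: "?e ?A ?B = ?e {u} ?B + ?e {v} ?B + ?e {w} ?B"
      using d by (simp add: crossing_def)
    have "?e {a} (verts G) = ?e {a} ?A + ?e {a} ?B" for a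
      by (rule degree_partition) (use u vwx in auto)
    moreover have "?e {a} (verts G) = 3" if "a \<in> ?A" for a
      using deg[of a] that u ux vwx by auto
    moreover have "?e {a} ?A = edge_mult G a u + edge_mult G a v + edge_mult G a w" for a
      using d by (simp add: crossing_def)
    ultimately have "edge_mult G a u + edge_mult G a v + edge_mult G a w + ?e {a} ?B = 3" if "a \<in> ?A" for a
      using that by metis
    from this[of u] this[of v] this[of w]
    have "?e ?A ?B \<le> 3" using A uv pos by simp
    \<comment> \<open>\<open>x\<close> and its neighbours are at least five vertices, so two remain
      outside the triangle.\<close>
    moreover have "5 \<le> card (verts G)" using uniform3_crossing_less[OF U finite_V x(1)] x(2) by linarith
    then have "2 \<le> card ?B" using u vwx d finite_V by (simp add: card_Diff_subset)
    ultimately have "nontrivial_edge_cut (verts G) (edge_mult G) ?A ?B"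
      using u vwx d by (auto simp: nontrivial_edge_cut_def)
    then show False using no_cut by blast
  qed
  define H where "H = add_edge (del_verts G {u}) v w"
  have VH: "verts H = verts G - {u}" by (simp add: H_def verts_simps)
  have H: "multigraph H" unfolding H_def
    by (intro multigraph_ops G) (use vwx in \<open>auto simp: verts_simps\<close>)
  have uH: "u \<notin> verts H" and ins: "verts G = insert u (verts H)" using u VH by auto
  have vwxH: "{v, w, x} \<subseteq> verts H" using vwx VH by simp
  have inner: "edge_mult H a b = edge_mult G a b + (if {a, b} = {v, w} then 1 else 0)"
    if "a \<in> verts H" "b \<in> verts H" for a b
    using that VH by (auto simp: H_def edge_mult_simps)
  have outer: "edge_mult G u a = (if a \<in> {v, w, x} then 1 else 0)" for a
    using nb[of a] le[of u a] by (auto simp: le_Suc_eq)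
  interpret E: extension "verts H" "edge_mult H" u v w x "edge_mult G"
    by (rule extension_of_graph[OF H G ins uH vwxH vwx(2)]) (use inner outer in auto)
  have UH: "uniform3 (verts H) (edge_mult H)"
    by (rule E.uniform3_reduction; unfold ins[symmetric]) (use U deg x no_cut in auto)
  have "card (verts H) < card (verts G)" unfolding VH using finite_V u(1) by (rule card_Diff1_less)
  then have HC: "H \<in> graph_class" using IH H UH by blast
  have edge: "{v, w} \<in># edges H" by (simp add: H_def add_edge_def)
  have degH: "\<forall>y\<in>verts H - {x}. degree H y = 3"
  proof
    fix y assume y: "y \<in> verts H - {x}"
    then have "degree H y = ?e {y} (verts G)"
      using degree_eq_crossing[OF H, of y] E.ext_degree[of y, folded ins] by simp
    then show "degree H y = 3" using deg[of y] y VH by simp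
  qed
  have "G = extend_graph H v w x u"
  proof (rule mgraph_eqI[OF G multigraph_extend[OF H vwxH uH]])
    show V: "verts G = verts (extend_graph H v w x u)" using ins by (simp add: verts_extend)
    note mX = edge_mult_extend[OF H vwxH vwx(2) uH]
    fix a b
    consider "a \<in> verts H" "b \<in> verts H" | "a = u" "b \<in> verts H" | "b = u" "a \<in> verts H"
      | "a = u" "b = u" | "a \<notin> verts G \<or> b \<notin> verts G" using ins by blast
    then show "edge_mult G a b = edge_mult (extend_graph H v w x u) a b"
    proof cases
      case 1
      then show ?thesis using mX(1)[OF 1] inner[OF 1] by simp
    next
      case 2
      then show ?thesis using mX(2)[OF 2(2)] outer by simp
    next
      case 3
      then show ?thesis using mX(2)[OF 3(2)] outer[of a] edge_mult_commute[of _ a u] by simp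
    next
      case 4
      then show ?thesis using edge_mult_refl[OF G] edge_mult_refl[OF multigraph_extend[OF H vwxH uH]] by simp
    next
      case 5
      then have "edge_mult G a b = 0" "edge_mult (extend_graph H v w x u) a b = 0"
        using edge_mult_pos[OF G, of a b] edge_mult_pos[OF multigraph_extend[OF H vwxH uH], of a b]
        unfolding V by blast+
      then show ?thesis by simp
    qed
  qed
  then show ?thesis
    using graph_class.extend[OF HC vwxH vwx(2) edge degH uH] by (simp add: extend_graph_def)
qed

lemma uniform3_graph_class:
  fixes G :: "'v :: infinite mgraph"
  assumes "multigraph G" "uniform3 (verts G) (edge_mult G)"
  shows "G \<in> graph_class"
  using assms
proof (induction "card (verts G)" arbitrary: G rule: less_induct)
  case less
  interpret weighted_graph "verts G" "edge_mult G" by (rule multigraph_weighted_graph[OF less.prems(1)])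
  let ?d = "\<lambda>v. crossing (edge_mult G) {v} (verts G)"
  have d3: "3 \<le> ?d v" if "v \<in> verts G" for v
    using uniform3_degree[OF weighted_graph_axioms less.prems(2) that] .
  consider A B where "nontrivial_edge_cut (verts G) (edge_mult G) A B"
    | "\<nexists>A B. nontrivial_edge_cut (verts G) (edge_mult G) A B" "\<forall>v\<in>verts G. ?d v = 3"
    | x where "\<nexists>A B. nontrivial_edge_cut (verts G) (edge_mult G) A B" "x \<in> verts G" "4 \<le> ?d x"
    using d3 by (metis Suc_leI eval_nat_numeral(2) le_neq_implies_less numeral_3_eq_3 semiring_norm(26,27))
  then show ?case
  proof cases
    case 1
    then show ?thesis using graph_class_of_nontrivial_edge_cut[OF less.prems] less.hyps by blast
  next
    case 2
    have "simple_graph G"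
      using less.prems uniform3_multiplicity by (simp add: simple_graph_iff)
    moreover have "regular 3 G"
      using 2 degree_eq_crossing[OF less.prems(1)] by (simp add: regular_def)
    ultimately show ?thesis
      using uniform3_three_connected[OF less.prems] by (intro graph_class.cubic)
  next
    case 3
    have "?d y = 3" if "y \<in> verts G - {x}" for y
    proof (rule ccontr)
      \<comment> \<open>A second vertex of high degree would produce a nontrivial edge cut, which
        this case excludes.\<close>
      assume "?d y \<noteq> 3"
      then have "4 \<le> ?d y" using d3[of y] that by simp
      then show False
        using nontrivial_edge_cut_of_two_high_degrees[OF less.prems(2), of x y] 3 that by blast
    qed
    then show ?thesis using graph_class_of_unique_high_degree[OF less.prems 3] less.hyps by blast
  qed
qed

theorem theorem12:
  fixes G :: "'v::infinite mgraph"
  assumes "multigraph G"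
  shows "G \<in> graph_class \<longleftrightarrow> uniformly_3_connected G"
  using graph_class_uniform3 uniform3_graph_class[OF assms] uniformly_3_connected_iff[OF assms]
  by blast

end
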